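(* Let $d\ge 2$, let $\sigma$ be any irreducible permutation of $\{1,\dots,d\}$, and for $s>0$ let $\mathbf a(s)=(s,s^2,\dots,s^d)$. Then for Lebesgue almost every $s>0$, the interval exchange transformation associated to $(\sigma,\mathbf a(s))$ is uniquely ergodic.
   Context: A permutation $\sigma$ of $\{1,\dots,d\}$ is irreducible if whenever $\{1,\dots,k\}$ with $1\le k\le d$ is invariant under $\sigma$, then $k=d$. Interval exchange transformation: for $\mathbf a=(a_1,\dots,a_d)\in\mathbb R^d$ with all $a_i>0$, let $x_i=\sum_{j\le i}a_j$ and $x'_i=\sum_{j\le i}a_{\sigma^{-1}(j)}$ for $0\le i\le d$, let $I_{\mathbf a}=[0,\sum_i a_i)$ and $I_i=[x_{i-1},x_i)$ for $1\le i\le d$. The interval exchange transformation $T:I_{\mathbf a}\to I_{\mathbf a}$ associated to $(\sigma,\mathbf a)$ is $T(x)=x-x_j+x'_{\sigma(j)}$ for $x\in I_j$; that is, $T$ permutes the intervals $I_j$ by translations according to $\sigma$. $T$ is uniquely ergodic if the only $T$-invariant Borel probability measure on $I_{\mathbf a}$ is (normalized) Lebesgue measure. *)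

theory Defs
  imports "HOL-Probability.Probability" "HOL-Combinatorics.Permutations"
begin

definition irreducible_perm :: "nat \<Rightarrow> (nat \<Rightarrow> nat) \<Rightarrow> bool" where
  "irreducible_perm d \<sigma> \<longleftrightarrow>
     \<sigma> permutes {1..d} \<and> (\<forall>k\<in>{1..d}. \<sigma> ` {1..k} \<subseteq> {1..k} \<longrightarrow> k = d)"

text \<open>Length vectors are functions on \<open>nat\<close>, of which only the values at \<open>1, \<dots>, d\<close> are used.
  The endpoints \<open>x\<^sub>i\<close> and \<open>x'\<^sub>i\<close> of the subintervals before and after the exchange:\<close>

definition iet_endpt :: "(nat \<Rightarrow> real) \<Rightarrow> nat \<Rightarrow> real" where
  "iet_endpt a i = (\<Sum>j=1..i. a j)"

definition iet_endpt' :: "(nat \<Rightarrow> nat) \<Rightarrow> (nat \<Rightarrow> real) \<Rightarrow> nat \<Rightarrow> real" where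
  "iet_endpt' \<sigma> a i = (\<Sum>j=1..i. a (inv \<sigma> j))"

definition iet_domain :: "nat \<Rightarrow> (nat \<Rightarrow> real) \<Rightarrow> real set" where
  "iet_domain d a = {0..<(\<Sum>i=1..d. a i)}"

definition iet_interval :: "(nat \<Rightarrow> real) \<Rightarrow> nat \<Rightarrow> real set" where
  "iet_interval a i = {iet_endpt a (i - 1)..<iet_endpt a i}"

text \<open>Meaningful only if \<open>a\<close> is positive on \<open>{1..d}\<close>; then every point of \<open>iet_domain d a\<close>
  lies in exactly one subinterval. Outside the domain the value is unspecified.\<close>

definition iet :: "nat \<Rightarrow> (nat \<Rightarrow> nat) \<Rightarrow> (nat \<Rightarrow> real) \<Rightarrow> real \<Rightarrow> real" where
  "iet d \<sigma> a x =
     (let j = (THE j. j \<in> {1..d} \<and> x \<in> iet_interval a j)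
      in x - iet_endpt a j + iet_endpt' \<sigma> a (\<sigma> j))"

definition invariant_measure :: "('a \<Rightarrow> 'a) \<Rightarrow> 'a measure \<Rightarrow> bool" where
  "invariant_measure T M \<longleftrightarrow> T \<in> measurable M M \<and> distr M M T = M"

text \<open>The equivalence says both that normalized Lebesgue measure on \<open>I\<close> is invariant and that
  no other Borel probability measure on \<open>I\<close> is.\<close>

definition uniquely_ergodic_on :: "real set \<Rightarrow> (real \<Rightarrow> real) \<Rightarrow> bool" where
  "uniquely_ergodic_on I T \<longleftrightarrow>
     (\<forall>M. sets M = sets (restrict_space borel I) \<and> prob_space M \<and> invariant_measure T M
        \<longleftrightarrow> M = uniform_measure (restrict_space lborel I) I)"

end

theory Submission
  imports Defs
begin

text \<open>The proof avoids renormalization. Unique ergodicity follows if, for some fixed \<open>e > 0\<close> and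
  infinitely many \<open>H\<close>, no orbit segment of length \<open>H\<close> starting at a discontinuity of \<open>T\<inverse>\<close> comes
  \<open>e / H\<close>-close to a discontinuity of \<open>T\<close>: then every interval of length at most \<open>e / H\<close> flows
  disjointly for about \<open>H / 2\<close> steps forwards or backwards, so every invariant set looks trivial on
  all intervals at that scale.

  If the condition fails at time \<open>H\<close>, consider a long chain of scales \<open>w\<^sub>0 < \<dots> < w\<^sub>M \<approx> 1 / H\<close> with ratio
  \<open>A\<close>. A combinatorial argument, using that no proper union of intervals traps its orbits, yields an
  isolated near-connection at some pair of consecutive scales: an orbit of a discontinuity \<open>x'\<close> that stays
  \<open>w\<^sub>i\<^sub>+\<^sub>1\<close>-away from all discontinuities until it comes \<open>w\<^sub>i\<close>-close to one.

  For the lengths \<open>s, s\<^sup>2, \<dots>, s\<^sup>d\<close>, irreducibility and the fact that the exponents increase with the index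
  make the distance between the two points move with \<open>s\<close> at a speed comparable to the elapsed time. Hence
  isolated near-connections occur only for a set of parameters of measure \<open>O(1 / A)\<close>, uniformly in \<open>H\<close>. As
  \<open>A\<close> is arbitrary, the parameters that are bad for all large \<open>H\<close> form a null set.\<close>

section \<open>Half exchanges and orbits avoiding the singularities\<close>

text \<open>Isolation is what makes the bound independent of \<open>H\<close>. A plain union bound
  over the times \<open>k < H\<close> is too weak: at each time, near-connections at distance
  \<open>w\<close> are to be expected for parameters of measure of order \<open>w\<close>, and these
  add up to order \<open>H * w\<close>, which is not small when \<open>w\<close> is about
  \<open>1 / H\<close>. An isolated hit at time \<open>k\<close>, however, owns a parameter window
  of radius about \<open>W / (k + 1)\<close>: there the itinerary up to \<open>k\<close> persists
  and no other time can give an isolated hit of the same orbit. The speed of order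
  \<open>k + 1\<close> confines the hits to radius about \<open>\<mu> / (k + 1)\<close> inside this
  window. The factor \<open>k + 1\<close> cancels, and the density \<open>\<mu> / W = 1 / A\<close>
  remains. The number of scales depends on \<open>d\<close> only, so \<open>A\<close> can be chosen
  after it, and \<open>e\<close> is then fixed in terms of \<open>A\<close>. The parameters that are
  bad for all large \<open>H\<close> form an increasing union of sets, each contained in the bad set
  of a single \<open>H\<close>; this is why a bound uniform in \<open>H\<close> suffices without any
  summation over \<open>H\<close>. The same estimate with \<open>\<mu> = 0\<close> shows that exact
  connections occur only for a null set of parameters.\<close>

definition ok :: "real \<Rightarrow> real \<Rightarrow> (real \<Rightarrow> real) \<Rightarrow> real set \<Rightarrow> nat \<Rightarrow> real \<Rightarrow> bool" where
  "ok lo hi T D h y \<longleftrightarrow> (\<forall>t<h. (T ^^ t) y \<in> {lo<..<hi} - D)"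

text \<open>The interval is open, so its ends may be singularities. A free interval is moved rigidly
  by \<open>T ^^ t\<close> for every \<open>t \<le> h\<close> (\<open>free_tr\<close>): it is the
  base of a tower of translates.\<close>

definition free :: "real \<Rightarrow> real \<Rightarrow> (real \<Rightarrow> real) \<Rightarrow> real set \<Rightarrow> real \<Rightarrow> real \<Rightarrow> nat \<Rightarrow> bool" where
  "free lo hi T D a b h \<longleftrightarrow> lo \<le> a \<and> a < b \<and> b \<le> hi \<and> (\<forall>y\<in>{a<..<b}. ok lo hi T D h y)"

definition mir :: "(real \<Rightarrow> real) \<Rightarrow> real \<Rightarrow> real" where
  "mir T y = - T (- y)"

lemma mir_mir [simp]: "mir (mir T) = T"
  by (simp add: mir_def fun_eq_iff)

lemma mir_funpow: "(mir T ^^ t) y = - (T ^^ t) (- y)"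
  by (induction t) (auto simp: mir_def)

lemma mem_uminus_image: "x \<in> uminus ` D \<longleftrightarrow> - x \<in> D" for x :: real
  by force

lemma ok_mir: "ok (-hi) (-lo) (mir T) (uminus ` D) h y \<longleftrightarrow> ok lo hi T D h (- y)"
  unfolding ok_def mir_funpow by (auto simp: mem_uminus_image)

lemma free_mir: "free (-hi) (-lo) (mir T) (uminus ` D) a b h \<longleftrightarrow> free lo hi T D (-b) (-a) h"
proof -
  have "(\<forall>y\<in>{a<..<b}. ok lo hi T D h (-y)) \<longleftrightarrow> (\<forall>y\<in>{-b<..<-a}. ok lo hi T D h y)"
    by (metis add.inverse_inverse greaterThanLessThan_iff neg_less_iff_less)
  then show ?thesis unfolding free_def ok_mir by auto
qed

lemma ok_0 [simp]: "ok lo hi T D 0 y"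
  by (simp add: ok_def)

lemma ok_mono: "ok lo hi T D h y \<Longrightarrow> k \<le> h \<Longrightarrow> ok lo hi T D k y"
  by (auto simp: ok_def)

lemma ok_Suc: "ok lo hi T D (Suc h) y \<longleftrightarrow> ok lo hi T D h y \<and> (T ^^ h) y \<in> {lo<..<hi} - D"
  by (auto simp: ok_def less_Suc_eq)

lemma ok_add: "ok lo hi T D (h + k) y \<longleftrightarrow> ok lo hi T D h y \<and> ok lo hi T D k ((T ^^ h) y)"
proof (induction k)
  case (Suc k)
  have "(T ^^ (h + k)) y = (T ^^ k) ((T ^^ h) y)"
    by (metis add.commute comp_apply funpow_add)
  with Suc show ?case by (simp add: ok_Suc)
qed simp

lemma free_mono: "free lo hi T D a b h \<Longrightarrow> k \<le> h \<Longrightarrow> a \<le> a' \<Longrightarrow> a' < b' \<Longrightarrow> b' \<le> b \<Longrightarrow> free lo hi T D a' b' k"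
  unfolding free_def by (auto intro: ok_mono)

lemma free_join: "free lo hi T D a c h \<Longrightarrow> free lo hi T D c b h \<Longrightarrow> ok lo hi T D h c \<Longrightarrow> free lo hi T D a b h"
  unfolding free_def by (metis greaterThanLessThan_iff less_linear order_less_trans)

lemma free_ok: "free lo hi T D a b h \<Longrightarrow> a < y \<Longrightarrow> y < b \<Longrightarrow> ok lo hi T D h y"
  by (auto simp: free_def)

lemma free_bounds: "free lo hi T D a b h \<Longrightarrow> lo \<le> a \<and> a < b \<and> b \<le> hi"
  by (auto simp: free_def)

lemma free_add:
  assumes "free lo hi T D a b h" "\<And>y. a < y \<Longrightarrow> y < b \<Longrightarrow> (T ^^ h) y = y + c"
    and "free lo hi T D (a + c) (b + c) k"
  shows "free lo hi T D a b (h + k)"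
  using assms unfolding free_def ok_add by auto

lemma free_drop:
  assumes "free lo hi T D a b (h + k)" "\<And>y. a < y \<Longrightarrow> y < b \<Longrightarrow> (T ^^ h) y = y + c"
    and "lo \<le> a + c" "b + c \<le> hi"
  shows "free lo hi T D (a + c) (b + c) k"
  unfolding free_def
proof (intro conjI ballI)
  fix y assume "y \<in> {a + c<..<b + c}"
  then have *: "a < y - c" "y - c < b" by auto
  then have "ok lo hi T D (h + k) (y - c)" using free_ok[OF assms(1)] by blast
  then show "ok lo hi T D k y" using assms(2)[OF *] by (simp add: ok_add)
qed (use assms free_bounds[OF assms(1)] in auto)

text \<open>The axioms retain only what the combinatorics needs, so that they are stable under the reflection
  \<open>y \<mapsto> - y\<close> and, in \<open>exch\<close> below, under inversion; every one-sided statement is then proved only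
  once. In \<open>rgerm\<close> and \<open>lgerm\<close> a singularity may be sent to an end of the interval; the next step
  then leads to a point of \<open>D'\<close>.\<close>
locale exch_half =
  fixes lo hi w0 :: real and T :: "real \<Rightarrow> real" and D D' :: "real set"
  assumes fin: "finite D" and w0: "w0 > 0" and lohi: "lo < hi"
    and D_in: "x \<in> D \<Longrightarrow> lo + w0 \<le> x \<and> x \<le> hi - w0"
    and maps: "y \<in> {lo<..<hi} - D \<Longrightarrow> T y \<in> {lo<..<hi} - D'"
    and trans: "lo \<le> a \<Longrightarrow> a < b \<Longrightarrow> b \<le> hi \<Longrightarrow> {a<..<b} \<inter> D = {} \<Longrightarrow> \<exists>c. \<forall>y\<in>{a<..<b}. T y = y + c"
    and rgerm: "x \<in> insert lo D \<Longrightarrow> \<exists>x'\<in>insert lo D'. (x = lo \<longrightarrow> x' \<noteq> lo) \<and> (\<forall>v\<in>{0<..<w0}. T (x + v) = x' + v)"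
    and lgerm: "x \<in> insert hi D \<Longrightarrow> \<exists>x'\<in>insert hi D'. (x = hi \<longrightarrow> x' \<noteq> hi) \<and> (\<forall>v\<in>{0<..<w0}. T (x - v) = x' - v)"
    and sep: "x \<in> D \<Longrightarrow> y \<in> D \<Longrightarrow> x < y \<Longrightarrow> w0 \<le> y - x"
begin

abbreviation "Ok \<equiv> ok lo hi T D"
abbreviation "Free \<equiv> free lo hi T D"

lemma mirror: "exch_half (-hi) (-lo) w0 (mir T) (uminus ` D) (uminus ` D')"
proof
  show "finite (uminus ` D)" using fin by simp
  show "w0 > 0" by (rule w0)
  show "-hi < -lo" using lohi by simp
  show "- hi + w0 \<le> x \<and> x \<le> - lo - w0" if "x \<in> uminus ` D" for x
    using that D_in[of "-x"] by (auto simp: mem_uminus_image)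
  show "mir T y \<in> {- hi<..<- lo} - uminus ` D'" if "y \<in> {- hi<..<- lo} - uminus ` D" for y
    using that maps[of "-y"] by (auto simp: mem_uminus_image mir_def)
  show "\<exists>c. \<forall>y\<in>{a<..<b}. mir T y = y + c"
    if "- hi \<le> a" "a < b" "b \<le> - lo" "{a<..<b} \<inter> uminus ` D = {}" for a b
  proof -
    have "{-b<..<-a} \<inter> D = {}"
    proof -
      have "\<not> (-b < x \<and> x < -a)" if "x \<in> D" for x
        using that \<open>{a<..<b} \<inter> uminus ` D = {}\<close> by (auto simp: mem_uminus_image disjoint_iff dest!: spec[of _ "-x"])
      then show ?thesis by auto
    qed
    then obtain c where c: "\<forall>y\<in>{-b<..<-a}. T y = y + c"
      using trans[of "-b" "-a"] \<open>-hi \<le> a\<close> \<open>a < b\<close> \<open>b \<le> -lo\<close> by auto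
    have "mir T y = y + (-c)" if "y \<in> {a<..<b}" for y
      using c[rule_format, of "-y"] that by (auto simp: mir_def)
    then show ?thesis by blast
  qed
  show "\<exists>x'\<in>insert (- hi) (uminus ` D'). (x = -hi \<longrightarrow> x' \<noteq> -hi) \<and> (\<forall>v\<in>{0<..<w0}. mir T (x + v) = x' + v)"
    if "x \<in> insert (- hi) (uminus ` D)" for x
  proof -
    have "-x \<in> insert hi D" using that by auto
    from lgerm[OF this] obtain x' where "x' \<in> insert hi D'" "-x = hi \<longrightarrow> x' \<noteq> hi" "\<forall>v\<in>{0<..<w0}. T (-x - v) = x' - v" by auto
    then show ?thesis by (intro bexI[of _ "-x'"]) (auto simp: mir_def)
  qed
  show "\<exists>x'\<in>insert (- lo) (uminus ` D'). (x = -lo \<longrightarrow> x' \<noteq> -lo) \<and> (\<forall>v\<in>{0<..<w0}. mir T (x - v) = x' - v)"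
    if "x \<in> insert (- lo) (uminus ` D)" for x
  proof -
    have "-x \<in> insert lo D" using that by auto
    from rgerm[OF this] obtain x' where "x' \<in> insert lo D'" "-x = lo \<longrightarrow> x' \<noteq> lo" "\<forall>v\<in>{0<..<w0}. T (-x + v) = x' + v" by auto
    then show ?thesis by (intro bexI[of _ "-x'"]) (auto simp: mir_def algebra_simps)
  qed
  show "w0 \<le> y - x" if "x \<in> uminus ` D" "y \<in> uminus ` D" "x < y" for x y
    using that sep[of "-y" "-x"] by (auto simp: mem_uminus_image)
qed

text \<open>The image at each time below \<open>h\<close> misses \<open>D\<close>, so
  \<open>trans\<close> moves it as one piece. \<open>maps\<close> controls only the open image;
  density of the reals carries the bounds over to its ends.\<close>

lemma free_tr:
  assumes "Free a b h" "t \<le> h"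
  obtains c where "lo \<le> a + c" "b + c \<le> hi" "\<And>y. a < y \<Longrightarrow> y < b \<Longrightarrow> (T ^^ t) y = y + c"
proof -
  have "\<exists>c. lo \<le> a + c \<and> b + c \<le> hi \<and> (\<forall>y\<in>{a<..<b}. (T ^^ t) y = y + c)"
    using assms(2)
  proof (induction t)
    case 0
    then show ?case using free_bounds[OF assms(1)] by (intro exI[of _ 0]) auto
  next
    case (Suc t)
    then obtain c where c: "lo \<le> a + c" "b + c \<le> hi" "\<forall>y\<in>{a<..<b}. (T ^^ t) y = y + c" by auto
    have in_D: "z \<in> {lo<..<hi} - D" if "z \<in> {a + c<..<b + c}" for z
    proof -
      have *: "z - c \<in> {a<..<b}" using that by auto
      then have "(T ^^ t) (z - c) = z" using c(3) by auto
      moreover have "(T ^^ t) (z - c) \<in> {lo<..<hi} - D"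
        using assms(1) * Suc.prems unfolding free_def ok_def by auto
      ultimately show ?thesis by simp
    qed
    have "{a + c<..<b + c} \<inter> D = {}" using in_D by auto
    moreover have "a + c < b + c" using free_bounds[OF assms(1)] by simp
    ultimately obtain c' where c': "\<forall>y\<in>{a + c<..<b + c}. T y = y + c'"
      using trans[of "a + c" "b + c"] c by auto
    have tr: "(T ^^ Suc t) y = y + (c + c')" if "y \<in> {a<..<b}" for y
      using that c(3) c' by simp
    have im: "y + (c + c') \<in> {lo<..<hi}" if "y \<in> {a<..<b}" for y
    proof -
      have "y + c \<in> {lo<..<hi} - D" using in_D that by auto
      then have "T (y + c) \<in> {lo<..<hi}" using maps by blast
      then show ?thesis using c' that by auto
    qed
    have "lo - (c + c') \<le> a"
    proof (rule dense_ge_bounded[of _ b])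
      show "a < b" using free_bounds[OF assms(1)] by simp
      show "lo - (c + c') \<le> w" if "a < w" "w < b" for w
        using im[of w] that by auto
    qed
    moreover have "b \<le> hi - (c + c')"
    proof (rule dense_le_bounded[of a])
      show "a < b" using free_bounds[OF assms(1)] by simp
      show "w \<le> hi - (c + c')" if "a < w" "w < b" for w
        using im[of w] that by auto
    qed
    ultimately show ?case using tr by (intro exI[of _ "c + c'"]) auto
  qed
  then show ?thesis using that by auto
qed

lemma ok_nbhd:
  assumes "y \<in> {lo<..<hi}" "Ok h y"
  obtains \<eta> where "\<eta> > 0" "Free (y - \<eta>) (y + \<eta>) h"
proof -
  have "\<exists>\<eta>>0. Free (y - \<eta>) (y + \<eta>) h"
    using assms(2)
  proof (induction h)
    case 0
    have "Free (y - min (y - lo) (hi - y)) (y + min (y - lo) (hi - y)) 0"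
      using assms(1) unfolding free_def by auto
    then show ?case using assms(1) by (intro exI[of _ "min (y - lo) (hi - y)"]) auto
  next
    case (Suc h)
    then obtain \<eta> where \<eta>: "\<eta> > 0" "Free (y - \<eta>) (y + \<eta>) h" by (auto simp: ok_Suc)
    obtain c where c: "lo \<le> y - \<eta> + c" "y + \<eta> + c \<le> hi" "\<And>z. y - \<eta> < z \<Longrightarrow> z < y + \<eta> \<Longrightarrow> (T ^^ h) z = z + c"
      using free_tr[OF \<eta>(2) order_refl] by blast
    have "y + c \<notin> D" using Suc.prems c(3)[of y] \<eta>(1) by (auto simp: ok_Suc)
    moreover have "open (- D)" using fin finite_imp_closed by blast
    ultimately obtain e where e: "e > 0" "\<And>z. dist z (y + c) < e \<Longrightarrow> z \<notin> D"
      unfolding open_dist by auto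
    define d where "d = min \<eta> e"
    have "Free (y - d) (y + d) (Suc h)"
      unfolding free_def ok_Suc
    proof (intro conjI ballI)
      fix z assume z: "z \<in> {y - d<..<y + d}"
      then have z2: "y - \<eta> < z" "z < y + \<eta>" by (auto simp: d_def)
      then show "Ok h z" using free_ok[OF \<eta>(2)] by auto
      have "dist (z + c) (y + c) < e" using z by (auto simp: d_def dist_real_def)
      then have "z + c \<notin> D" using e(2) by blast
      then show "(T ^^ h) z \<in> {lo<..<hi} - D" using c z2 by auto
    qed (use free_bounds[OF \<eta>(2)] \<eta>(1) e(1) in \<open>auto simp: d_def\<close>)
    then show ?case using \<eta>(1) e(1) by (intro exI[of _ d]) (auto simp: d_def)
  qed
  then show ?thesis using that by auto
qed

text \<open>Here \<open>p\<close> may be an end of the interval, where \<open>free\<close> says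
  nothing. \<open>Ok h p\<close> gives \<open>p\<close> a two-sided free neighbourhood, and the two
  translations agree on the overlap. This ties the strips beside a point of \<open>D'\<close> to the
  orbit of the point itself.\<close>

lemma free_tr_pt:
  assumes "Free a b h" "t \<le> h" "p \<in> {lo<..<hi}" "Ok h p" "a \<le> p" "p \<le> b" "a < y" "y < b"
  shows "(T ^^ t) y = (T ^^ t) p + (y - p)"
proof -
  obtain \<eta> where \<eta>: "\<eta> > 0" "Free (p - \<eta>) (p + \<eta>) h" using ok_nbhd assms by blast
  obtain c where c: "\<And>y. a < y \<Longrightarrow> y < b \<Longrightarrow> (T ^^ t) y = y + c" using free_tr[OF assms(1,2)] by blast
  obtain c2 where c2: "\<And>y. p - \<eta> < y \<Longrightarrow> y < p + \<eta> \<Longrightarrow> (T ^^ t) y = y + c2" using free_tr[OF \<eta>(2) assms(2)] by blast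
  have "max a (p - \<eta>) < min b (p + \<eta>)" using assms \<eta> free_bounds[OF assms(1)] by auto
  then obtain z where "max a (p - \<eta>) < z" "z < min b (p + \<eta>)" using dense by blast
  then have "c = c2" using c[of z] c2[of z] by auto
  then show ?thesis using c[of y] c2[of p] assms \<eta> by auto
qed

text \<open>\<open>maps\<close> keeps an orbit strictly inside until its first visit to
  \<open>D\<close>, so such a visit is the only way to fail.\<close>

lemma not_ok_first:
  assumes "y \<in> {lo<..<hi}" "\<not> Ok h y"
  obtains t where "t < h" "Ok t y" "(T ^^ t) y \<in> D"
proof -
  have "\<exists>t<h. Ok t y \<and> (T ^^ t) y \<in> D"
    using assms(2)
  proof (induction h)
    case (Suc h)
    show ?case
    proof (cases "Ok h y")
      case True
      have "(T ^^ h) y \<in> {lo<..<hi}"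
      proof (cases h)
        case 0
        then show ?thesis using assms by simp
      next
        case (Suc k)
        then show ?thesis using True maps[of "(T ^^ k) y"] by (auto simp: ok_Suc)
      qed
      then show ?thesis using True Suc.prems by (auto simp: ok_Suc)
    next
      case False
      then show ?thesis using Suc.IH less_SucI by blast
    qed
  qed simp
  then show ?thesis using that by blast
qed

lemma ok_in: "y \<in> {lo<..<hi} \<Longrightarrow> Ok h y \<Longrightarrow> t \<le> h \<Longrightarrow> (T ^^ t) y \<in> {lo<..<hi}"
proof (cases t)
  case (Suc k)
  assume "Ok h y" "t \<le> h"
  then have "(T ^^ k) y \<in> {lo<..<hi} - D" using Suc by (auto simp: ok_def)
  then show ?thesis using maps Suc by auto
qed auto

text \<open>Taking the least time at which any point of the interval fails, rather than the failure
  time of one point, keeps the whole interval free up to the hit.\<close>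

lemma first_hit:
  assumes "\<not> Free a b h" "lo \<le> a" "a < b" "b \<le> hi"
  obtains t y where "t < h" "a < y" "y < b" "Free a b t" "(T ^^ t) y \<in> D"
proof -
  define P where "P t \<longleftrightarrow> (\<exists>y\<in>{a<..<b}. \<not> Ok (Suc t) y)" for t
  obtain y where y: "a < y" "y < b" "\<not> Ok h y" using assms unfolding free_def by auto
  then obtain t where t: "t < h" "Ok t y" "(T ^^ t) y \<in> D" using not_ok_first[of y h] assms by auto
  have "P t" using t y unfolding P_def by (auto simp: ok_Suc)
  define m where "m = (LEAST t. P t)"
  have Pm: "P m" "m \<le> t" using \<open>P t\<close> unfolding m_def by (auto intro: LeastI Least_le)
  have fr: "Free a b m"
  proof (cases m)
    case 0
    then show ?thesis using assms unfolding free_def by auto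
  next
    case (Suc k)
    then have "\<not> P k" using not_less_Least[of k P] by (auto simp: m_def)
    then show ?thesis using assms Suc unfolding free_def P_def by auto
  qed
  obtain z where z: "a < z" "z < b" "\<not> Ok (Suc m) z" using Pm unfolding P_def by auto
  then have "Ok m z" using free_ok[OF fr] by auto
  then have "(T ^^ m) z \<in> {lo<..<hi}" using z assms by (intro ok_in[of z m]) auto
  then have "(T ^^ m) z \<in> D" using z \<open>Ok m z\<close> by (auto simp: ok_Suc)
  then show ?thesis using that[of m z] z fr Pm t by auto
qed

end

section \<open>Cylinders and one-sided near-connections\<close>

definition near :: "real set \<Rightarrow> real \<Rightarrow> real \<Rightarrow> bool" where
  "near D \<mu> y \<longleftrightarrow> (\<exists>x\<in>D. \<bar>y - x\<bar> \<le> \<mu>)"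

definition isolated :: "(real \<Rightarrow> real) \<Rightarrow> real set \<Rightarrow> real set \<Rightarrow> nat \<Rightarrow> real \<Rightarrow> real \<Rightarrow> bool" where
  "isolated T D D' H \<mu> W \<longleftrightarrow>
     (\<exists>x'\<in>D'. \<exists>k<H. near D \<mu> ((T ^^ k) x') \<and> (\<forall>t<k. \<not> near D W ((T ^^ t) x')))"

text \<open>A quantitative form of minimality: if the union of the intervals returns to itself
  within \<open>K\<close> steps, then \<open>K\<close> of its images must cover the whole interval
  up to a null set. Orbits that meet \<open>D\<close> in the meantime are exempt; they come from
  finitely many points.\<close>

definition no_trap :: "real \<Rightarrow> real \<Rightarrow> (real \<Rightarrow> real) \<Rightarrow> real set \<Rightarrow> bool" where
  "no_trap lo hi T D \<longleftrightarrow>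
     (\<forall>P K. finite P \<and> P \<noteq> {} \<and> (\<forall>(p, r)\<in>P. lo \<le> p \<and> p < r \<and> r \<le> hi) \<and>
        (\<forall>y\<in>(\<Union>(p, r)\<in>P. {p<..<r}). ok lo hi T D K y \<longrightarrow>
            (\<exists>t\<in>{1..K}. (T ^^ t) y \<in> (\<Union>(p, r)\<in>P. {p<..<r})))
        \<longrightarrow> hi - lo \<le> real K * (\<Sum>(p, r)\<in>P. r - p))"

lemma near_mono: "near D \<mu> y \<Longrightarrow> \<mu> \<le> \<mu>' \<Longrightarrow> near D \<mu>' y"
  unfolding near_def by force

lemma near_mir: "near (uminus ` D) \<mu> (- y) \<longleftrightarrow> near D \<mu> y"
  unfolding near_def by (force simp: abs_minus_commute)

lemma isolated_mir: "isolated (mir T) (uminus ` D) (uminus ` D') H \<mu> W \<longleftrightarrow> isolated T D D' H \<mu> W"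
  unfolding isolated_def mir_funpow by (simp add: near_mir)

lemma no_trap_mir:
  assumes "no_trap lo hi T D"
  shows "no_trap (-hi) (-lo) (mir T) (uminus ` D)"
  unfolding no_trap_def
proof (intro allI impI)
  fix P K
  assume A: "finite P \<and> P \<noteq> {} \<and> (\<forall>(p, r)\<in>P. - hi \<le> p \<and> p < r \<and> r \<le> - lo) \<and>
    (\<forall>y\<in>\<Union>(p, r)\<in>P. {p<..<r}. ok (- hi) (- lo) (mir T) (uminus ` D) K y \<longrightarrow>
       (\<exists>t\<in>{1..K}. (mir T ^^ t) y \<in> (\<Union>(p, r)\<in>P. {p<..<r})))"
  define f where "f = (\<lambda>(p, r). (- r, - p) :: real \<times> real)"
  have inj: "inj_on f P" by (auto simp: inj_on_def f_def)
  have U: "y \<in> (\<Union>(p, r)\<in>f ` P. {p<..<r}) \<longleftrightarrow> - y \<in> (\<Union>(p, r)\<in>P. {p<..<r})" for y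
    by (force simp: f_def)
  have "hi - lo \<le> real K * (\<Sum>(p, r)\<in>f ` P. r - p)"
  proof (rule assms[unfolded no_trap_def, rule_format], intro conjI)
    show "\<forall>y\<in>\<Union>(p, r)\<in>f ` P. {p<..<r}. ok lo hi T D K y \<longrightarrow>
       (\<exists>t\<in>{1..K}. (T ^^ t) y \<in> (\<Union>(p, r)\<in>f ` P. {p<..<r}))"
    proof (intro ballI impI)
      fix y assume y: "y \<in> (\<Union>(p, r)\<in>f ` P. {p<..<r})" "ok lo hi T D K y"
      then have "- y \<in> (\<Union>(p, r)\<in>P. {p<..<r})" "ok (-hi) (-lo) (mir T) (uminus ` D) K (- y)"
        using U by (auto simp: ok_mir)
      then obtain t where "t \<in> {1..K}" "(mir T ^^ t) (- y) \<in> (\<Union>(p, r)\<in>P. {p<..<r})" using A by blast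
      then show "\<exists>t\<in>{1..K}. (T ^^ t) y \<in> (\<Union>(p, r)\<in>f ` P. {p<..<r})"
        unfolding U mir_funpow by (intro bexI[of _ t]) auto
    qed
  qed (use A in \<open>auto simp: f_def\<close>)
  also have "(\<Sum>(p, r)\<in>f ` P. r - p) = (\<Sum>(p, r)\<in>P. r - p)"
    unfolding sum.reindex[OF inj] by (intro sum.cong) (auto simp: f_def)
  finally show "- lo - - hi \<le> real K * (\<Sum>(p, r)\<in>P. r - p)" by simp
qed

text \<open>\<open>NC\<close> is Keane's condition: no forward orbit of a singularity of
  \<open>S\<close> meets a singularity of \<open>T\<close>. It is stated so as to keep these orbits
  off the two ends as well.\<close>

locale exch = F: exch_half lo hi w0 T D D' + B: exch_half lo hi w0 S D' D
  for lo hi w0 T S D D' +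
  assumes ST: "y \<in> {lo<..<hi} - D \<Longrightarrow> S (T y) = y"
    and TS: "y \<in> {lo<..<hi} - D' \<Longrightarrow> T (S y) = y"
    and NC: "x' \<in> D' \<Longrightarrow> (T ^^ k) x' \<in> {lo<..<hi} - D"
begin

lemma D'_in: "x' \<in> D' \<Longrightarrow> x' \<in> {lo<..<hi}"
  using B.D_in[of x'] F.w0 by auto

lemma D_in': "x \<in> D \<Longrightarrow> x \<in> {lo<..<hi}"
  using F.D_in[of x] F.w0 by auto

lemma ok_D': "x' \<in> D' \<Longrightarrow> F.Ok k x'"
  using NC by (auto simp: ok_def)

lemma T_back: "y \<in> {lo<..<hi} \<Longrightarrow> B.Ok k y \<Longrightarrow> s \<le> k \<Longrightarrow> (T ^^ s) ((S ^^ k) y) = (S ^^ (k - s)) y"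
proof (induction s)
  case (Suc s)
  then obtain j where "k = Suc (s + j)" using less_iff_Suc_add Suc_le_eq by auto
  then have j: "k - s = Suc j" "j < k" "k - Suc s = j" by auto
  have "(T ^^ Suc s) ((S ^^ k) y) = T ((S ^^ (k - s)) y)" using Suc by simp
  also have "\<dots> = T (S ((S ^^ j) y))" using j by simp
  also have "\<dots> = (S ^^ j) y" using Suc.prems j by (intro TS) (auto simp: ok_def)
  finally show ?case using j by simp
qed simp

lemma S_back: "y \<in> {lo<..<hi} \<Longrightarrow> F.Ok k y \<Longrightarrow> s \<le> k \<Longrightarrow> (S ^^ s) ((T ^^ k) y) = (T ^^ (k - s)) y"
proof (induction s)
  case (Suc s)
  then obtain j where "k = Suc (s + j)" using less_iff_Suc_add Suc_le_eq by auto
  then have j: "k - s = Suc j" "j < k" "k - Suc s = j" by auto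
  have "(S ^^ Suc s) ((T ^^ k) y) = S ((T ^^ (k - s)) y)" using Suc by simp
  also have "\<dots> = S (T ((T ^^ j) y))" using j by simp
  also have "\<dots> = (T ^^ j) y" using Suc.prems j by (intro ST) (auto simp: ok_def)
  finally show ?case using j by simp
qed simp

lemma NC': "x \<in> D \<Longrightarrow> (S ^^ k) x \<in> {lo<..<hi} - D'"
proof (induction k rule: less_induct)
  case (less k)
  then have okk: "B.Ok k x" by (auto simp: ok_def)
  have xin: "x \<in> {lo<..<hi}" using D_in' less by auto
  have "(S ^^ k) x \<in> {lo<..<hi}" using B.ok_in[OF xin okk] by blast
  moreover have "(S ^^ k) x \<notin> D'"
  proof
    assume "(S ^^ k) x \<in> D'"
    then have "(T ^^ k) ((S ^^ k) x) \<notin> D" using NC by blast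
    moreover have "(T ^^ k) ((S ^^ k) x) = x" using T_back[OF xin okk, of k] by simp
    ultimately show False using less by simp
  qed
  ultimately show ?case by auto
qed

lemma inverse: "exch lo hi w0 S T D' D"
  by unfold_locales (use TS ST NC' in auto)

lemma mirror: "exch (-hi) (-lo) w0 (mir T) (mir S) (uminus ` D) (uminus ` D')"
proof -
  interpret MF: exch_half "-hi" "-lo" w0 "mir T" "uminus ` D" "uminus ` D'" by (rule F.mirror)
  interpret MB: exch_half "-hi" "-lo" w0 "mir S" "uminus ` D'" "uminus ` D" by (rule B.mirror)
  show ?thesis
  proof unfold_locales
    show "mir S (mir T y) = y" if "y \<in> {- hi<..<- lo} - uminus ` D" for y
      using ST[of "-y"] that by (auto simp: mir_def mem_uminus_image)
    show "mir T (mir S y) = y" if "y \<in> {- hi<..<- lo} - uminus ` D'" for y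
      using TS[of "-y"] that by (auto simp: mir_def mem_uminus_image)
    show "(mir T ^^ k) x' \<in> {- hi<..<- lo} - uminus ` D" if "x' \<in> uminus ` D'" for x' k
      using NC[of "-x'" k] that by (auto simp: mir_funpow mem_uminus_image)
  qed
qed

lemma finite_obs: "finite {y \<in> {lo<..<hi}. \<not> F.Ok K y}"
proof (rule finite_subset)
  show "{y \<in> {lo<..<hi}. \<not> F.Ok K y} \<subseteq> (\<Union>t\<in>{..<K}. (S ^^ t) ` D)"
  proof
    fix y assume "y \<in> {y \<in> {lo<..<hi}. \<not> F.Ok K y}"
    then have y: "y \<in> {lo<..<hi}" "\<not> F.Ok K y" by auto
    obtain t where t: "t < K" "F.Ok t y" "(T ^^ t) y \<in> D" using F.not_ok_first y by blast
    have "(S ^^ t) ((T ^^ t) y) = y" using S_back[OF y(1) t(2), of t] by simp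
    then show "y \<in> (\<Union>t\<in>{..<K}. (S ^^ t) ` D)" using t by (metis UN_I imageI lessThan_iff)
  qed
  show "finite (\<Union>t\<in>{..<K}. (S ^^ t) ` D)" using F.fin by auto
qed

lemma strip_tr:
  assumes "x' \<in> D'" "F.Free a b t" "a \<le> x'" "x' \<le> b" "k \<le> t" "a < y" "y < b"
  shows "(T ^^ k) y = (T ^^ k) x' + (y - x')"
  using F.free_tr_pt[OF assms(2,5) D'_in[OF assms(1)] ok_D'[OF assms(1)] assms(3,4,6,7)] .

lemma rgermD:
  assumes "x \<in> D"
  obtains x' e where "x' \<in> D'" "e = 1 \<or> e = (2::nat)" "\<And>v. 0 < v \<Longrightarrow> v < w0 \<Longrightarrow> (T ^^ e) (x + v) = x' + v"
    "\<And>v. e = 2 \<Longrightarrow> 0 < v \<Longrightarrow> v < w0 \<Longrightarrow> T (x + v) = lo + v"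
proof -
  obtain x1 where x1: "x1 \<in> insert lo D'" "\<forall>v\<in>{0<..<w0}. T (x + v) = x1 + v" using F.rgerm[of x] assms by auto
  show thesis
  proof (cases "x1 \<in> D'")
    case True
    then show thesis using that[of x1 1] x1 by auto
  next
    case False
    then have "x1 = lo" using x1 by auto
    obtain x2 where "x2 \<in> D'" "\<forall>v\<in>{0<..<w0}. T (lo + v) = x2 + v" using F.rgerm[of lo] by auto
    then show thesis using that[of x2 2] x1 \<open>x1 = lo\<close> by (auto simp: numeral_2_eq_2)
  qed
qed

text \<open>Extending a cylinder to the left until it meets the orbit of a singularity.\<close>
lemma leftmost:
  assumes "F.Free u0 (u0 + W) K" "\<And>y. u0 < y \<Longrightarrow> y < u0 + W \<Longrightarrow> (T ^^ K) y = y - f" "0 \<le> f" "K > 0"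
  obtains u where "lo < u" "u \<le> u0" "\<not> F.Ok K u" "F.Free u (u0 + W) K" "\<And>y. u < y \<Longrightarrow> y < u0 + W \<Longrightarrow> (T ^^ K) y = y - f"
proof -
  note b = free_bounds[OF assms(1)]
  have tr: "(T ^^ K) y = y - f" if fr2: "F.Free u (u0 + W) K" and "u \<le> u0" "u < y" "y < u0 + W" for u y
  proof -
    obtain c where c: "lo \<le> u + c" "\<And>y. u < y \<Longrightarrow> y < u0 + W \<Longrightarrow> (T ^^ K) y = y + c"
      using F.free_tr[OF fr2 order_refl] by blast
    obtain z where "u0 < z" "z < u0 + W" using b dense by blast
    then have "c = - f" using c(2)[of z] assms(2)[of z] that by auto
    then show ?thesis using c that by auto
  qed
  define Z where "Z = {y. lo < y \<and> y \<le> u0 \<and> \<not> F.Ok K y}"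
  have finZ: "finite Z" unfolding Z_def using b by (intro finite_subset[OF _ finite_obs[of K]]) auto
  show thesis
  proof (cases "Z = {}")
    case False
    define u where "u = Max Z"
    have u: "u \<in> Z" "\<And>z. z \<in> Z \<Longrightarrow> z \<le> u" using finZ False by (auto simp: u_def)
    have "F.Free u (u0 + W) K"
    proof -
      have "F.Ok K y" if "u < y" "y < u0 + W" for y
      proof (cases "y \<le> u0")
        case True
        then show ?thesis using u(2)[of y] that u(1) by (force simp: Z_def)
      qed (use free_ok[OF assms(1)] that in auto)
      then show ?thesis using u(1) b by (auto simp: free_def Z_def)
    qed
    then show thesis using that[of u] u(1) tr by (auto simp: Z_def)
  next
    \<comment> \<open>The cylinder would reach down to \<open>lo\<close>, where a shift to the left
      is impossible, so \<open>f = 0\<close>. The germ at \<open>lo\<close> follows the orbit of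
      \<open>x1 \<in> D'\<close>, which would then return to \<open>lo\<close> against
      \<open>NC\<close>.\<close>
    case True
    have fr: "F.Free lo (u0 + W) K"
    proof -
      have "F.Ok K y" if "lo < y" "y < u0 + W" for y
      proof (cases "y \<le> u0")
        case True
        then show ?thesis using \<open>Z = {}\<close> that by (force simp: Z_def)
      qed (use free_ok[OF assms(1)] that in auto)
      then show ?thesis using b by (auto simp: free_def)
    qed
    obtain c where c: "lo \<le> lo + c" "\<And>y. lo < y \<Longrightarrow> y < u0 + W \<Longrightarrow> (T ^^ K) y = y + c"
      using F.free_tr[OF fr order_refl] by blast
    obtain z where "lo < z" "z < u0 + W" using b dense by (metis order_le_less_trans)
    then have "c = - f" using c(2)[of z] tr[OF fr _, of z] b by auto
    then have "f = 0" using c assms by auto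
    obtain x1 where x1: "x1 \<in> D'" "\<forall>v\<in>{0<..<w0}. T (lo + v) = x1 + v" using F.rgerm[of lo] by auto
    obtain k where k: "K = Suc k" using assms(4) not0_implies_Suc by blast
    obtain \<eta> where \<eta>: "\<eta> > 0" "F.Free (x1 - \<eta>) (x1 + \<eta>) k" using F.ok_nbhd[OF D'_in[OF x1(1)] ok_D'[OF x1(1)]] by blast
    define v where "v = min (min w0 \<eta>) (u0 + W - lo) / 2"
    have v: "0 < v" "v < w0" "v < \<eta>" "lo + v < u0 + W"
    proof -
      have p: "0 < u0 + W - lo" using b by auto
      then show "0 < v" using \<eta> F.w0 by (simp add: v_def)
      have "v \<le> w0 / 2" "v \<le> \<eta> / 2" "v \<le> (u0 + W - lo) / 2" by (auto simp: v_def)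
      then show "v < w0" "v < \<eta>" "lo + v < u0 + W" using p \<eta> F.w0 by auto
    qed
    have "(T ^^ K) (lo + v) = lo + v" using tr[OF fr, of "lo + v"] v b \<open>f = 0\<close> by auto
    moreover have "(T ^^ K) (lo + v) = (T ^^ k) (x1 + v)" using v x1 k by (simp add: funpow_Suc_right del: funpow.simps)
    moreover have "(T ^^ k) (x1 + v) = (T ^^ k) x1 + v" using strip_tr[OF x1(1) \<eta>(2), of k "x1 + v"] v \<eta> by auto
    ultimately have "(T ^^ k) x1 = lo" by simp
    then show thesis using NC[OF x1(1), of k] by auto
  qed
qed

text \<open>Extended to the left, the cylinder ends at a point whose orbit meets some
  \<open>x \<in> D\<close> at a time \<open>m < K\<close>. Carried along to \<open>x\<close>, it
  becomes a strip to the right of \<open>x\<close>. Points at offset more than \<open>f\<close>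
  return into the strip, while offset \<open>f\<close> itself returns to \<open>x\<close>; so the
  strip first meets \<open>D\<close> at an offset of at most \<open>f\<close>. Its germ runs along
  the orbit of some \<open>x' \<in> D'\<close>, which is therefore \<open>f\<close>-close to
  \<open>D\<close> at that time.\<close>

lemma cylinder_boundary:
  assumes fr: "F.Free u0 (u0 + W) K" and tr0: "\<And>y. u0 < y \<Longrightarrow> y < u0 + W \<Longrightarrow> (T ^^ K) y = y - f"
    and f: "0 < f" "f < W" and W: "W < w0" and K: "K > 0"
  obtains x' t where "x' \<in> D'" "t < K" "F.Free x' (x' + W) t" "near D f ((T ^^ t) x')"
    "\<And>z. x' + f < z \<Longrightarrow> z < x' + W \<Longrightarrow> (T ^^ K) z = z - f"
proof -
  obtain u where u: "lo < u" "u \<le> u0" "\<not> F.Ok K u" "F.Free u (u0 + W) K"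
    "\<And>y. u < y \<Longrightarrow> y < u0 + W \<Longrightarrow> (T ^^ K) y = y - f"
    using leftmost[OF fr tr0 _ K] f by auto
  have U: "F.Free u (u + W) K" using free_mono[OF u(4) order_refl, of u "u + W"] u(2) f by auto
  have tr: "(T ^^ K) y = y - f" if "u < y" "y < u + W" for y using u that by auto
  have uin: "u \<in> {lo<..<hi}" using u free_bounds[OF U] f by auto
  obtain m where m: "m < K" "F.Ok m u" "(T ^^ m) u \<in> D" using F.not_ok_first[OF uin u(3)] by blast
  define x where "x = (T ^^ m) u"
  have xD: "x \<in> D" using m x_def by simp
  have Tm: "(T ^^ m) y = x + (y - u)" if "u < y" "y < u + W" for y
    unfolding x_def by (rule F.free_tr_pt[of u "u + W" m]) (use that m U uin free_mono[OF U, of m u "u + W"] f in auto)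
  have xb: "lo \<le> x" "x + W \<le> hi" using F.D_in[OF xD] W F.w0 by auto
  have Kc: "(T ^^ K) ((T ^^ m) y) = (T ^^ m) ((T ^^ K) y)" for y
    by (metis add.commute comp_apply funpow_add)
  \<comment> \<open>\<open>K\<close> steps bring \<open>c\<close> back into the cylinder, so it
    survives \<open>K + K\<close> steps; as \<open>m < K\<close>, at least \<open>K + 1\<close> of
    them come after the first \<open>m\<close>.\<close>
  have okR: "F.Ok (K + 1) y" if "x + f < y" "y < x + W" for y
  proof -
    define c where "c = u + (y - x)"
    have c: "u + f < c" "c < u + W" using that by (auto simp: c_def)
    have "F.Ok K c" using free_ok[OF U] c f by auto
    moreover have "F.Ok K ((T ^^ K) c)" using tr[of c] free_ok[OF U, of "c - f"] c f by auto
    ultimately have "F.Ok (K + K) c" by (simp add: ok_add)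
    moreover have "K + K = m + (K + K - m)" using m by simp
    ultimately have "F.Ok (K + K - m) ((T ^^ m) c)" by (metis ok_add)
    moreover have "(T ^^ m) c = y" using Tm[of c] c f by (simp add: c_def)
    ultimately show ?thesis using m by (auto intro: ok_mono)
  qed
  \<comment> \<open>\<open>u + f\<close> falls on \<open>u\<close> after \<open>K\<close> steps, so
    \<open>x + f\<close> falls on \<open>x \<in> D\<close>. Hence the strip meets \<open>D\<close>
    no later than time \<open>K\<close>, and by \<open>okR\<close> at an offset of at most
    \<open>f\<close>.\<close>
  have nok: "\<not> F.Ok (K + 1) (x + f)"
  proof
    assume "F.Ok (K + 1) (x + f)"
    moreover have "(T ^^ m) (u + f) = x + f" using Tm[of "u + f"] f by simp
    moreover have "F.Ok m (u + f)" using free_ok[OF U, of "u + f"] f m by (auto intro: ok_mono)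
    ultimately have "F.Ok (m + (K + 1)) (u + f)" using ok_add[of lo hi T D m "K + 1" "u + f"] by simp
    moreover have "m + (K + 1) = K + (m + 1)" by simp
    ultimately have "F.Ok (K + (m + 1)) (u + f)" by metis
    then have "F.Ok (m + 1) ((T ^^ K) (u + f))" by (simp only: ok_add)
    then have "F.Ok (m + 1) u" using tr[of "u + f"] f by simp
    then show False using m by (simp add: ok_Suc)
  qed
  have "\<not> F.Free x (x + W) (K + 1)" using nok free_ok[of lo hi T D x "x + W" "K + 1" "x + f"] f by auto
  then obtain t0 y where t0: "t0 < K + 1" "x < y" "y < x + W" "F.Free x (x + W) t0" "(T ^^ t0) y \<in> D"
    using F.first_hit[of x "x + W" "K + 1"] xb f by auto
  have yf: "y \<le> x + f"
  proof (rule ccontr)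
    assume "\<not> y \<le> x + f"
    then have "F.Ok (K + 1) y" using okR t0 by auto
    then show False using t0 by (auto simp: ok_def)
  qed
  obtain x' e where g: "x' \<in> D'" "e = 1 \<or> e = (2::nat)" "\<And>v. 0 < v \<Longrightarrow> v < w0 \<Longrightarrow> (T ^^ e) (x + v) = x' + v"
    "\<And>v. e = 2 \<Longrightarrow> 0 < v \<Longrightarrow> v < w0 \<Longrightarrow> T (x + v) = lo + v" using rgermD[OF xD] by metis
  \<comment> \<open>A hit before the germ has reached \<open>x'\<close> is excluded: singularities
    are at least \<open>w0 > W\<close> away from one another and from the ends.\<close>
  have e: "e \<le> t0"
  proof -
    have "t0 \<noteq> 0"
    proof
      assume "t0 = 0"
      then show False using t0 F.sep[OF xD, of y] W by auto
    qed
    moreover have "\<not> (e = 2 \<and> t0 = 1)"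
    proof
      assume *: "e = 2 \<and> t0 = 1"
      then have "(T ^^ t0) y = lo + (y - x)" using g(4)[of "y - x"] t0 W by auto
      then show False using F.D_in[OF t0(5)] t0 W by auto
    qed
    ultimately show ?thesis using g(2) by auto
  qed
  have Te: "(T ^^ e) z = z + (x' - x)" if "x < z" "z < x + W" for z
    using g(3)[of "z - x"] that W by auto
  have x'b: "lo \<le> x'" "x' + W \<le> hi" using B.D_in[OF g(1)] W F.w0 by auto
  have fr': "F.Free x' (x' + W) (t0 - e)"
    using free_drop[of lo hi T D x "x + W" e "t0 - e" "x' - x"] Te t0(4) e x'b by (simp add: algebra_simps)
  have yt: "(T ^^ (t0 - e)) (x' + (y - x)) \<in> D"
  proof -
    have "(T ^^ t0) y = (T ^^ (t0 - e)) ((T ^^ e) y)" using e by (metis comp_apply funpow_add le_add_diff_inverse2)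
    then show ?thesis using t0 Te[of y] by (simp add: algebra_simps)
  qed
  have "(T ^^ (t0 - e)) (x' + (y - x)) = (T ^^ (t0 - e)) x' + (y - x)"
    using strip_tr[OF g(1) fr', of "t0 - e" "x' + (y - x)"] t0 f by auto
  then have nr: "near D f ((T ^^ (t0 - e)) x')"
    using yt yf t0 unfolding near_def by (intro bexI[of _ "(T ^^ (t0 - e)) (x' + (y - x))"]) auto
  have TK: "(T ^^ K) z = z - f" if "x' + f < z" "z < x' + W" for z
  proof -
    define z0 where "z0 = z - x' + x"
    define c where "c = u + (z0 - x)"
    have c: "u + f < c" "c < u + W" "(T ^^ m) c = z0" using that Tm[of c] f by (auto simp: c_def z0_def)
    have "(T ^^ K) z0 = (T ^^ m) (c - f)" using Kc[of c] tr[of c] c f by auto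
    also have "\<dots> = z0 - f" using Tm[of "c - f"] c f by (auto simp: c_def)
    finally have "(T ^^ K) z0 = z0 - f" .
    moreover have "(T ^^ K) ((T ^^ e) z0) = (T ^^ e) ((T ^^ K) z0)" by (metis add.commute comp_apply funpow_add)
    ultimately show ?thesis using Te[of z0] Te[of "z0 - f"] that f by (auto simp: z0_def)
  qed
  show thesis using that[of x' "t0 - e"] g fr' nr TK t0 e K by force
qed

text \<open>A periodic cylinder extends to the left until the orbit of its end meets
  \<open>D\<close>, at \<open>x\<close> say. The right germ of \<open>x\<close> follows the orbit of
  some \<open>x' \<in> D'\<close>, and periodicity brings it back to \<open>x\<close>: a connection,
  against \<open>NC\<close>.\<close>

lemma no_periodic:
  assumes fr0: "F.Free u0 (u0 + W) K" and tr0: "\<And>y. u0 < y \<Longrightarrow> y < u0 + W \<Longrightarrow> (T ^^ K) y = y" and K: "K > 0"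
  shows False
proof -
  obtain u where u: "lo < u" "u \<le> u0" "\<not> F.Ok K u" "F.Free u (u0 + W) K"
    "\<And>y. u < y \<Longrightarrow> y < u0 + W \<Longrightarrow> (T ^^ K) y = y"
    using leftmost[OF fr0 _ _ K, of 0] tr0 by auto
  have uin: "u \<in> {lo<..<hi}" using u free_bounds[OF u(4)] by auto
  obtain m where m: "m < K" "F.Ok m u" "(T ^^ m) u \<in> D" using F.not_ok_first[OF uin u(3)] by blast
  define x where "x = (T ^^ m) u"
  have xD: "x \<in> D" using m x_def by simp
  obtain x' e where g: "x' \<in> D'" "e = 1 \<or> e = (2::nat)" "\<And>v. 0 < v \<Longrightarrow> v < w0 \<Longrightarrow> (T ^^ e) (x + v) = x' + v"
    "\<And>v. e = 2 \<Longrightarrow> 0 < v \<Longrightarrow> v < w0 \<Longrightarrow> T (x + v) = lo + v" using rgermD[OF xD] by metis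
  obtain \<eta> where \<eta>: "\<eta> > 0" "F.Free (x' - \<eta>) (x' + \<eta>) K" using F.ok_nbhd[OF D'_in[OF g(1)] ok_D'[OF g(1)]] by blast
  define v where "v = min (min w0 \<eta>) (u0 + W - u) / 2"
  have v: "0 < v" "v < w0" "v < \<eta>" "u + v < u0 + W"
  proof -
    have p: "0 < u0 + W - u" using free_bounds[OF u(4)] by auto
    then show "0 < v" using \<eta> F.w0 by (simp add: v_def)
    have "v \<le> w0 / 2" "v \<le> \<eta> / 2" "v \<le> (u0 + W - u) / 2" by (auto simp: v_def)
    then show "v < w0" "v < \<eta>" "u + v < u0 + W" using p \<eta> F.w0 by auto
  qed
  have Tm: "(T ^^ m) (u + v) = x + v"
    using F.free_tr_pt[of u "u0 + W" m m u "u + v"] free_mono[OF u(4), of m u "u0 + W"] m uin v free_bounds[OF u(4)]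
    by (auto simp: x_def)
  have "(T ^^ K) (x + v) = (T ^^ m) ((T ^^ K) (u + v))" unfolding Tm[symmetric] by (metis add.commute comp_apply funpow_add)
  then have K1: "(T ^^ K) (x + v) = x + v" using u(5)[of "u + v"] v Tm by simp
  have "e \<le> K"
  proof (rule ccontr)
    assume "\<not> e \<le> K"
    then have "e = 2" "K = 1" using g(2) K by auto
    then have "x = lo" using K1 g(4)[of v] v by auto
    then show False using D_in'[OF xD] by auto
  qed
  then have "(T ^^ K) (x + v) = (T ^^ (K - e)) ((T ^^ e) (x + v))" by (metis comp_apply funpow_add le_add_diff_inverse2)
  also have "\<dots> = (T ^^ (K - e)) (x' + v)" using g(3)[of v] v by simp
  also have "\<dots> = (T ^^ (K - e)) x' + v" using strip_tr[OF g(1) \<eta>(2), of "K - e" "x' + v"] v \<eta> by auto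
  finally show False using K1 NC[OF g(1), of "K - e"] xD by auto
qed

text \<open>The first times at which the orbit of \<open>x'\<close> is \<open>v i\<close>-close to \<open>D\<close> strictly decrease in \<open>i\<close>, for
  otherwise the near-connection is isolated. By pigeonhole two of them are close to the same
  singularity; the time between them is \<open>K2\<close>, and their offset is \<open>f\<close>.\<close>
lemma staircase:
  assumes x': "x' \<in> D'" and fr: "F.Free x' (x' + W) t" and nr: "near D (v 0) ((T ^^ t) x')" and tH: "t < H"
    and v: "\<And>i. i \<le> card D \<Longrightarrow> v i < v (Suc i)" "v (Suc (card D)) < W" "0 \<le> v 0"
    and niso: "\<And>i. i \<le> card D \<Longrightarrow> \<not> isolated T D D' H (v i) (v (Suc i))"
  obtains kb K2 f where "K2 > 0" "kb + K2 < t" "0 < f" "f \<le> v (Suc (card D))"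
    "F.Free ((T ^^ kb) x') ((T ^^ kb) x' + W) K2"
    "\<And>y. (T ^^ kb) x' < y \<Longrightarrow> y < (T ^^ kb) x' + W \<Longrightarrow> (T ^^ K2) y = y - f"
    "\<And>y. x' < y \<Longrightarrow> y < x' + W \<Longrightarrow> (T ^^ kb) y = y + ((T ^^ kb) x' - x')"
proof -
  let ?q = "card D"
  define k where "k i = (LEAST k. near D (v i) ((T ^^ k) x'))" for i
  have v_mono: "v i \<le> v j" if "i \<le> j" "j \<le> Suc ?q" for i j
    using that(2,1) by (induction j) (auto simp: le_Suc_eq intro: order_trans[OF _ less_imp_le[OF v(1)]])
  have ex: "near D (v i) ((T ^^ t) x')" if "i \<le> Suc ?q" for i using near_mono[OF nr v_mono[of 0 i]] that by auto
  have k1: "near D (v i) ((T ^^ k i) x')" "k i \<le> t" if "i \<le> Suc ?q" for i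
    unfolding k_def using ex[OF that] by (auto intro: LeastI Least_le)
  have k2: "\<not> near D (v i) ((T ^^ s) x')" if "s < k i" for s i
    using not_less_Least that unfolding k_def by blast
  have kdec: "k (Suc i) < k i" if "i \<le> ?q" for i
  proof -
    have "k (Suc i) \<le> k i" unfolding k_def[of "Suc i"]
      by (rule Least_le) (use near_mono[OF k1(1)[of i]] v(1)[OF that] that in auto)
    moreover have "k (Suc i) \<noteq> k i"
    proof
      assume eq: "k (Suc i) = k i"
      have "isolated T D D' H (v i) (v (Suc i))"
        unfolding isolated_def
        by (intro bexI[of _ x'] exI[of _ "k i"] conjI allI impI) (use k1[of i] k2[of _ "Suc i"] eq that tH x' in auto)
      then show False using niso that by auto
    qed
    ultimately show ?thesis by simp
  qed
  have kdec2: "k j < k i" if "i < j" "j \<le> Suc ?q" for i j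
    using that
  proof (induction j)
    case (Suc j)
    have "k (Suc j) < k j" using kdec[of j] Suc.prems by auto
    then show ?case using Suc by (cases "i = j") auto
  qed simp
  \<comment> \<open>The approach is always from the right of the singularity: otherwise the strip to
    the right of the orbit, of width \<open>W > v i\<close>, would contain \<open>x\<close> before
    time \<open>t\<close>.\<close>
  have "\<exists>x\<in>D. 0 < (T ^^ k i) x' - x \<and> (T ^^ k i) x' - x \<le> v i" if i: "i \<in> {1..Suc ?q}" for i
  proof -
    obtain x where x: "x \<in> D" "\<bar>(T ^^ k i) x' - x\<bar> \<le> v i" using k1(1)[of i] i unfolding near_def by auto
    have "\<not> (T ^^ k i) x' \<le> x"
    proof
      assume le: "(T ^^ k i) x' \<le> x"
      define y where "y = x' + (x - (T ^^ k i) x')"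
      have kt: "k i < t" using kdec2[of 0 i] k1(2)[of 0] i by auto
      have "v i \<le> v (Suc ?q)" using v_mono[of i "Suc ?q"] i by auto
      then have y: "x' \<le> y" "y < x' + W" using le x v(2) by (auto simp: y_def)
      have "x' \<noteq> y" using NC[OF x', of "k i"] x by (auto simp: y_def)
      then have y2: "x' < y" using y by simp
      have "(T ^^ k i) y = x" using strip_tr[OF x' fr, of "k i" y] kt y y2 v(3) by (auto simp: y_def)
      moreover have "F.Ok t y" using free_ok[OF fr y2 y(2)] .
      ultimately show False using kt x by (auto simp: ok_def)
    qed
    then show ?thesis using x by (intro bexI[of _ x]) auto
  qed
  then obtain X where X: "\<And>i. i \<in> {1..Suc ?q} \<Longrightarrow> X i \<in> D \<and> 0 < (T ^^ k i) x' - X i \<and> (T ^^ k i) x' - X i \<le> v i"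
    by metis
  have "\<not> inj_on X {1..Suc ?q}"
  proof
    assume "inj_on X {1..Suc ?q}"
    then have "card {1..Suc ?q} \<le> card D" using X F.fin by (intro card_inj_on_le[of X]) auto
    then show False by simp
  qed
  then obtain i j where ij: "i < j" "i \<in> {1..Suc ?q}" "j \<in> {1..Suc ?q}" "X i = X j"
    unfolding inj_on_def by (metis nat_neq_iff)
  define fi where "fi = (T ^^ k i) x' - X i"
  define fj where "fj = (T ^^ k j) x' - X j"
  obtain j' where j': "j = Suc j'" "i \<le> j'" using ij by (cases j) auto
  \<comment> \<open>Since \<open>k j < k j'\<close>, the orbit is not yet \<open>v j'\<close>-close
    to \<open>D\<close> at time \<open>k j\<close>; so the offset at \<open>j\<close> exceeds
    \<open>v j'\<close>, which bounds the offset at \<open>i\<close>.\<close>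
  have "\<not> near D (v j') ((T ^^ k j) x')" using k2[of "k j" j'] kdec2[of j' j] j' ij by auto
  then have "fj > v j'" using X[OF ij(3)] unfolding near_def fj_def by force
  moreover have "fi \<le> v j'" using X[OF ij(2)] v_mono[of i j'] j' ij unfolding fi_def by auto
  ultimately have fifj: "fi < fj" by simp
  have f0: "0 < fi" using X[OF ij(2)] by (simp add: fi_def)
  have fj: "fj \<le> v (Suc ?q)" using X[OF ij(3)] v_mono[of j "Suc ?q"] ij unfolding fj_def by auto
  define K2 where "K2 = k i - k j"
  have kk: "k j < k i" "k i < t" using kdec2[of i j] kdec2[of 0 i] k1(2)[of 0] ij by auto
  define g where "g = (T ^^ k j) x'"
  have Tj: "(T ^^ k j) y = y + (g - x')" if "x' < y" "y < x' + W" for y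
    using strip_tr[OF x' fr, of "k j" y] kk that by (auto simp: g_def)
  have Ti: "(T ^^ k i) y = (T ^^ k i) x' + (y - x')" if "x' < y" "y < x' + W" for y
    using strip_tr[OF x' fr, of "k i" y] kk that by auto
  have fr2: "F.Free x' (x' + W) (k j + K2)" using free_mono[OF fr] kk free_bounds[OF fr] by (auto simp: K2_def)
  have b: "lo \<le> g" "g + W \<le> hi"
  proof -
    obtain c where c: "lo \<le> x' + c" "x' + W + c \<le> hi" "\<And>y. x' < y \<Longrightarrow> y < x' + W \<Longrightarrow> (T ^^ k j) y = y + c"
      using F.free_tr[OF fr, of "k j"] kk by auto
    obtain y where y: "x' < y" "y < x' + W" using dense free_bounds[OF fr] by blast
    have "c = g - x'" using c(3)[OF y] Tj[OF y] by simp
    then show "lo \<le> g" "g + W \<le> hi" using c by auto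
  qed
  have frg: "F.Free g (g + W) K2"
    using free_drop[OF fr2, of "g - x'"] Tj b by (auto simp: algebra_simps)
  have TK: "(T ^^ K2) y = y - (fj - fi)" if "g < y" "y < g + W" for y
  proof -
    define z where "z = y - g + x'"
    have z: "x' < z" "z < x' + W" using that by (auto simp: z_def)
    have "(T ^^ k i) z = (T ^^ K2) ((T ^^ k j) z)" unfolding K2_def using kk by (metis comp_apply funpow_add le_add_diff_inverse2 less_imp_le)
    then have "(T ^^ K2) y = (T ^^ k i) x' + (z - x')" using Tj[OF z] Ti[OF z] by (simp add: z_def)
    then show ?thesis using ij(4) by (simp add: z_def fi_def fj_def g_def)
  qed
  show thesis
    using that[of K2 "k j" "fj - fi"] kk fifj f0 fj frg TK Tj by (auto simp: K2_def g_def)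
qed

text \<open>Take a return by a small shift \<open>f\<close> with minimal time \<open>K\<close>. At the boundary of its cylinder the staircase
  gives a shorter time \<open>K2\<close>, whose shift \<open>f2\<close> is larger by minimality. Then
  \<open>(g, g + W - f2)\<close> is a trap: \<open>K2\<close> steps move its right part to the left, \<open>K - K2\<close> steps its
  left part to the right.\<close>
lemma no_right_isolated:
  assumes v: "\<And>i. i < 2 * card D + 2 \<Longrightarrow> v i < v (Suc i)" "0 \<le> v 0" "8 * v (2 * card D + 2) \<le> W"
    and W: "W < w0" "real H * W < hi - lo" and trap: "no_trap lo hi T D"
    and niso: "\<And>i. i < 2 * card D + 2 \<Longrightarrow> \<not> isolated T D D' H (v i) (v (Suc i))"
    and os: "x' \<in> D'" "k < H" "F.Free x' (x' + W) k" "near D (v 0) ((T ^^ k) x')"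
  shows False
proof -
  let ?q = "card D" and ?n = "2 * card D + 2"
  define w where "w = v (Suc ?q)"
  have v_mono: "v i \<le> v j" if "i \<le> j" "j \<le> ?n" for i j
    using that(2,1) by (induction j) (auto simp: le_Suc_eq intro: order_trans[OF _ less_imp_le[OF v(1)]])
  have vn: "0 < v ?n" using v(1)[of "Suc (2 * card D)"] v_mono[of 0 "Suc (2 * card D)"] v(2) by auto
  have wn: "w \<le> v ?n" unfolding w_def by (rule v_mono) auto
  define P where "P K \<longleftrightarrow> 0 < K \<and> (\<exists>u f. 0 < f \<and> f \<le> w \<and> F.Free u (u + W) K \<and> (\<forall>y\<in>{u<..<u + W}. (T ^^ K) y = y - f))" for K
  have "\<exists>K<H. P K"
  proof (rule staircase[OF os(1) os(3), of v H])
    fix K2 kb f assume *: "0 < K2" "kb + K2 < k" "0 < f" "f \<le> v (Suc ?q)" "F.Free ((T ^^ kb) x') ((T ^^ kb) x' + W) K2"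
      "\<And>y. (T ^^ kb) x' < y \<Longrightarrow> y < (T ^^ kb) x' + W \<Longrightarrow> (T ^^ K2) y = y - f"
    define g where "g = (T ^^ kb) x'"
    have "0 < K2 \<and> 0 < f \<and> f \<le> w \<and> F.Free g (g + W) K2 \<and> (\<forall>y\<in>{g<..<g + W}. (T ^^ K2) y = y - f)"
      using * by (auto simp: w_def g_def)
    then have "P K2" unfolding P_def by blast
    then show "\<exists>K<H. P K" using * os(2) by (intro exI[of _ K2]) auto
  qed (use v vn wn w_def os niso in auto)
  define K where "K = (LEAST K. P K)"
  have PK: "P K" "K < H" using \<open>\<exists>K<H. P K\<close> unfolding K_def by (auto intro: LeastI dest: Least_le[of P] order_le_less_trans)
  have minK: "\<not> P K'" if "K' < K" for K' using not_less_Least that unfolding K_def by blast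
  obtain u f where uf: "0 < K" "0 < f" "f \<le> w" "F.Free u (u + W) K" "\<And>y. u < y \<Longrightarrow> y < u + W \<Longrightarrow> (T ^^ K) y = y - f"
    using PK(1) unfolding P_def by auto
  have fW: "f < W" using uf wn vn v(3) by auto
  obtain z t where z: "z \<in> D'" "t < K" "F.Free z (z + W) t" "near D f ((T ^^ t) z)"
    "\<And>y. z + f < y \<Longrightarrow> y < z + W \<Longrightarrow> (T ^^ K) y = y - f"
    using cylinder_boundary[OF uf(4,5,2) fW W(1) uf(1)] by metis
  have "near D (v (Suc ?q + 0)) ((T ^^ t) z)" using near_mono[OF z(4), of w] uf by (simp add: w_def)
  then show False
  proof (rule staircase[OF z(1) z(3), of "\<lambda>i. v (Suc ?q + i)" H])
    have e: "Suc ?q + Suc ?q = ?n" by simp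
    show "v (Suc ?q + Suc (card D)) < W" unfolding e using v(3) vn by simp
    show "0 \<le> v (Suc ?q + 0)" using v_mono[of 0 "Suc ?q"] v(2) by simp
    show "t < H" using z PK by simp
    fix K2 kb f2
    assume *: "0 < K2" "kb + K2 < t" "0 < f2" "f2 \<le> v (Suc ?q + Suc (card D))"
      "F.Free ((T ^^ kb) z) ((T ^^ kb) z + W) K2"
      "\<And>y. (T ^^ kb) z < y \<Longrightarrow> y < (T ^^ kb) z + W \<Longrightarrow> (T ^^ K2) y = y - f2"
      "\<And>y. z < y \<Longrightarrow> y < z + W \<Longrightarrow> (T ^^ kb) y = y + ((T ^^ kb) z - z)"
    define g where "g = (T ^^ kb) z"
    have f2n: "f2 \<le> v ?n" using * unfolding e by simp
    have "\<not> f2 \<le> w"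
    proof
      assume "f2 \<le> w"
      then have "0 < K2 \<and> 0 < f2 \<and> f2 \<le> w \<and> F.Free g (g + W) K2 \<and> (\<forall>y\<in>{g<..<g + W}. (T ^^ K2) y = y - f2)"
        using * by (auto simp: g_def)
      then have "P K2" unfolding P_def by blast
      then show False using minK[of K2] * z by simp
    qed
    then have ff: "f < f2" using uf by simp
    have KK: "K2 < K" using * z by simp
    have left: "(T ^^ K2) y = y - f2" if "g < y" "y < g + W" for y using * that by (simp add: g_def)
    have TK: "(T ^^ K) p = p - f" if "g + f < p" "p < g + W" for p
    proof -
      define s where "s = p - g + z"
      have s: "z + f < s" "s < z + W" using that by (auto simp: s_def)
      have "(T ^^ K) ((T ^^ kb) s) = (T ^^ kb) ((T ^^ K) s)" by (metis add.commute comp_apply funpow_add)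
      also have "\<dots> = (T ^^ kb) (s - f)" using z(5)[OF s] by simp
      also have "\<dots> = p - f" using *(7)[of "s - f"] s uf by (simp add: s_def g_def)
      finally show ?thesis using *(7)[of s] s uf by (simp add: s_def g_def)
    qed
    have right: "(T ^^ (K - K2)) y = y + (f2 - f)" if "g < y" "y < g + W - f2" for y
    proof -
      have "(T ^^ (K - K2)) ((T ^^ K2) (y + f2)) = (T ^^ K) (y + f2)"
        using KK by (metis comp_apply funpow_add le_add_diff_inverse2 less_imp_le)
      then show ?thesis using left[of "y + f2"] TK[of "y + f2"] that ff * by simp
    qed
    define P' where "P' = {(g, g + W - f2)}"
    have U: "(\<Union>(p, r)\<in>P'. {p<..<r}) = {g<..<g + W - f2}" by (simp add: P'_def)
    have "hi - lo \<le> real K * (\<Sum>(p, r)\<in>P'. r - p)"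
    proof (rule trap[unfolded no_trap_def, rule_format], intro conjI)
      show "\<forall>y\<in>\<Union>(p, r)\<in>P'. {p<..<r}. F.Ok K y \<longrightarrow> (\<exists>t\<in>{1..K}. (T ^^ t) y \<in> (\<Union>(p, r)\<in>P'. {p<..<r}))"
        unfolding U
      proof (intro ballI impI)
        fix y assume y: "y \<in> {g<..<g + W - f2}"
        show "\<exists>t\<in>{1..K}. (T ^^ t) y \<in> {g<..<g + W - f2}"
        \<comment> \<open>The left part is moved to \<open>y + f2 - f\<close>, which stays below
          \<open>g + W - f2\<close> because \<open>3 * f2 \<le> W\<close>; the factor 8 in the
          hypothesis leaves this room.\<close>
        proof (cases "y > g + f2")
          case True
          then show ?thesis using left[of y] y * KK by (intro bexI[of _ K2]) auto
        next
          case False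
          then show ?thesis using right[of y] y * KK ff f2n v(3) vn uf by (intro bexI[of _ "K - K2"]) auto
        qed
      qed
      show "\<forall>(p, r)\<in>P'. lo \<le> p \<and> p < r \<and> r \<le> hi"
        using free_bounds[OF *(5)] f2n v(3) vn * by (auto simp: P'_def g_def)
    qed (auto simp: P'_def)
    also have "\<dots> = real K * (W - f2)" by (simp add: P'_def)
    also have "\<dots> \<le> real H * W" using PK * f2n v(3) vn by (intro mult_mono) auto
    finally show False using W by simp
  next
    fix i assume i: "i \<le> card D"
    then have "Suc ?q + i < ?n" by simp
    from v(1)[OF this] niso[OF this]
    show "v (Suc ?q + i) < v (Suc ?q + Suc i)" "\<not> isolated T D D' H (v (Suc ?q + i)) (v (Suc ?q + Suc i))" by simp_all
  qed
qed

end

section \<open>Short connections contain isolated ones\<close>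

text \<open>Only the total width counts: \<open>x\<close> may lie anywhere in the closed interval,
  even at an end. A singularity can thus be wide although one of its sides is blocked, and this is
  how one-sided isolation arises.\<close>

definition wide :: "real \<Rightarrow> real \<Rightarrow> (real \<Rightarrow> real) \<Rightarrow> real set \<Rightarrow> nat \<Rightarrow> real \<Rightarrow> real \<Rightarrow> bool" where
  "wide lo hi T D H x w \<longleftrightarrow> (\<exists>a b. a \<le> x \<and> x \<le> b \<and> w \<le> b - a \<and> free lo hi T D a b H)"

text \<open>Unlike \<open>isolated\<close>, this leaves the other side of the orbit unrestricted;
  \<open>no_right_isolated\<close> nevertheless finds a two-sided isolated hit below such a
  one.\<close>

definition right_isolated :: "real \<Rightarrow> real \<Rightarrow> (real \<Rightarrow> real) \<Rightarrow> real set \<Rightarrow> real set \<Rightarrow> nat \<Rightarrow> real \<Rightarrow> real \<Rightarrow> bool" where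
  "right_isolated lo hi T D D' H \<mu> W \<longleftrightarrow>
     (\<exists>x'\<in>D'. \<exists>k<H. free lo hi T D x' (x' + W) k \<and> near D \<mu> ((T ^^ k) x'))"

definition left_isolated :: "real \<Rightarrow> real \<Rightarrow> (real \<Rightarrow> real) \<Rightarrow> real set \<Rightarrow> real set \<Rightarrow> nat \<Rightarrow> real \<Rightarrow> real \<Rightarrow> bool" where
  "left_isolated lo hi T D D' H \<mu> W \<longleftrightarrow>
     (\<exists>x'\<in>D'. \<exists>k<H. free lo hi T D (x' - W) x' k \<and> near D \<mu> ((T ^^ k) x'))"

lemma wide_mir: "wide (-hi) (-lo) (mir T) (uminus ` D) H x w \<longleftrightarrow> wide lo hi T D H (- x) w"
proof -
  have "wide (-hi) (-lo) (mir T) (uminus ` D) H x w"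
    if *: "wide lo hi T D H (- x) w" for lo hi T D x
  proof -
    obtain a b where ab: "a \<le> - x" "- x \<le> b" "w \<le> b - a" "free lo hi T D a b H" using * unfolding wide_def by auto
    then show ?thesis unfolding wide_def free_mir by (intro exI[of _ "- b"] exI[of _ "- a"]) auto
  qed
  from this[of lo hi T D x] this[of "-hi" "-lo" "mir T" "uminus ` D" "-x"]
  show ?thesis by (auto simp: image_image)
qed

lemma right_isolated_mir:
  "right_isolated (-hi) (-lo) (mir T) (uminus ` D) (uminus ` D') H \<mu> W \<longleftrightarrow> left_isolated lo hi T D D' H \<mu> W"
  unfolding right_isolated_def left_isolated_def by (simp add: mir_funpow near_mir free_mir)

lemma left_isolated_mir:
  "left_isolated (-hi) (-lo) (mir T) (uminus ` D) (uminus ` D') H \<mu> W \<longleftrightarrow> right_isolated lo hi T D D' H \<mu> W"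
  unfolding right_isolated_def left_isolated_def by (simp add: mir_funpow near_mir free_mir add.commute[of W])

lemma wide_antimono: "wide lo hi T D H x w \<Longrightarrow> w' \<le> w \<Longrightarrow> wide lo hi T D H x w'"
  unfolding wide_def by (meson order_trans)

lemma wideI: "free lo hi T D a b H \<Longrightarrow> a \<le> x \<Longrightarrow> x \<le> b \<Longrightarrow> w \<le> b - a \<Longrightarrow> wide lo hi T D H x w"
  unfolding wide_def by blast

text \<open>\<open>P c z\<close> can only be lost as \<open>c\<close> grows, so each
  \<open>z\<close> loses it at most once, and among \<open>card Z + 1\<close> consecutive levels
  there is one at which no \<open>z\<close> does.\<close>

lemma pigeonhole_gap:
  assumes "finite Z" and mono: "\<And>c z. z \<in> Z \<Longrightarrow> P (Suc c) z \<Longrightarrow> P c z"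
  obtains c where "c \<le> card Z" "\<And>z. z \<in> Z \<Longrightarrow> P c z \<Longrightarrow> P (Suc c) z"
proof -
  have anti: "P c z" if "c \<le> c'" "P c' z" "z \<in> Z" for c c' z
    using that(1,2) by (induction c' rule: dec_induct) (auto intro: mono[OF that(3)])
  have "\<exists>c\<le>card Z. \<forall>z\<in>Z. P c z \<longrightarrow> P (Suc c) z"
  proof (rule ccontr)
    assume "\<not> ?thesis"
    then have "\<forall>c\<in>{..card Z}. \<exists>z. z \<in> Z \<and> P c z \<and> \<not> P (Suc c) z" by auto
    then obtain f where f: "\<And>c. c \<in> {..card Z} \<Longrightarrow> f c \<in> Z \<and> P c (f c) \<and> \<not> P (Suc c) (f c)" by metis
    have "inj_on f {..card Z}"
    proof (rule linorder_inj_onI)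
      fix c c' assume c: "c < c'" "c \<in> {..card Z}" "c' \<in> {..card Z}"
      show "f c \<noteq> f c'"
      proof
        assume "f c = f c'"
        then have "P (Suc c) (f c)" using anti[of "Suc c" c' "f c"] f[OF c(3)] f[OF c(2)] c by auto
        then show False using f[OF c(2)] by auto
      qed
    qed auto
    then have "card {..card Z} \<le> card Z" using f assms(1) by (intro card_inj_on_le[of f]) auto
    then show False by simp
  qed
  then show thesis using that by blast
qed

section \<open>Widths of singularities, blocked sides and one-sided isolation\<close>

context exch
begin

abbreviation "fwide \<equiv> wide lo hi T D"
abbreviation "bwide \<equiv> wide lo hi S D'"

text \<open>Time reversal: a tower for \<open>S\<close>, read from its other end, is a tower for
  \<open>T\<close>.\<close>

lemma dual_free:
  assumes fr: "B.Free a b t" and tr: "\<And>y. a < y \<Longrightarrow> y < b \<Longrightarrow> (S ^^ t) y = y + c"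
  shows "F.Free (a + c) (b + c) t" "a + c < z \<Longrightarrow> z < b + c \<Longrightarrow> (T ^^ t) z = z - c"
proof -
  have TS: "(T ^^ s) z = (S ^^ (t - s)) (z - c)" if "a + c < z" "z < b + c" "s \<le> t" for z s
  proof -
    have y: "a < z - c" "z - c < b" using that by auto
    then have "z - c \<in> {lo<..<hi}" "B.Ok t (z - c)" "(S ^^ t) (z - c) = z"
      using free_bounds[OF fr] free_ok[OF fr] tr by auto
    then show ?thesis using T_back[of "z - c" t s] that by simp
  qed
  show "a + c < z \<Longrightarrow> z < b + c \<Longrightarrow> (T ^^ t) z = z - c" using TS[of z t] by simp
  obtain c' where c': "lo \<le> a + c'" "b + c' \<le> hi" "\<And>y. a < y \<Longrightarrow> y < b \<Longrightarrow> (S ^^ t) y = y + c'"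
    using B.free_tr[OF fr order_refl] by blast
  obtain y where "a < y" "y < b" using free_bounds[OF fr] dense by blast
  then have "c' = c" using c'(3)[of y] tr[of y] by simp
  have "F.Ok t z" if "a + c < z" "z < b + c" for z
    unfolding ok_def
  proof (intro allI impI)
    fix s assume s: "s < t"
    then obtain j where "t = Suc (s + j)" using less_iff_Suc_add by auto
    then have j: "t - s = Suc j" "j < t" by auto
    have "B.Ok t (z - c)" using free_ok[OF fr, of "z - c"] that by auto
    then have "(S ^^ j) (z - c) \<in> {lo<..<hi} - D'" using j by (auto simp: ok_def)
    then have "S ((S ^^ j) (z - c)) \<in> {lo<..<hi} - D" by (rule B.maps)
    then show "(T ^^ s) z \<in> {lo<..<hi} - D" using TS[OF that, of s] s j by simp
  qed
  then show "F.Free (a + c) (b + c) t" using c' \<open>c' = c\<close> free_bounds[OF fr] by (auto simp: free_def)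
qed

text \<open>As the right side is blocked within \<open>m\<close>, the free interval of width
  \<open>\<rho>\<close> reaches at least \<open>\<rho> - m\<close> to the left. Up to the first hit
  on the right the two sides join across \<open>x'\<close>, whose orbit avoids \<open>D\<close>. The
  hit is then an approach within \<open>m\<close> with a wide free strip on the left.\<close>

lemma narrow_side:
  assumes x': "x' \<in> D'" and w: "fwide H x' \<rho>" and nf: "\<not> F.Free x' (x' + m) H" and m: "0 < m" "m < \<rho>" "m < w0"
  obtains t y where "t < H" "F.Free (x' - (\<rho> - m)) (x' + m) t" "x' < y" "y < x' + m" "(T ^^ t) y \<in> D"
proof -
  obtain a b where ab: "a \<le> x'" "x' \<le> b" "\<rho> \<le> b - a" "F.Free a b H" using w unfolding wide_def by auto
  have "b < x' + m"
  proof (rule ccontr)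
    assume "\<not> b < x' + m"
    then show False using nf free_mono[OF ab(4) order_refl, of x' "x' + m"] ab m by auto
  qed
  have xb: "lo \<le> x'" "x' + m \<le> hi" using B.D_in[OF x'] m F.w0 by auto
  obtain t y where t: "t < H" "x' < y" "y < x' + m" "F.Free x' (x' + m) t" "(T ^^ t) y \<in> D"
    using F.first_hit[OF nf xb(1) _ xb(2)] m by auto
  have "F.Free (x' - (\<rho> - m)) x' t"
    using free_mono[OF ab(4), of t "x' - (\<rho> - m)" x'] ab m t \<open>b < x' + m\<close> by auto
  from free_join[OF this t(4) ok_D'[OF x']] show thesis using that t by auto
qed

lemma wide_right_blocked:
  assumes x': "x' \<in> D'" and w: "fwide H x' \<rho>" and nf: "\<not> F.Free x' (x' + m) H" and m: "0 < m" "m < \<rho>" "m < w0"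
  shows "left_isolated lo hi T D D' H m (\<rho> - m)"
proof -
  obtain t y where t: "t < H" "F.Free (x' - (\<rho> - m)) (x' + m) t" "x' < y" "y < x' + m" "(T ^^ t) y \<in> D"
    using narrow_side[OF assms] by metis
  have "(T ^^ t) y = (T ^^ t) x' + (y - x')" using strip_tr[OF x' t(2), of t y] t m by auto
  then have "near D m ((T ^^ t) x')" using t unfolding near_def by (intro bexI[of _ "(T ^^ t) y"]) auto
  then show ?thesis using x' t(1) free_mono[OF t(2), of t "x' - (\<rho> - m)" x'] m unfolding left_isolated_def by auto
qed

text \<open>The backward strip beside \<open>x\<close> meets \<open>D'\<close> at a point whose
  forward orbit comes back \<open>m\<close>-close to \<open>x\<close>. Translations keep left and
  right, so the free side stays the left one.\<close>

lemma bwide_right_blocked: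
  assumes x: "x \<in> D" and w: "bwide H x \<rho>" and nf: "\<not> B.Free x (x + m) H" and m: "0 < m" "m < \<rho>" "m < w0"
  shows "left_isolated lo hi T D D' H m (\<rho> - m)"
proof -
  interpret I: exch lo hi w0 S T D' D by (rule inverse)
  obtain t y where t: "t < H" "B.Free (x - (\<rho> - m)) (x + m) t" "x < y" "y < x + m" "(S ^^ t) y \<in> D'"
    using I.narrow_side[OF assms] by metis
  obtain c where c: "\<And>y. x - (\<rho> - m) < y \<Longrightarrow> y < x + m \<Longrightarrow> (S ^^ t) y = y + c" using B.free_tr[OF t(2) order_refl] by blast
  note d = dual_free[OF t(2) c]
  have yc: "y + c \<in> D'" using c[of y] t m by auto
  have "(T ^^ t) (y + c) = y" using d(2)[of "y + c"] t m by auto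
  then have "near D m ((T ^^ t) (y + c))" using x t unfolding near_def by (intro bexI[of _ x]) auto
  moreover have "F.Free (y + c - (\<rho> - m)) (y + c) t" using free_mono[OF d(1) order_refl, of "y + c - (\<rho> - m)" "y + c"] t m by auto
  ultimately show ?thesis using yc t(1) unfolding left_isolated_def by blast
qed

lemma wide_left_blocked:
  assumes x': "x' \<in> D'" and w: "fwide H x' \<rho>" and nf: "\<not> F.Free (x' - m) x' H" and m: "0 < m" "m < \<rho>" "m < w0"
  shows "right_isolated lo hi T D D' H m (\<rho> - m)"
proof -
  interpret M: exch "-hi" "-lo" w0 "mir T" "mir S" "uminus ` D" "uminus ` D'" by (rule mirror)
  show ?thesis using M.wide_right_blocked[of "-x'" H \<rho> m] assms
    by (simp add: wide_mir free_mir left_isolated_mir)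
qed

lemma bwide_left_blocked:
  assumes x: "x \<in> D" and w: "bwide H x \<rho>" and nf: "\<not> B.Free (x - m) x H" and m: "0 < m" "m < \<rho>" "m < w0"
  shows "right_isolated lo hi T D D' H m (\<rho> - m)"
proof -
  interpret M: exch "-hi" "-lo" w0 "mir T" "mir S" "uminus ` D" "uminus ` D'" by (rule mirror)
  show ?thesis using M.bwide_right_blocked[of "-x" H \<rho> m] assms
    by (simp add: wide_mir free_mir left_isolated_mir)
qed

lemma lgermD':
  assumes "x' \<in> D'"
  obtains x where "x \<in> insert hi D" "\<And>v. 0 < v \<Longrightarrow> v < w0 \<Longrightarrow> S (x' - v) = x - v"
proof -
  obtain x where "x \<in> insert hi D" "\<forall>v\<in>{0<..<w0}. S (x' - v) = x - v" using B.lgerm[of x'] assms by auto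
  then show thesis using that[of x] by simp
qed

text \<open>The first backward hit from the short strip is a point \<open>x' \<in> D'\<close> that
  comes \<open>\<epsilon>\<close>-close to \<open>x\<close> after \<open>k\<close> steps. If the
  long strip survives these \<open>k\<close> steps backwards, \<open>x'\<close> is right isolated.
  Otherwise the width of \<open>x'\<close> would lie strictly between \<open>\<epsilon>\<close> and
  \<open>\<rho>\<close>, which \<open>gap\<close> forbids.\<close>

lemma right_up_free:
  assumes x: "x \<in> D" and up: "F.Free x (x + m) H" and down: "\<not> B.Free x (x + \<epsilon>) H"
    and m: "0 < \<epsilon>" "\<epsilon> < m" "m < \<rho>" "m < w0"
    and gap: "\<And>x'. x' \<in> D' \<Longrightarrow> fwide H x' \<epsilon> \<Longrightarrow> fwide H x' \<rho>"
  shows "right_isolated lo hi T D D' H \<epsilon> (m - \<epsilon>)"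
proof -
  interpret I: exch lo hi w0 S T D' D by (rule inverse)
  have xb: "lo \<le> x" "x + m \<le> hi" using F.D_in[OF x] m F.w0 by auto
  obtain k y1 where k: "k < H" "x < y1" "y1 < x + \<epsilon>" "B.Free x (x + \<epsilon>) k" "(S ^^ k) y1 \<in> D'"
    using B.first_hit[OF down xb(1)] xb m by auto
  show ?thesis
  proof (cases "B.Free x (x + m) k")
    case True
    obtain c where c: "\<And>y. x < y \<Longrightarrow> y < x + m \<Longrightarrow> (S ^^ k) y = y + c" using B.free_tr[OF True order_refl] by blast
    note d = dual_free[OF True c]
    have yc: "y1 + c \<in> D'" using c[of y1] k m by auto
    have "(T ^^ k) (y1 + c) = y1" using d(2)[of "y1 + c"] k m by auto
    then have "near D \<epsilon> ((T ^^ k) (y1 + c))" using x k unfolding near_def by (intro bexI[of _ x]) auto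
    moreover have "F.Free (y1 + c) (y1 + c + (m - \<epsilon>)) k"
      using free_mono[OF d(1) order_refl, of "y1 + c" "y1 + c + (m - \<epsilon>)"] k m by auto
    ultimately show ?thesis using yc k(1) unfolding right_isolated_def by blast
  next
    \<comment> \<open>With \<open>y2\<close> the first obstructed point, the strip from
      \<open>x\<close> to \<open>y2\<close> pulls back to a strip around \<open>x'\<close> that is
      free for \<open>k + H\<close> steps, so \<open>x'\<close> is wide at \<open>\<epsilon>\<close>
      and hence at \<open>\<rho>\<close>. But a free interval around \<open>x'\<close> cannot pass
      either end of the pulled-back strip, whose length is below \<open>m\<close>.\<close>
    case False
    define Z where "Z = {y. x < y \<and> y < x + m \<and> \<not> B.Ok k y}"
    have finZ: "finite Z" unfolding Z_def using xb by (intro finite_subset[OF _ I.finite_obs[of k]]) auto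
    have "Z \<noteq> {}" using False xb m unfolding free_def Z_def by auto
    define y2 where "y2 = Min Z"
    have y2: "y2 \<in> Z" "\<And>z. z \<in> Z \<Longrightarrow> y2 \<le> z" using finZ \<open>Z \<noteq> {}\<close> by (auto simp: y2_def)
    have y2b: "x + \<epsilon> \<le> y2" "y2 < x + m" "\<not> B.Ok k y2"
    proof -
      show "x + \<epsilon> \<le> y2" using y2(1) free_ok[OF k(4), of y2] by (force simp: Z_def)
    qed (use y2 in \<open>auto simp: Z_def\<close>)
    have fr2: "B.Free x y2 k"
      unfolding free_def using xb y2b m y2(2) by (force simp: Z_def)
    obtain c where c: "lo \<le> x + c" "y2 + c \<le> hi" "\<And>y. x < y \<Longrightarrow> y < y2 \<Longrightarrow> (S ^^ k) y = y + c"
      using B.free_tr[OF fr2 order_refl] by blast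
    note d = dual_free[OF fr2 c(3)]
    define x' where "x' = y1 + c"
    have x': "x' \<in> D'" using c(3)[of y1] k y2b by (auto simp: x'_def)
    have long: "F.Free (x + c) (y2 + c) (k + H)"
    proof (rule free_add[OF d(1)])
      show "(T ^^ k) y = y + (- c)" if "x + c < y" "y < y2 + c" for y using d(2)[of y] that by simp
      show "F.Free (x + c + - c) (y2 + c + - c) H"
        using free_mono[OF up order_refl, of x y2] y2b m by simp
    qed
    have "fwide H x' \<epsilon>"
      by (rule wideI[of lo hi T D "x + c" "y2 + c"]) (use free_mono[OF long, of H "x + c" "y2 + c"] k y2b m in \<open>auto simp: x'_def\<close>)
    then have "fwide H x' \<rho>" using gap x' by blast
    then obtain a b where ab: "a \<le> x'" "x' \<le> b" "\<rho> \<le> b - a" "F.Free a b H" unfolding wide_def by auto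
    note abb = free_bounds[OF ab(4)]
    have "x + c \<le> a"
    proof (rule ccontr)
      assume "\<not> x + c \<le> a"
      then have okc: "F.Ok H (x + c)" using free_ok[OF ab(4), of "x + c"] ab k by (auto simp: x'_def)
      have "(T ^^ k) (y1 + c) = (T ^^ k) (x + c) + (y1 + c - (x + c))"
        by (rule F.free_tr_pt[of "x + c" "y2 + c" k]) (use d(1) abb \<open>\<not> x + c \<le> a\<close> ab y2b m k okc ok_mono[OF okc, of k] in \<open>auto simp: x'_def\<close>)
      moreover have "(T ^^ k) (y1 + c) = y1" using d(2)[of "y1 + c"] k y2b by auto
      ultimately have "(T ^^ k) (x + c) = x" by simp
      then show False using okc k x by (auto simp: ok_def)
    qed
    \<comment> \<open>The backward orbit of \<open>y2\<close> meets \<open>D'\<close>, and one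
      further step back its left germ sits at a point \<open>x3\<close> of \<open>D\<close> or at
      \<open>hi\<close>. Read forwards, the orbit of \<open>y2 + c\<close> would pass through
      \<open>x3\<close>, which is impossible inside a free interval.\<close>
    moreover have "b \<le> y2 + c"
    proof (rule ccontr)
      assume nb: "\<not> b \<le> y2 + c"
      have okc: "F.Ok H (y2 + c)" using free_ok[OF ab(4), of "y2 + c"] nb ab k y2b by (auto simp: x'_def)
      have y2in: "y2 \<in> {lo<..<hi}" using xb y2b m by auto
      obtain k2 where k2: "k2 < k" "B.Ok k2 y2" "(S ^^ k2) y2 \<in> D'" using B.not_ok_first[OF y2in y2b(3)] by blast
      obtain x3 where x3: "x3 \<in> insert hi D" "\<And>v. 0 < v \<Longrightarrow> v < w0 \<Longrightarrow> S ((S ^^ k2) y2 - v) = x3 - v"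
        using lgermD'[OF k2(3)] by blast
      define v where "v = (y2 - y1) / 2"
      have "y2 - v = y1 + v" "y1 < y2" using k y2b by (auto simp: v_def field_simps)
      moreover have "v < m"
      proof -
        have "y2 - y1 < m" "0 < m" using k y2b m by auto
        then have "y2 - y1 < m * 2" by linarith
        then show ?thesis by (simp add: v_def)
      qed
      moreover have "0 < v" using \<open>y1 < y2\<close> by (simp add: v_def)
      ultimately have v: "0 < v" "v < w0" "x < y2 - v" "y2 - v < y2" using k m by linarith+
      have "(S ^^ k2) (y2 - v) = (S ^^ k2) y2 + (y2 - v - y2)"
        by (rule B.free_tr_pt[of x y2 k2]) (use fr2 k2 v y2in y2b free_mono[OF fr2, of k2 x y2] free_bounds[OF fr2] in auto)
      then have S1: "(S ^^ Suc k2) (y2 - v) = x3 - v" using x3(2)[of v] v by simp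
      have nf: "y2 + c - v \<in> {x + c<..<y2 + c}" using v by auto
      have T1: "(T ^^ (k - Suc k2)) (y2 - v + c) = x3 - v"
      proof -
        have "(S ^^ k) (y2 - v) = y2 - v + c" using c(3) v by auto
        moreover have "y2 - v \<in> {lo<..<hi}" "B.Ok k (y2 - v)" using free_ok[OF fr2] v free_bounds[OF fr2] by auto
        ultimately have "(T ^^ (k - Suc k2)) (y2 - v + c) = (S ^^ (k - (k - Suc k2))) (y2 - v)" using T_back[of "y2 - v" k "k - Suc k2"] by simp
        also have "k - (k - Suc k2) = Suc k2" using k2 by simp
        finally show ?thesis using S1 by simp
      qed
      have "(T ^^ (k - Suc k2)) (y2 - v + c) = (T ^^ (k - Suc k2)) (y2 + c) + (y2 - v + c - (y2 + c))"
        by (rule F.free_tr_pt[of "x + c" "y2 + c" k]) (use d(1) c(2) abb nb free_bounds[OF d(1)] ok_mono[OF okc, of k] k v in auto)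
      then have "(T ^^ (k - Suc k2)) (y2 + c) = x3" using T1 by simp
      moreover have "(T ^^ (k - Suc k2)) (y2 + c) \<in> {lo<..<hi} - D" using okc k by (auto simp: ok_def)
      ultimately show False using x3(1) by auto
    qed
    ultimately show ?thesis using ab y2b m by auto
  qed
qed

lemma left_up_free:
  assumes x: "x \<in> D" and up: "F.Free (x - m) x H" and down: "\<not> B.Free (x - \<epsilon>) x H"
    and m: "0 < \<epsilon>" "\<epsilon> < m" "m < \<rho>" "m < w0"
    and gap: "\<And>x'. x' \<in> D' \<Longrightarrow> fwide H x' \<epsilon> \<Longrightarrow> fwide H x' \<rho>"
  shows "left_isolated lo hi T D D' H \<epsilon> (m - \<epsilon>)"
proof -
  interpret M: exch "-hi" "-lo" w0 "mir T" "mir S" "uminus ` D" "uminus ` D'" by (rule mirror)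
  show ?thesis using M.right_up_free[of "-x" m H \<epsilon> \<rho>] assms
    by (auto simp: wide_mir free_mir right_isolated_mir mem_uminus_image)
qed

lemma no_left_isolated:
  assumes v: "\<And>i. i < 2 * card D + 2 \<Longrightarrow> v i < v (Suc i)" "0 \<le> v 0" "8 * v (2 * card D + 2) \<le> W"
    and W: "W < w0" "real H * W < hi - lo" and trap: "no_trap lo hi T D"
    and niso: "\<And>i. i < 2 * card D + 2 \<Longrightarrow> \<not> isolated T D D' H (v i) (v (Suc i))"
  shows "\<not> left_isolated lo hi T D D' H (v 0) W"
proof -
  interpret M: exch "-hi" "-lo" w0 "mir T" "mir S" "uminus ` D" "uminus ` D'" by (rule mirror)
  have c: "card (uminus ` D) = card D" by (simp add: card_image)
  show ?thesis
    using M.no_right_isolated[of v W H, unfolded c isolated_mir] v W niso no_trap_mir[OF trap]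
    unfolding right_isolated_mir[of hi lo, symmetric] right_isolated_def by fastforce
qed

lemma lgermD:
  assumes "x \<in> D"
  obtains x' e where "x' \<in> D'" "e = 1 \<or> e = (2::nat)" "\<And>v. 0 < v \<Longrightarrow> v < w0 \<Longrightarrow> (T ^^ e) (x - v) = x' - v"
    "\<And>v. e = 2 \<Longrightarrow> 0 < v \<Longrightarrow> v < w0 \<Longrightarrow> T (x - v) = hi - v"
proof -
  interpret M: exch "-hi" "-lo" w0 "mir T" "mir S" "uminus ` D" "uminus ` D'" by (rule mirror)
  have xm: "- x \<in> uminus ` D" using assms by simp
  show thesis
  proof (rule M.rgermD[OF xm])
    fix x' e
    assume *: "x' \<in> uminus ` D'" "e = 1 \<or> e = (2::nat)" "\<And>v. 0 < v \<Longrightarrow> v < w0 \<Longrightarrow> (mir T ^^ e) (-x + v) = x' + v"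
      "\<And>v. e = 2 \<Longrightarrow> 0 < v \<Longrightarrow> v < w0 \<Longrightarrow> mir T (-x + v) = - hi + v"
    show thesis
    proof (rule that[of "-x'" e])
      show "(T ^^ e) (x - v) = - x' - v" if "0 < v" "v < w0" for v
        using *(3)[OF that] by (simp add: mir_funpow)
      show "T (x - v) = hi - v" if "e = 2" "0 < v" "v < w0" for v
        using *(4)[OF that] by (simp add: mir_def)
    qed (use * in \<open>auto simp: mem_uminus_image\<close>)
  qed
qed

text \<open>The germ reaches \<open>x'\<close> without obstruction, so a strip free for
  \<open>H\<close> steps at \<open>x'\<close> would make the strip at \<open>x\<close> free for
  \<open>e + H\<close> steps.\<close>

lemma right_germ_blocked:
  assumes x: "x \<in> D" and nf: "\<not> F.Free x (x + m) H" and m: "0 < m" "m < w0"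
    and g: "x' \<in> D'" "e = 1 \<or> e = (2::nat)" "\<And>v. 0 < v \<Longrightarrow> v < w0 \<Longrightarrow> (T ^^ e) (x + v) = x' + v"
    "\<And>v. e = 2 \<Longrightarrow> 0 < v \<Longrightarrow> v < w0 \<Longrightarrow> T (x + v) = lo + v"
  shows "\<not> F.Free x' (x' + m) H"
proof
  assume fr: "F.Free x' (x' + m) H"
  have xb: "lo \<le> x" "x + m \<le> hi" using F.D_in[OF x] m F.w0 by auto
  have Te: "(T ^^ e) y = y + (x' - x)" if "x < y" "y < x + m" for y using g(3)[of "y - x"] that m by auto
  have oke: "F.Ok e y" if y: "x < y" "y < x + m" for y
  proof -
    have "y \<notin> D" using F.sep[OF x, of y] y m by auto
    moreover have "lo + (y - x) \<notin> D" using F.D_in[of "lo + (y - x)"] y m by auto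
    moreover have "lo + (y - x) < hi" using y xb F.w0 m by auto
    moreover have "y \<in> {lo<..<hi}" "lo < lo + (y - x)" using y xb m by auto
    ultimately have "F.Ok 1 y" "lo + (y - x) \<in> {lo<..<hi} - D" by (auto simp: ok_def)
    moreover have "T y = lo + (y - x)" if "e = 2" using g(4)[of "y - x"] that y m by simp
    ultimately show ?thesis using g(2) ok_Suc[of lo hi T D 1 y] by (auto simp: numeral_2_eq_2)
  qed
  have "F.Free x (x + m) e" using oke xb m by (auto simp: free_def)
  then have "F.Free x (x + m) (e + H)"
    by (rule free_add[where c = "x' - x"]) (use Te fr in \<open>auto simp: algebra_simps\<close>)
  then show False using nf free_mono[of lo hi T D x "x + m" "e + H" H x "x + m"] m by auto
qed

lemma left_germ_blocked:
  assumes x: "x \<in> D" and nf: "\<not> F.Free (x - m) x H" and m: "0 < m" "m < w0"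
    and g: "x' \<in> D'" "e = 1 \<or> e = (2::nat)" "\<And>v. 0 < v \<Longrightarrow> v < w0 \<Longrightarrow> (T ^^ e) (x - v) = x' - v"
    "\<And>v. e = 2 \<Longrightarrow> 0 < v \<Longrightarrow> v < w0 \<Longrightarrow> T (x - v) = hi - v"
  shows "\<not> F.Free (x' - m) x' H"
proof -
  interpret M: exch "-hi" "-lo" w0 "mir T" "mir S" "uminus ` D" "uminus ` D'" by (rule mirror)
  show ?thesis
    using M.right_germ_blocked[of "-x" m H "-x'" e] assms by (auto simp: free_mir mir_funpow mir_def mem_uminus_image)
qed

text \<open>The heart of the argument: if neither one-sided isolation nor a width between \<open>\<epsilon>\<close> and \<open>\<rho>\<close>
  occurs, the singularities seen at scale \<open>\<epsilon>\<close> form a closed system around which orbits are trapped.\<close>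
lemma blocked_trap:
  assumes m: "0 < \<epsilon>" "\<epsilon> < m" "m < \<rho>" "m < w0"
    and gap: "\<And>x'. x' \<in> D' \<Longrightarrow> fwide H x' \<epsilon> \<Longrightarrow> fwide H x' \<rho>"
    and bgap: "\<And>x. x \<in> D \<Longrightarrow> bwide H x \<epsilon> \<Longrightarrow> bwide H x \<rho>"
    and nL: "\<not> left_isolated lo hi T D D' H m (\<rho> - m)" "\<not> left_isolated lo hi T D D' H \<epsilon> (m - \<epsilon>)"
    and nR: "\<not> right_isolated lo hi T D D' H m (\<rho> - m)" "\<not> right_isolated lo hi T D D' H \<epsilon> (m - \<epsilon>)"
    and conn: "x0 \<in> D'" "k0 < H" "near D \<delta> ((T ^^ k0) x0)" "\<delta> < \<epsilon>"
    and trap: "no_trap lo hi T D"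
  shows "hi - lo \<le> real (H + 1) * (2 * \<epsilon> * card D')"
proof -
  \<comment> \<open>\<open>P\<close> collects the singularities of \<open>S\<close> that are narrow
    at scale \<open>\<epsilon>\<close>, and \<open>Y\<close> their punctured
    \<open>\<epsilon>\<close>-neighbourhoods. These are split at the centre because each half has
    its own first obstruction.\<close>
  define P where "P = {x' \<in> D'. \<not> fwide H x' \<epsilon>}"
  define Q where "Q = (\<lambda>x'. (x' - \<epsilon>, x')) ` P \<union> (\<lambda>x'. (x', x' + \<epsilon>)) ` P"
  define Y where "Y = (\<Union>(p, r)\<in>Q. {p<..<r})"
  have memY: "y \<in> Y \<longleftrightarrow> (\<exists>x'\<in>P. (x' - \<epsilon> < y \<and> y < x') \<or> (x' < y \<and> y < x' + \<epsilon>))" for y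
    unfolding Y_def Q_def by auto
  \<comment> \<open>A chain of forced alternatives: blocked backwards on one side, hence not wide at
    \<open>\<rho>\<close> (or one-sided isolation), hence not wide at \<open>\<epsilon>\<close> by
    \<open>bgap\<close>, hence blocked backwards on both sides, hence blocked forwards on both sides
    even at scale \<open>m\<close> (or one-sided isolation by \<open>right_up_free\<close>).\<close>
  have step: "\<not> F.Free x (x + m) H \<and> \<not> F.Free (x - m) x H"
    if x: "x \<in> D" and sh: "\<not> B.Free x (x + \<epsilon>) H \<or> \<not> B.Free (x - \<epsilon>) x H" for x
  proof -
    have "\<not> bwide H x \<rho>"
    proof
      assume w: "bwide H x \<rho>"
      from sh show False
      proof
        assume "\<not> B.Free x (x + \<epsilon>) H"
        then have "\<not> B.Free x (x + m) H" using free_mono[of lo hi S D' x "x + m" H H x "x + \<epsilon>"] m by auto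
        then show False using bwide_right_blocked[OF x w _ _ m(3,4)] nL m by auto
      next
        assume "\<not> B.Free (x - \<epsilon>) x H"
        then have "\<not> B.Free (x - m) x H" using free_mono[of lo hi S D' "x - m" x H H "x - \<epsilon>" x] m by auto
        then show False using bwide_left_blocked[OF x w _ _ m(3,4)] nR m by auto
      qed
    qed
    then have nb: "\<not> bwide H x \<epsilon>" using bgap x by blast
    have "\<not> B.Free x (x + \<epsilon>) H" "\<not> B.Free (x - \<epsilon>) x H"
      using nb wideI[of lo hi S D' x "x + \<epsilon>" H x \<epsilon>] wideI[of lo hi S D' "x - \<epsilon>" x H x \<epsilon>] m by auto
    then show ?thesis using right_up_free[OF x _ _ m gap] left_up_free[OF x _ _ m gap] nL nR by blast
  qed
  have germP: "x' \<in> P" if "x' \<in> D'" "\<not> F.Free x' (x' + m) H \<or> \<not> F.Free (x' - m) x' H" for x'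
    using that wide_right_blocked[OF that(1) _ _ _ m(3,4)] wide_left_blocked[OF that(1) _ _ _ m(3,4)] gap[OF that(1)] nL nR m
    unfolding P_def by auto
  have enter: "\<exists>t\<in>{1..2}. (T ^^ t) y \<in> Y"
    if x: "x \<in> D" and sh: "\<not> B.Free x (x + \<epsilon>) H \<or> \<not> B.Free (x - \<epsilon>) x H"
      and y: "(x < y \<and> y < x + \<epsilon>) \<or> (x - \<epsilon> < y \<and> y < x)" for x y
    using y
  proof
    assume y: "x < y \<and> y < x + \<epsilon>"
    obtain x' e where g: "x' \<in> D'" "e = 1 \<or> e = (2::nat)" "\<And>v. 0 < v \<Longrightarrow> v < w0 \<Longrightarrow> (T ^^ e) (x + v) = x' + v"
      "\<And>v. e = 2 \<Longrightarrow> 0 < v \<Longrightarrow> v < w0 \<Longrightarrow> T (x + v) = lo + v" using rgermD[OF x] by metis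
    have "x' \<in> P" using germP[OF g(1)] right_germ_blocked[OF x _ _ m(4) g] step[OF x sh] m by auto
    moreover have "(T ^^ e) y = x' + (y - x)" using g(3)[of "y - x"] y m by auto
    ultimately have "(T ^^ e) y \<in> Y" unfolding memY using y by (intro bexI[of _ x']) auto
    then show ?thesis using g(2) by (intro bexI[of _ e]) auto
  next
    assume y: "x - \<epsilon> < y \<and> y < x"
    obtain x' e where g: "x' \<in> D'" "e = 1 \<or> e = (2::nat)" "\<And>v. 0 < v \<Longrightarrow> v < w0 \<Longrightarrow> (T ^^ e) (x - v) = x' - v"
      "\<And>v. e = 2 \<Longrightarrow> 0 < v \<Longrightarrow> v < w0 \<Longrightarrow> T (x - v) = hi - v" using lgermD[OF x] by metis
    have "x' \<in> P" using germP[OF g(1)] left_germ_blocked[OF x _ _ m(4) g] step[OF x sh] m by auto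
    moreover have "(T ^^ e) y = x' - (x - y)" using g(3)[of "x - y"] y m by auto
    ultimately have "(T ^^ e) y \<in> Y" unfolding memY using y by (intro bexI[of _ x']) auto
    then show ?thesis using g(2) by (intro bexI[of _ e]) auto
  qed
  have blocked: "\<not> B.Free x (x + \<epsilon>) H \<or> \<not> B.Free (x - \<epsilon>) x H"
    if x: "x \<in> D" and p: "p \<noteq> x" "\<bar>p - x\<bar> < \<epsilon>" "\<not> B.Ok H p" for x p
  proof (cases "p < x")
    case True
    then show ?thesis using free_ok[of lo hi S D' "x - \<epsilon>" x H p] p by auto
  next
    case False
    then show ?thesis using free_ok[of lo hi S D' x "x + \<epsilon>" H p] p by auto
  qed
  have orbit: "\<not> B.Ok H ((T ^^ t) x')" if "x' \<in> D'" "t < H" for x' t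
  proof -
    have "(S ^^ t) ((T ^^ t) x') = x'" using S_back[OF D'_in[OF that(1)] ok_D'[OF that(1)], of t t] by simp
    then show ?thesis using that by (auto simp: ok_def)
  qed
  have Db: "lo \<le> x' - \<epsilon>" "x' + \<epsilon> \<le> hi" if "x' \<in> D'" for x' using B.D_in[OF that] m F.w0 by auto
  have finP: "finite P" using B.fin by (simp add: P_def)
  \<comment> \<open>The given short connection starts the closed system: it blocks one side of its
    target backwards.\<close>
  have "P \<noteq> {}"
  proof -
    obtain x where x: "x \<in> D" "\<bar>(T ^^ k0) x0 - x\<bar> \<le> \<delta>" using conn unfolding near_def by auto
    have "\<not> B.Free x (x + \<epsilon>) H \<or> \<not> B.Free (x - \<epsilon>) x H"
      using blocked[OF x(1), of "(T ^^ k0) x0"] orbit[OF conn(1,2)] NC[OF conn(1), of k0] x conn by auto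
    from enter[OF x(1) this, of "x + \<epsilon> / 2"] show ?thesis unfolding memY using m by auto
  qed
  have "hi - lo \<le> real (H + 1) * (\<Sum>(p, r)\<in>Q. r - p)"
  proof (rule trap[unfolded no_trap_def, rule_format], fold Y_def, intro conjI)
    show "\<forall>y\<in>Y. F.Ok (H + 1) y \<longrightarrow> (\<exists>t\<in>{1..H + 1}. (T ^^ t) y \<in> Y)"
    proof (intro ballI impI)
      fix y assume y: "y \<in> Y" "F.Ok (H + 1) y"
      then obtain x' where x': "x' \<in> P" "(x' - \<epsilon> < y \<and> y < x') \<or> (x' < y \<and> y < x' + \<epsilon>)" unfolding memY by blast
      have xD: "x' \<in> D'" "\<not> fwide H x' \<epsilon>" using x' by (auto simp: P_def)
      have nf: "\<not> F.Free x' (x' + \<epsilon>) H" "\<not> F.Free (x' - \<epsilon>) x' H"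
        using xD(2) wideI[of lo hi T D x' "x' + \<epsilon>" H x' \<epsilon>] wideI[of lo hi T D "x' - \<epsilon>" x' H x' \<epsilon>] m by auto
      have "\<exists>a b. a \<le> x' \<and> x' \<le> b \<and> b - a = \<epsilon> \<and> a < y \<and> y < b \<and> \<not> F.Free a b H \<and> lo \<le> a \<and> b \<le> hi"
        using x'(2)
      proof
        assume "x' - \<epsilon> < y \<and> y < x'"
        then show ?thesis using nf Db[OF xD(1)] m by (intro exI[of _ "x' - \<epsilon>"] exI[of _ x']) auto
      next
        assume "x' < y \<and> y < x' + \<epsilon>"
        then show ?thesis using nf Db[OF xD(1)] m by (intro exI[of _ x'] exI[of _ "x' + \<epsilon>"]) auto
      qed
      then obtain a b where ab: "a \<le> x'" "x' \<le> b" "b - a = \<epsilon>" "a < y" "y < b" "\<not> F.Free a b H" "lo \<le> a" "b \<le> hi" by blast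
      obtain t z where t: "t < H" "a < z" "z < b" "F.Free a b t" "(T ^^ t) z \<in> D"
        using F.first_hit[OF ab(6,7) _ ab(8)] ab by auto
      define x where "x = (T ^^ t) z"
      have tr: "(T ^^ t) w = (T ^^ t) x' + (w - x')" if "a < w" "w < b" for w
        using strip_tr[OF xD(1) t(4) ab(1,2) order_refl that] .
      have xeq: "x = (T ^^ t) x' + (z - x')" using tr[of z] t by (simp add: x_def)
      have yeq: "(T ^^ t) y = x + (y - z)" using tr[of y] tr[of z] t ab by (simp add: x_def)
      have "(T ^^ t) y \<notin> D" using y(2) t(1) by (auto simp: ok_def)
      then have "y \<noteq> z" using t by auto
      \<comment> \<open>The orbit of \<open>x'\<close> passes \<open>\<epsilon>\<close>-close to
        \<open>x\<close>; run backwards from there it reaches \<open>D'\<close> within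
        \<open>H\<close> steps, so it obstructs one side of \<open>x\<close>.\<close>
      have "\<not> B.Free x (x + \<epsilon>) H \<or> \<not> B.Free (x - \<epsilon>) x H"
      proof (rule blocked)
        show "x \<in> D" using t by (simp add: x_def)
        then show "(T ^^ t) x' \<noteq> x" using NC[OF xD(1), of t] by auto
        show "\<bar>(T ^^ t) x' - x\<bar> < \<epsilon>" using xeq ab t by auto
        show "\<not> B.Ok H ((T ^^ t) x')" using orbit xD t by blast
      qed
      from enter[OF _ this, of "(T ^^ t) y"] have "\<exists>s\<in>{1..2}. (T ^^ s) ((T ^^ t) y) \<in> Y"
        using yeq less_linear[of y z] \<open>y \<noteq> z\<close> ab t by (auto simp: x_def)
      then obtain s where s: "s \<in> {1..2}" "(T ^^ s) ((T ^^ t) y) \<in> Y" by blast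
      have "(T ^^ (s + t)) y \<in> Y" using s by (simp add: funpow_add)
      then show "\<exists>t\<in>{1..H + 1}. (T ^^ t) y \<in> Y" using s t by (intro bexI[of _ "s + t"]) auto
    qed
    show "finite Q" "Q \<noteq> {}" using finP \<open>P \<noteq> {}\<close> by (auto simp: Q_def)
    show "\<forall>(p, r)\<in>Q. lo \<le> p \<and> p < r \<and> r \<le> hi"
    proof -
      have "lo \<le> x' - \<epsilon> \<and> x' \<le> hi" "lo \<le> x' \<and> x' + \<epsilon> \<le> hi" if "x' \<in> P" for x'
        using Db[of x'] that m by (auto simp: P_def)
      then show ?thesis using m by (auto simp: Q_def)
    qed
  qed
  also have "\<dots> \<le> real (H + 1) * (2 * \<epsilon> * card D')"
  proof (rule mult_left_mono)
    have "(\<Sum>(p, r)\<in>Q. r - p) = (\<Sum>z\<in>Q. \<epsilon>)" by (rule sum.cong) (auto simp: Q_def)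
    also have "\<dots> = \<epsilon> * card Q" by simp
    also have "card Q \<le> card D' + card D'"
    proof -
      have "card P \<le> card D'" using B.fin by (intro card_mono) (auto simp: P_def)
      moreover have "card Q \<le> card P + card P"
        unfolding Q_def by (meson add_mono card_Un_le card_image_le finP order_trans)
      ultimately show ?thesis by simp
    qed
    then have "\<epsilon> * card Q \<le> \<epsilon> * real (card D' + card D')" using m by (intro mult_left_mono) auto
    finally show "(\<Sum>(p, r)\<in>Q. r - p) \<le> 2 * \<epsilon> * card D'" by simp
  qed simp
  finally show ?thesis .
qed

text \<open>The scales are cut into \<open>card D + card D' + 1\<close> blocks of \<open>p\<close>;
  by pigeonhole no width of a singularity falls into one of them, and \<open>blocked_trap\<close>
  applies with \<open>\<epsilon>\<close>, \<open>m\<close>, \<open>\<rho>\<close> at its start,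
  middle and end. Each half block has \<open>2 * card D + 6\<close> scales:
  \<open>2 * card D + 2\<close> for \<open>no_right_isolated\<close>, three for its factor 8, and
  one for passing from \<open>w j\<close> to the difference \<open>w j - w b\<close>.\<close>

theorem short_connection_isolated:
  assumes w: "\<And>i. 2 * w i \<le> w (Suc i)" "0 < w 0"
    and p: "p = 4 * card D + 12" "M = p * (card D + card D' + 1)"
    and top: "w M < w0" "real (H + 1) * (2 * w M * (card D' + 1)) < hi - lo"
    and conn: "x0 \<in> D'" "k0 < H" "near D \<delta> ((T ^^ k0) x0)" "\<delta> < w 0"
    and trap: "no_trap lo hi T D"
  shows "\<exists>i<M. isolated T D D' H (w i) (w (Suc i))"
proof (rule ccontr)
  assume "\<not> ?thesis"
  then have niso: "\<not> isolated T D D' H (w i) (w (Suc i))" if "i < M" for i using that by blast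
  have wpos: "0 < w i" for i
  proof (induction i)
    case (Suc i)
    then show ?case using w(1)[of i] by linarith
  qed (rule w)
  have wS: "w i < w (Suc i)" for i using w(1)[of i] wpos[of i] by linarith
  have wmono: "w i \<le> w j" if "i \<le> j" for i j
    using that by (rule lift_Suc_mono_le[of w, rotated]) (use wS less_imp_le in blast)
  have w8: "8 * w i \<le> w (i + 3)" for i
    using w(1)[of i] w(1)[of "Suc i"] w(1)[of "Suc (Suc i)"] by (simp add: numeral_3_eq_3)
  define Z where "Z = ({True} \<times> D') \<union> ({False} \<times> D)"
  have cZ: "card Z = card D' + card D"
    unfolding Z_def using F.fin B.fin by (subst card_Un_disjoint) (auto simp: card_cartesian_product)
  define PP where "PP c z = (if fst z then fwide H (snd z) (w (p * c)) else bwide H (snd z) (w (p * c)))" for c :: nat and z :: "bool \<times> real"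
  obtain c where c: "c \<le> card Z" "\<And>z. z \<in> Z \<Longrightarrow> PP c z \<Longrightarrow> PP (Suc c) z"
  proof (rule pigeonhole_gap[of Z PP])
    show "finite Z" using F.fin B.fin by (simp add: Z_def)
    show "PP c z" if "PP (Suc c) z" for c z
      using that wmono[of "p * c" "p * Suc c"] unfolding PP_def by (auto intro: wide_antimono split: if_splits)
  qed blast
  define h where "h = 2 * card D + 6"
  have ph: "p = h + h" using p by (simp add: h_def)
  define \<epsilon> where "\<epsilon> = w (p * c)"
  define m where "m = w (p * c + h)"
  define \<rho> where "\<rho> = w (p * Suc c)"
  have rh: "\<rho> = w (p * c + h + h)" unfolding \<rho>_def ph by (simp add: algebra_simps)
  have pcM: "p * Suc c \<le> M" unfolding p(2) using c(1) cZ by (intro mult_le_mono) auto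
  have \<rho>M: "\<rho> \<le> w M" unfolding \<rho>_def using pcM by (rule wmono)
  have two: "2 * w i \<le> w j" if "i < j" for i j using w(1)[of i] wmono[of "Suc i" j] that by linarith
  have em: "2 * \<epsilon> \<le> m" unfolding \<epsilon>_def m_def by (rule two) (simp add: h_def)
  have mr: "2 * m \<le> \<rho>" unfolding m_def rh by (rule two) (simp add: h_def)
  have e0: "0 < \<epsilon>" "0 < m" "0 < \<rho>" using wpos by (auto simp: \<epsilon>_def m_def \<rho>_def)
  have lt: "\<epsilon> < m" "m < \<rho>" "m < w0" using em mr e0 \<rho>M top by auto
  have cM: "real H * w M < hi - lo"
  proof -
    have "real H * w M \<le> real (H + 1) * (2 * w M * (card D' + 1))"
    proof (rule mult_mono)
      have "w M * 1 \<le> w M * (2 * (real (card D') + 1))" using wpos[of M] by (intro mult_left_mono) auto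
      then show "w M \<le> 2 * w M * real (card D' + 1)" by (simp add: algebra_simps)
    qed (use wpos[of M] in auto)
    then show ?thesis using top by simp
  qed
  have no: "\<not> right_isolated lo hi T D D' H (w b) (w j - w b) \<and> \<not> left_isolated lo hi T D D' H (w b) (w j - w b)"
    if b: "b + h \<le> j" "j \<le> M" for b j
  proof -
    let ?n = "2 * card D + 2" and ?W = "w j - w b"
    have "8 * w (b + ?n) \<le> w (b + ?n + 3)" by (rule w8)
    also have "\<dots> \<le> w (j - 1)" using b by (intro wmono) (auto simp: h_def)
    also have "2 * w (j - 1) \<le> w j" using b by (intro two) (auto simp: h_def)
    moreover have "w b \<le> w (j - 1)" using b by (intro wmono) (auto simp: h_def)
    ultimately have 8: "8 * w (b + ?n) \<le> ?W" using \<open>8 * w (b + ?n) \<le> w (b + ?n + 3)\<close> \<open>w (b + ?n + 3) \<le> w (j - 1)\<close> by linarith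
    have WM: "?W \<le> w M" using wmono[OF b(2)] wpos[of b] by linarith
    have W1: "?W < w0" using WM top by linarith
    have W2: "real H * ?W < hi - lo" using mult_left_mono[OF WM, of "real H"] cM by linarith
    have n: "\<not> isolated T D D' H (w (b + i)) (w (b + Suc i))" if "i < ?n" for i
      using niso[of "b + i"] that b by (auto simp: h_def)
    have v1: "w (b + i) < w (b + Suc i)" for i using wS[of "b + i"] by simp
    have R: "\<not> right_isolated lo hi T D D' H (w b) ?W"
    proof
      assume "right_isolated lo hi T D D' H (w b) ?W"
      then obtain x' k where *: "x' \<in> D'" "k < H" "F.Free x' (x' + ?W) k" "near D (w (b + 0)) ((T ^^ k) x')"
        unfolding right_isolated_def by auto
      show False
        by (rule no_right_isolated[of "\<lambda>i. w (b + i)", OF v1 _ 8 W1 W2 trap n *]) (use wpos[of b] in auto)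
    qed
    moreover have "\<not> left_isolated lo hi T D D' H (w b) ?W"
      using no_left_isolated[of "\<lambda>i. w (b + i)", OF v1 _ 8 W1 W2 trap n] wpos[of b] by simp
    ultimately show ?thesis ..
  qed
  have ph2: "p * c + h + h \<le> M" using pcM ph by simp
  have "hi - lo \<le> real (H + 1) * (2 * \<epsilon> * card D')"
  proof (rule blocked_trap[OF e0(1) lt _ _ _ _ _ _ conn(1,2,3) _ trap])
    show "\<not> left_isolated lo hi T D D' H m (\<rho> - m)" "\<not> right_isolated lo hi T D D' H m (\<rho> - m)"
      using no[of "p * c + h" "p * c + h + h"] ph2 unfolding m_def rh by auto
    show "\<not> left_isolated lo hi T D D' H \<epsilon> (m - \<epsilon>)" "\<not> right_isolated lo hi T D D' H \<epsilon> (m - \<epsilon>)"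
      using no[of "p * c" "p * c + h"] ph2 unfolding m_def \<epsilon>_def by auto
    show "fwide H x' \<rho>" if "x' \<in> D'" "fwide H x' \<epsilon>" for x'
      using c(2)[of "(True, x')"] that by (auto simp: Z_def PP_def \<epsilon>_def \<rho>_def)
    show "bwide H x \<rho>" if "x \<in> D" "bwide H x \<epsilon>" for x
      using c(2)[of "(False, x)"] that by (auto simp: Z_def PP_def \<epsilon>_def \<rho>_def)
    show "\<delta> < \<epsilon>" using conn(4) wmono[of 0 "p * c"] by (simp add: \<epsilon>_def)
  qed
  also have "\<dots> \<le> real (H + 1) * (2 * w M * (card D' + 1))"
  proof -
    have "\<epsilon> \<le> w M" using lt \<rho>M by simp
    then have "2 * \<epsilon> * card D' \<le> 2 * w M * real (card D' + 1)" using e0 by (intro mult_mono) auto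
    then show ?thesis by (intro mult_left_mono) auto
  qed
  finally show False using top by simp
qed

end

section \<open>Interval exchange transformations\<close>

locale iet_data =
  fixes d :: nat and \<sigma> :: "nat \<Rightarrow> nat" and a :: "nat \<Rightarrow> real"
  assumes d2: "d \<ge> 2" and irr: "irreducible_perm d \<sigma>" and pos: "i \<in> {1..d} \<Longrightarrow> 0 < a i"
begin

definition "L = iet_endpt a d"

abbreviation "X \<equiv> iet_endpt a"
abbreviation "X' \<equiv> iet_endpt' \<sigma> a"
abbreviation "T \<equiv> iet d \<sigma> a"
abbreviation "S \<equiv> iet d (inv \<sigma>) (a \<circ> inv \<sigma>)"
abbreviation "D \<equiv> X ` {1..d - 1}"
abbreviation "D' \<equiv> X' ` {1..d - 1}"

lemma perm: "\<sigma> permutes {1..d}"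
  using irr by (simp add: irreducible_perm_def)

lemma sigma_in: "\<sigma> j \<in> {1..d} \<longleftrightarrow> j \<in> {1..d}"
  using permutes_in_image[OF perm] .

lemma inv_in: "inv \<sigma> j \<in> {1..d} \<longleftrightarrow> j \<in> {1..d}"
  using permutes_in_image[OF permutes_inv[OF perm]] .

lemma inv_sigma [simp]: "inv \<sigma> (\<sigma> j) = j" "\<sigma> (inv \<sigma> j) = j"
  using permutes_inverses[OF perm] by auto

lemma endpt_0 [simp]: "X 0 = 0" "X' 0 = 0"
  by (auto simp: iet_endpt_def iet_endpt'_def)

lemma endpt_Suc: "X (Suc i) = X i + a (Suc i)" "X' (Suc i) = X' i + a (inv \<sigma> (Suc i))"
  by (auto simp: iet_endpt_def iet_endpt'_def)

lemma endpt'_eq: "X' = iet_endpt (a \<circ> inv \<sigma>)"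
  by (auto simp: iet_endpt_def iet_endpt'_def fun_eq_iff)

lemma endpt_pred: "j \<in> {1..d} \<Longrightarrow> X j = X (j - 1) + a j" "j \<in> {1..d} \<Longrightarrow> X' j = X' (j - 1) + a (inv \<sigma> j)"
  using endpt_Suc[of "j - 1"] by auto

lemma endpt_less: "i < j \<Longrightarrow> j \<le> d \<Longrightarrow> X i < X j"
proof (induction j)
  case (Suc j)
  have "X j < X (Suc j)" using pos[of "Suc j"] Suc.prems endpt_Suc by simp
  then show ?case using Suc by (cases "i = j") auto
qed simp

lemma endpt_le: "i \<le> j \<Longrightarrow> j \<le> d \<Longrightarrow> X i \<le> X j"
  using endpt_less[of i j] by (cases "i = j") auto

lemma X'_d: "X' d = L"
  unfolding L_def iet_endpt_def iet_endpt'_def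
  using sum.permute[OF permutes_inv[OF perm], of a] by (simp add: comp_def)

text \<open>The inverse is again an exchange, with inverse permutation and reordered lengths; every
  fact about \<open>T\<close> is thereby available for \<open>S\<close>.\<close>

lemma inverse_data: "iet_data d (inv \<sigma>) (a \<circ> inv \<sigma>)"
proof
  show "irreducible_perm d (inv \<sigma>)"
    unfolding irreducible_perm_def
  proof (intro conjI ballI impI)
    show "inv \<sigma> permutes {1..d}" using perm by (rule permutes_inv)
    fix k assume k: "k \<in> {1..d}" "inv \<sigma> ` {1..k} \<subseteq> {1..k}"
    have "inj_on (inv \<sigma>) {1..k}" using permutes_inj[OF permutes_inv[OF perm]] by (rule inj_on_subset) simp
    then have "inv \<sigma> ` {1..k} = {1..k}" using k(2) by (intro card_subset_eq) (auto simp: card_image)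
    then have "\<sigma> ` {1..k} = \<sigma> ` inv \<sigma> ` {1..k}" by simp
    also have "\<dots> = {1..k}" by (simp add: image_image)
    finally have "\<sigma> ` {1..k} \<subseteq> {1..k}" by simp
    then show "k = d" using irr k unfolding irreducible_perm_def by blast
  qed
  show "0 < (a \<circ> inv \<sigma>) i" if "i \<in> {1..d}" for i using pos inv_in that by simp
qed (rule d2)

lemma inverse_endpt: "iet_endpt (a \<circ> inv \<sigma>) = X'" "iet_endpt' (inv \<sigma>) (a \<circ> inv \<sigma>) = X"
  unfolding endpt'_eq by (auto simp: iet_endpt_def iet_endpt'_def fun_eq_iff permutes_inv_inv[OF perm])

lemma L_inverse: "iet_data.L d (a \<circ> inv \<sigma>) = L"
proof -
  interpret I: iet_data d "inv \<sigma>" "a \<circ> inv \<sigma>" by (rule inverse_data)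
  show ?thesis unfolding I.L_def inverse_endpt X'_d ..
qed

lemma endpt'_less: "i < j \<Longrightarrow> j \<le> d \<Longrightarrow> X' i < X' j"
  using iet_data.endpt_less[OF inverse_data] unfolding inverse_endpt .

lemma endpt'_le: "i \<le> j \<Longrightarrow> j \<le> d \<Longrightarrow> X' i \<le> X' j"
  using iet_data.endpt_le[OF inverse_data] unfolding inverse_endpt .

lemma endpt_bounds: "j \<le> d \<Longrightarrow> 0 \<le> X j" "j \<le> d \<Longrightarrow> 0 \<le> X' j" "j \<le> d \<Longrightarrow> X j \<le> L" "j \<le> d \<Longrightarrow> X' j \<le> L"
  using endpt_le[of 0 j] endpt'_le[of 0 j] endpt_le[of j d] endpt'_le[of j d] X'_d by (auto simp: L_def)

lemma L_pos: "0 < L"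
  using endpt_less[of 0 d] d2 by (simp add: L_def)

lemma domain_eq: "iet_domain d a = {0..<L}"
  by (simp add: iet_domain_def L_def iet_endpt_def)

lemma index_ex:
  assumes "0 \<le> x" "x < L"
  obtains j where "j \<in> {1..d}" "X (j - 1) \<le> x" "x < X j"
proof -
  define j where "j = (LEAST j. x < X j)"
  have j: "x < X j" "j \<le> d" using assms unfolding j_def L_def by (auto intro: LeastI Least_le)
  have "j \<noteq> 0" using j assms by (cases "j = 0") auto
  then have "\<not> x < X (j - 1)" using not_less_Least[of "j - 1" "\<lambda>j. x < X j"] by (auto simp: j_def)
  then show thesis using that[of j] j \<open>j \<noteq> 0\<close> by auto
qed

lemma index_unique:
  assumes "i \<in> {1..d}" "j \<in> {1..d}" "X (i - 1) \<le> x" "x < X i" "X (j - 1) \<le> x" "x < X j"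
  shows "i = j"
proof (rule ccontr)
  assume "i \<noteq> j"
  then have "i \<le> j - 1 \<or> j \<le> i - 1" by auto
  moreover have "j - 1 \<le> d" "i - 1 \<le> d" using assms by auto
  ultimately show False using assms endpt_le[of i "j - 1"] endpt_le[of j "i - 1"] by linarith
qed

lemma T_eq:
  assumes "j \<in> {1..d}" "X (j - 1) \<le> x" "x < X j"
  shows "T x = x - X (j - 1) + X' (\<sigma> j - 1)"
proof -
  have "(THE j. j \<in> {1..d} \<and> x \<in> iet_interval a j) = j"
    using assms by (intro the_equality) (auto simp: iet_interval_def intro: index_unique)
  then have "T x = x - X j + X' (\<sigma> j)" by (simp add: iet_def)
  moreover have "\<sigma> j \<in> {1..d}" using assms sigma_in by blast
  ultimately show ?thesis using endpt_pred(1)[OF assms(1)] endpt_pred(2)[of "\<sigma> j"] by simp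
qed

lemma T_in:
  assumes "j \<in> {1..d}" "X (j - 1) \<le> x" "x < X j"
  shows "X' (\<sigma> j - 1) \<le> T x" "T x < X' (\<sigma> j)"
  using T_eq[OF assms] assms endpt_pred(1)[OF assms(1)] endpt_pred(2)[of "\<sigma> j"] sigma_in[of j] by auto

lemma T_range: "x \<in> {0..<L} \<Longrightarrow> T x \<in> {0..<L}"
proof -
  assume "x \<in> {0..<L}"
  then obtain j where j: "j \<in> {1..d}" "X (j - 1) \<le> x" "x < X j" using index_ex by auto
  have s: "\<sigma> j \<in> {1..d}" using j sigma_in by blast
  then have "\<sigma> j - 1 \<le> d" "\<sigma> j \<le> d" by auto
  then show ?thesis using T_in[OF j] endpt_bounds(2)[of "\<sigma> j - 1"] endpt_bounds(4)[of "\<sigma> j"] by auto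
qed

lemma S_eq:
  assumes "i \<in> {1..d}" "X' (i - 1) \<le> x" "x < X' i"
  shows "S x = x - X' (i - 1) + X (inv \<sigma> i - 1)"
  using iet_data.T_eq[OF inverse_data, unfolded inverse_endpt, OF assms] .

lemma S_T: "x \<in> {0..<L} \<Longrightarrow> S (T x) = x"
proof -
  assume "x \<in> {0..<L}"
  then obtain j where j: "j \<in> {1..d}" "X (j - 1) \<le> x" "x < X j" using index_ex by auto
  have "\<sigma> j \<in> {1..d}" using j sigma_in by blast
  then show ?thesis using S_eq[OF _ T_in[OF j]] T_eq[OF j] by simp
qed

lemma T_S: "x \<in> {0..<L} \<Longrightarrow> T (S x) = x"
proof -
  have ii: "inv (inv \<sigma>) = \<sigma>" by (rule permutes_inv_inv[OF perm])
  have aa: "a \<circ> inv \<sigma> \<circ> \<sigma> = a" by (simp add: fun_eq_iff)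
  show "x \<in> {0..<L} \<Longrightarrow> T (S x) = x" using iet_data.S_T[OF inverse_data, of x] unfolding L_inverse ii aa .
qed

lemma S_range: "x \<in> {0..<L} \<Longrightarrow> S x \<in> {0..<L}"
  using iet_data.T_range[OF inverse_data, of x] unfolding L_inverse .

text \<open>Irreducibility at \<open>k = 1\<close>, and in \<open>sigma_d\<close> at
  \<open>k = d - 1\<close>, prevents an end interval from staying at its end; this is what the end
  clauses of \<open>rgerm\<close> and \<open>lgerm\<close> ask for.\<close>

lemma sigma_1: "\<sigma> 1 \<noteq> 1"
proof
  assume "\<sigma> 1 = 1"
  then have "\<sigma> ` {1..1} \<subseteq> {1..1}" by simp
  moreover have "1 \<in> {1..d}" using d2 by simp
  ultimately have "1 = d" using irr unfolding irreducible_perm_def by blast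
  then show False using d2 by simp
qed

lemma sigma_d: "\<sigma> d \<noteq> d"
proof
  assume "\<sigma> d = d"
  have "\<sigma> ` {1..d - 1} \<subseteq> {1..d - 1}"
  proof
    fix y assume "y \<in> \<sigma> ` {1..d - 1}"
    then obtain i where i: "i \<in> {1..d - 1}" "y = \<sigma> i" by auto
    have "\<sigma> i \<noteq> \<sigma> d" using i inj_eq[OF permutes_inj[OF perm], of i d] d2 by auto
    then show "y \<in> {1..d - 1}" using i sigma_in[of i] \<open>\<sigma> d = d\<close> by auto
  qed
  moreover have "d - 1 \<in> {1..d}" using d2 by simp
  ultimately have "d - 1 = d" using irr unfolding irreducible_perm_def by blast
  then show False using d2 by simp
qed

lemma endpt_inj: "i \<le> d \<Longrightarrow> j \<le> d \<Longrightarrow> X i = X j \<Longrightarrow> i = j"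
  using endpt_less[of i j] endpt_less[of j i] by (cases i j rule: linorder_cases) auto

lemma endpt'_inj: "i \<le> d \<Longrightarrow> j \<le> d \<Longrightarrow> X' i = X' j \<Longrightarrow> i = j"
  using endpt'_less[of i j] endpt'_less[of j i] by (cases i j rule: linorder_cases) auto

lemma T_interior:
  assumes "y \<in> {0<..<L} - D"
  obtains j where "j \<in> {1..d}" "X (j - 1) < y" "y < X j"
proof -
  obtain j where j: "j \<in> {1..d}" "X (j - 1) \<le> y" "y < X j" using index_ex[of y] assms by auto
  have "X (j - 1) \<noteq> y"
  proof
    assume "X (j - 1) = y"
    then have "j - 1 \<noteq> 0" using assms by auto
    then have "y \<in> D" using \<open>X (j - 1) = y\<close> j by (intro image_eqI[of _ _ "j - 1"]) auto
    then show False using assms by simp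
  qed
  then show thesis using that j by auto
qed

lemma exch_half_iet:
  assumes w0: "0 < w0" "\<And>i. i \<in> {1..d} \<Longrightarrow> w0 \<le> a i"
  shows "exch_half 0 L w0 T D D'"
proof
  show "0 < w0" by fact
  show "0 < L" by (rule L_pos)
  show "finite D" by simp
  show "0 + w0 \<le> x \<and> x \<le> L - w0" if "x \<in> D" for x
  proof -
    obtain i where i: "i \<in> {1..d - 1}" "x = X i" using \<open>x \<in> D\<close> by blast
    have "X 1 \<le> X i" "X i \<le> X (d - 1)" using i by (auto intro!: endpt_le)
    moreover have "X 1 = a 1" using endpt_Suc(1)[of 0] by simp
    moreover have "L = X (d - 1) + a d" using endpt_pred(1)[of d] d2 by (simp add: L_def)
    ultimately show ?thesis using w0(2)[of 1] w0(2)[of d] d2 i by auto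
  qed
  show "T y \<in> {0<..<L} - D'" if yD: "y \<in> {0<..<L} - D" for y
  proof -
    obtain j where j: "j \<in> {1..d}" "X (j - 1) < y" "y < X j" using T_interior[OF yD] by metis
    have s: "\<sigma> j \<in> {1..d}" using j sigma_in by blast
    have T: "X' (\<sigma> j - 1) < T y" "T y < X' (\<sigma> j)" using T_eq[of j y] T_in[of j y] j by auto
    have "T y \<noteq> X' i" if "i \<in> {1..d - 1}" for i
    proof (cases "i \<le> \<sigma> j - 1")
      case True
      moreover have "\<sigma> j - 1 \<le> d" using s by auto
      ultimately show ?thesis using T endpt'_le[of i "\<sigma> j - 1"] by auto
    next
      case False
      then have "\<sigma> j \<le> i" "i \<le> d" using that by auto
      then show ?thesis using T endpt'_le[of "\<sigma> j" i] by auto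
    qed
    then have "T y \<notin> D'" by (metis imageE)
    moreover have "\<sigma> j - 1 \<le> d" "\<sigma> j \<le> d" using s by auto
    then have "0 < T y" "T y < L" using T endpt_bounds(2)[of "\<sigma> j - 1"] endpt_bounds(4)[of "\<sigma> j"] by auto
    ultimately show ?thesis by simp
  qed
  show "\<exists>c. \<forall>y\<in>{p<..<q}. T y = y + c"
    if *: "0 \<le> p" "p < q" "q \<le> L" "{p<..<q} \<inter> D = {}" for p q
  proof -
    obtain y where y: "p < y" "y < q" using dense * by blast
    obtain j where j: "j \<in> {1..d}" "X (j - 1) \<le> y" "y < X j" using index_ex[of y] y * by auto
    have "X (j - 1) \<le> p"
    proof (rule ccontr)
      assume n: "\<not> X (j - 1) \<le> p"
      then have "j - 1 \<noteq> 0" using * by auto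
      then have "X (j - 1) \<in> D" using j by (intro imageI) auto
      moreover have "X (j - 1) \<in> {p<..<q}" using n j y by auto
      ultimately show False using *(4) by blast
    qed
    moreover have "q \<le> X j"
    proof (rule ccontr)
      assume n: "\<not> q \<le> X j"
      then have "j \<noteq> d" using * by (auto simp: L_def)
      then have "X j \<in> D" using j by (intro imageI) auto
      moreover have "X j \<in> {p<..<q}" using n j y by auto
      ultimately show False using *(4) by blast
    qed
    ultimately have "T z = z + (X' (\<sigma> j - 1) - X (j - 1))" if "z \<in> {p<..<q}" for z using T_eq[OF j(1), of z] that by auto
    then show ?thesis by blast
  qed
  show "\<exists>x'\<in>insert 0 D'. (x = 0 \<longrightarrow> x' \<noteq> 0) \<and> (\<forall>v\<in>{0<..<w0}. T (x + v) = x' + v)" if x: "x \<in> insert 0 D" for x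
  proof -
    obtain i where i: "i \<le> d - 1" "x = X i"
    proof (cases "x = 0")
      case True
      then show thesis using that[of 0] by simp
    qed (use x that in auto)
    define j where "j = i + 1"
    have j: "j \<in> {1..d}" "X (j - 1) = x" "X j = x + a j" using i d2 endpt_Suc by (auto simp: j_def)
    have s: "\<sigma> j \<in> {1..d}" using j sigma_in by blast
    have "T (x + v) = X' (\<sigma> j - 1) + v" if "v \<in> {0<..<w0}" for v
      using T_eq[OF j(1), of "x + v"] j w0(2)[OF j(1)] that by auto
    moreover have "X' (\<sigma> j - 1) \<in> insert 0 D'" using s by (cases "\<sigma> j - 1") auto
    moreover have "X' (\<sigma> j - 1) \<noteq> 0" if "x = 0"
    proof
      assume "X' (\<sigma> j - 1) = 0"
      then have "\<sigma> j - 1 = 0" using endpt'_inj[of "\<sigma> j - 1" 0] s by auto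
      moreover have "i = 0" using endpt_inj[of i 0] i that by auto
      ultimately show False using sigma_1 s by (auto simp: j_def)
    qed
    ultimately show ?thesis by blast
  qed
  show "\<exists>x'\<in>insert L D'. (x = L \<longrightarrow> x' \<noteq> L) \<and> (\<forall>v\<in>{0<..<w0}. T (x - v) = x' - v)" if x: "x \<in> insert L D" for x
  proof -
    obtain j where j: "j \<in> {1..d}" "x = X j"
    proof (cases "x = L")
      case True
      then show thesis using that[of d] d2 by (auto simp: L_def)
    next
      case False
      then obtain i where "i \<in> {1..d - 1}" "x = X i" using x by auto
      then show thesis using that[of i] by auto
    qed
    have s: "\<sigma> j \<in> {1..d}" using j sigma_in by blast
    have "T (x - v) = X' (\<sigma> j) - v" if "v \<in> {0<..<w0}" for v
      using T_eq[OF j(1), of "x - v"] endpt_pred(1)[OF j(1)] endpt_pred(2)[OF s] j w0(2)[OF j(1)] that by auto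
    moreover have "X' (\<sigma> j) \<in> insert L D'" using s X'_d by (cases "\<sigma> j = d") auto
    moreover have "X' (\<sigma> j) \<noteq> L" if "x = L"
    proof
      assume "X' (\<sigma> j) = L"
      then have "\<sigma> j = d" using endpt'_inj[of "\<sigma> j" d] s X'_d by auto
      moreover have "j = d" using endpt_inj[of j d] j that by (auto simp: L_def)
      ultimately show False using sigma_d by simp
    qed
    ultimately show ?thesis by blast
  qed
  show "w0 \<le> y - x" if xy: "x \<in> D" "y \<in> D" "x < y" for x y
  proof -
    obtain i j where ij: "x = X i" "y = X j" "i \<in> {1..d - 1}" "j \<in> {1..d - 1}" using xy by auto
    have "i \<le> d" using ij by auto
    then have "i < j" using endpt_le[of j i] ij xy by (cases "i < j") auto
    have "X (Suc i) \<le> X j" using \<open>i < j\<close> ij by (intro endpt_le) auto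
    moreover have "Suc i \<in> {1..d}" using \<open>i < j\<close> ij by auto
    ultimately show ?thesis using endpt_Suc(1)[of i] w0(2)[of "Suc i"] ij by auto
  qed
qed

lemma exch_iet:
  assumes w0: "0 < w0" "\<And>i. i \<in> {1..d} \<Longrightarrow> w0 \<le> a i"
    and NC: "\<And>i j k. i \<in> {1..d - 1} \<Longrightarrow> j \<in> {1..d - 1} \<Longrightarrow> (T ^^ k) (X' j) \<noteq> X i"
  shows "exch 0 L w0 T S D D'"
proof -
  interpret F: exch_half 0 L w0 T D D' by (rule exch_half_iet[OF w0])
  have "exch_half 0 L w0 S D' D"
    using iet_data.exch_half_iet[OF inverse_data, unfolded L_inverse inverse_endpt, of w0] w0 inv_in by auto
  then interpret B: exch_half 0 L w0 S D' D .
  show ?thesis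
  proof
    show "S (T y) = y" if "y \<in> {0<..<L} - D" for y using S_T that by auto
    show "T (S y) = y" if "y \<in> {0<..<L} - D'" for y using T_S that by auto
    show "(T ^^ k) x' \<in> {0<..<L} - D" if "x' \<in> D'" for x' k
    proof (induction k)
      case 0
      show ?case using B.D_in[OF that] w0 NC[of _ _ 0] that by fastforce
    next
      case (Suc k)
      have "(T ^^ Suc k) x' \<in> {0<..<L}" using F.maps[OF Suc] by simp
      then show ?case using NC[of _ _ "Suc k"] that by blast
    qed
  qed
qed

section \<open>Preservation of Lebesgue measure\<close>

lemma T_vimage: "T -` A \<inter> {0..<L} = (\<Union>j\<in>{1..d}. {X (j - 1)..<X j} \<inter> (\<lambda>x. X' (\<sigma> j - 1) - X (j - 1) + x) -` A)"
proof -
  have *: "x \<in> T -` A \<inter> {0..<L} \<longleftrightarrow> (\<exists>j\<in>{1..d}. X (j - 1) \<le> x \<and> x < X j \<and> X' (\<sigma> j - 1) - X (j - 1) + x \<in> A)" for x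
  proof
    assume x: "x \<in> T -` A \<inter> {0..<L}"
    then obtain j where j: "j \<in> {1..d}" "X (j - 1) \<le> x" "x < X j" using index_ex by auto
    then show "\<exists>j\<in>{1..d}. X (j - 1) \<le> x \<and> x < X j \<and> X' (\<sigma> j - 1) - X (j - 1) + x \<in> A"
      using x T_eq[OF j] by (intro bexI[of _ j]) (auto simp: algebra_simps)
  next
    assume "\<exists>j\<in>{1..d}. X (j - 1) \<le> x \<and> x < X j \<and> X' (\<sigma> j - 1) - X (j - 1) + x \<in> A"
    then obtain j where j: "j \<in> {1..d}" "X (j - 1) \<le> x" "x < X j" "X' (\<sigma> j - 1) - X (j - 1) + x \<in> A" by blast
    have "T x = X' (\<sigma> j - 1) - X (j - 1) + x" using T_eq[OF j(1-3)] by simp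
    moreover have "j - 1 \<le> d" "j \<le> d" using j by auto
    ultimately show "x \<in> T -` A \<inter> {0..<L}" using j endpt_bounds(1)[of "j - 1"] endpt_bounds(3)[of j] by auto
  qed
  show ?thesis
    by (intro set_eqI, subst *) (simp only: UN_iff Int_iff vimage_eq atLeastLessThan_iff conj_assoc)
qed

lemma T_vimage_borel: "A \<in> sets borel \<Longrightarrow> T -` A \<inter> {0..<L} \<in> sets borel"
  unfolding T_vimage
proof (intro sets.finite_UN)
  fix j assume A: "A \<in> sets borel"
  have "(\<lambda>x. X' (\<sigma> j - 1) - X (j - 1) + x) -` A \<inter> space borel \<in> sets borel" by (rule measurable_sets[OF _ A]) measurable
  then show "{X (j - 1)..<X j} \<inter> (\<lambda>x. X' (\<sigma> j - 1) - X (j - 1) + x) -` A \<in> sets borel" by auto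
qed simp

lemma emeasure_T_vimage:
  assumes A: "A \<in> sets borel" "A \<subseteq> {0..<L}"
  shows "emeasure lborel (T -` A \<inter> {0..<L}) = emeasure lborel A"
proof -
  let ?J = "\<lambda>i. {X' (i - 1)..<X' i}"
  have "(\<lambda>x. c + x) -` A \<inter> space borel \<in> sets borel" for c :: real by (rule measurable_sets[OF _ A(1)]) measurable
  then have mv: "(\<lambda>x. c + x) -` A \<in> sets borel" for c :: real by simp
  have tr: "emeasure lborel ((\<lambda>x. c + x) -` B) = emeasure lborel B" if "B \<in> sets borel" for B :: "real set" and c
    using that emeasure_distr[of "(+) c" lborel borel B] by (simp add: lborel_distr_plus)
  have "emeasure lborel (T -` A \<inter> {0..<L}) = (\<Sum>j\<in>{1..d}. emeasure lborel ({X (j - 1)..<X j} \<inter> (\<lambda>x. X' (\<sigma> j - 1) - X (j - 1) + x) -` A))"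
    unfolding T_vimage
  proof (rule sum_emeasure[symmetric])
    show "disjoint_family_on (\<lambda>j. {X (j - 1)..<X j} \<inter> (\<lambda>x. X' (\<sigma> j - 1) - X (j - 1) + x) -` A) {1..d}"
      unfolding disjoint_family_on_def
    proof (intro ballI impI)
      fix i j assume ij: "i \<in> {1..d}" "j \<in> {1..d}" "i \<noteq> j"
      have False if "x \<in> {X (i - 1)..<X i}" "x \<in> {X (j - 1)..<X j}" for x
        using index_unique[OF ij(1,2), of x] that ij(3) by auto
      then show "{X (i - 1)..<X i} \<inter> (\<lambda>x. X' (\<sigma> i - 1) - X (i - 1) + x) -` A \<inter> ({X (j - 1)..<X j} \<inter> (\<lambda>x. X' (\<sigma> j - 1) - X (j - 1) + x) -` A) = {}" by blast
    qed
  qed (use mv in auto)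
  also have "\<dots> = (\<Sum>j\<in>{1..d}. emeasure lborel (A \<inter> ?J (\<sigma> j)))"
  proof (rule sum.cong[OF refl])
    fix j assume j: "j \<in> {1..d}"
    have s: "\<sigma> j \<in> {1..d}" using j sigma_in by blast
    have "{X (j - 1)..<X j} \<inter> (\<lambda>x. X' (\<sigma> j - 1) - X (j - 1) + x) -` A = (\<lambda>x. X' (\<sigma> j - 1) - X (j - 1) + x) -` (A \<inter> ?J (\<sigma> j))"
      using endpt_pred(1)[OF j] endpt_pred(2)[OF s] by auto
    then show "emeasure lborel ({X (j - 1)..<X j} \<inter> (\<lambda>x. X' (\<sigma> j - 1) - X (j - 1) + x) -` A) = emeasure lborel (A \<inter> ?J (\<sigma> j))"
      using tr[of "A \<inter> ?J (\<sigma> j)"] A by simp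
  qed
  also have "\<dots> = (\<Sum>i\<in>{1..d}. emeasure lborel (A \<inter> ?J i))"
    using sum.permute[OF perm, of "\<lambda>i. emeasure lborel (A \<inter> ?J i)"] by (simp add: comp_def)
  also have "\<dots> = emeasure lborel (\<Union>i\<in>{1..d}. A \<inter> ?J i)"
  proof (rule sum_emeasure)
    show "disjoint_family_on (\<lambda>i. A \<inter> ?J i) {1..d}"
      unfolding disjoint_family_on_def
    proof (intro ballI impI)
      fix i j assume ij: "i \<in> {1..d}" "j \<in> {1..d}" "i \<noteq> j"
      have False if "x \<in> ?J i" "x \<in> ?J j" for x
        using iet_data.index_unique[OF inverse_data, unfolded inverse_endpt, OF ij(1,2), of x] that ij(3) by auto
      then show "A \<inter> ?J i \<inter> (A \<inter> ?J j) = {}" by blast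
    qed
  qed (use A in auto)
  also have "(\<Union>i\<in>{1..d}. A \<inter> ?J i) = A"
  proof -
    have "\<exists>i\<in>{1..d}. x \<in> ?J i" if "x \<in> A" for x
    proof -
      have "0 \<le> x" "x < L" using A that by auto
      then show ?thesis by (rule iet_data.index_ex[OF inverse_data, unfolded inverse_endpt L_inverse]) auto
    qed
    then show ?thesis by blast
  qed
  finally show ?thesis .
qed

end

section \<open>Orbits are not trapped\<close>

lemma null_sets_translate:
  fixes c :: real
  assumes "A \<in> null_sets lborel"
  shows "(\<lambda>x. x + c) ` A \<in> null_sets lborel"
proof -
  have Ab: "A \<in> sets borel" using assms by auto
  have eq: "(\<lambda>x. x + c) ` A = (+) (- c) -` A" by force
  have "(+) (- c) -` A \<inter> space borel \<in> sets borel" by (rule measurable_sets[OF _ Ab]) measurable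
  then have m: "(+) (- c) -` A \<in> sets borel" by simp
  have "emeasure lborel ((+) (- c) -` A) = emeasure lborel A"
    using emeasure_distr[of "(+) (- c)" lborel borel A] Ab by (simp add: lborel_distr_plus)
  then show ?thesis unfolding eq using m assms by (intro null_setsI) auto
qed

lemma null_sets_borel_subset:
  "B \<in> null_sets lborel \<Longrightarrow> A \<subseteq> B \<Longrightarrow> A \<in> sets borel \<Longrightarrow> A \<in> null_sets lborel" for A B :: "real set"
  by (metis null_sets_subset sets_lborel)

lemma funpow_left_inverse:
  assumes "\<And>x. x \<in> I \<Longrightarrow> g x \<in> I \<and> f (g x) = x" and "x \<in> I"
  shows "(f ^^ t) ((g ^^ t) x) = x \<and> (g ^^ t) x \<in> I"
proof (induction t)
  case (Suc t)
  then show ?case using assms(1)[of "(g ^^ t) x"] by (simp add: funpow_swap1)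
qed (simp add: assms)

lemma funpow_Suc_vimage:
  assumes "\<And>x. x \<in> I \<Longrightarrow> g x \<in> I"
  shows "(g ^^ Suc t) -` A \<inter> I = g -` ((g ^^ t) -` A \<inter> I) \<inter> I"
  using assms by (auto simp: funpow_swap1)

context exch
begin

text \<open>An orbit that stays in the finite set without meeting a singularity is periodic, which
  \<open>no_periodic\<close> excludes. So the forward orbit of \<open>b\<close> meets
  \<open>D\<close> and its backward orbit meets \<open>D'\<close>; joined at \<open>b\<close> they
  form a connection, against \<open>NC\<close>.\<close>

lemma no_invariant_boundary:
  assumes fin: "finite \<Delta>" "\<Delta> \<noteq> {}" "\<Delta> \<subseteq> {lo<..<hi}"
    and inv: "\<And>p. p \<in> {lo<..<hi} - D \<Longrightarrow> p \<in> \<Delta> \<longleftrightarrow> T p \<in> \<Delta>"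
  shows False
proof -
  obtain b where b: "b \<in> \<Delta>" using fin by auto
  have bin: "b \<in> {lo<..<hi}" using b fin by auto
  have fixed: False if y: "y \<in> {lo<..<hi}" "F.Ok n y" "(T ^^ n) y = y" "0 < n" for y n
  proof -
    obtain \<eta> where \<eta>: "\<eta> > 0" "F.Free (y - \<eta>) (y + \<eta>) n" using F.ok_nbhd[OF y(1,2)] by blast
    have w: "y - \<eta> + 2 * \<eta> = y + \<eta>" by simp
    show False
    proof (rule no_periodic[of "y - \<eta>" "2 * \<eta>" n])
      show "F.Free (y - \<eta>) (y - \<eta> + 2 * \<eta>) n" using \<eta> unfolding w by simp
      show "(T ^^ n) z = z" if "y - \<eta> < z" "z < y - \<eta> + 2 * \<eta>" for z
        using F.free_tr_pt[OF \<eta>(2) order_refl y(1,2), of z] that \<eta> y(3) by auto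
    qed (use y in simp)
  qed
  have S\<Delta>: "S p \<in> \<Delta>" if "p \<in> \<Delta>" "p \<notin> D'" for p
  proof -
    have p: "p \<in> {lo<..<hi} - D'" using that fin by auto
    then have "S p \<in> {lo<..<hi} - D" by (rule B.maps)
    then show ?thesis using inv[of "S p"] TS[OF p] that by simp
  qed
  have "\<exists>k. \<not> F.Ok k b"
  proof (rule ccontr)
    assume "\<not> ?thesis"
    then have ok: "F.Ok k b" for k by blast
    have "(T ^^ k) b \<in> \<Delta>" for k
    proof (induction k)
      case (Suc k)
      have "(T ^^ k) b \<in> {lo<..<hi} - D" using ok[of "Suc k"] by (simp add: ok_Suc)
      then show ?case using inv Suc by simp
    qed (simp add: b)
    then have "\<not> inj (\<lambda>k. (T ^^ k) b)" using fin(1) by (metis finite_imageD finite_subset image_subsetI infinite_UNIV_nat)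
    then obtain i j where ij: "i < j" "(T ^^ i) b = (T ^^ j) b" unfolding inj_def by (metis nat_neq_iff)
    have "F.Ok (i + (j - i)) b" by (rule ok)
    then have "F.Ok (j - i) ((T ^^ i) b)" by (simp only: ok_add)
    moreover have "(T ^^ (j - i)) ((T ^^ i) b) = (T ^^ i) b" using ij by (metis comp_apply funpow_add le_add_diff_inverse2 less_imp_le)
    ultimately show False using fixed[of "(T ^^ i) b" "j - i"] ij F.ok_in[OF bin ok order_refl] by auto
  qed
  then obtain k where k: "F.Ok k b" "(T ^^ k) b \<in> D" using F.not_ok_first[OF bin] by metis
  have "\<exists>k. \<not> B.Ok k b"
  proof (rule ccontr)
    assume "\<not> ?thesis"
    then have ok: "B.Ok k b" for k by blast
    have "(S ^^ k) b \<in> \<Delta>" for k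
    proof (induction k)
      case (Suc k)
      have "(S ^^ k) b \<in> {lo<..<hi} - D'" using ok[of "Suc k"] by (simp add: ok_Suc)
      then show ?case using S\<Delta> Suc by simp
    qed (simp add: b)
    then have "\<not> inj (\<lambda>k. (S ^^ k) b)" using fin(1) by (metis finite_imageD finite_subset image_subsetI infinite_UNIV_nat)
    then obtain i j where ij: "i < j" "(S ^^ i) b = (S ^^ j) b" unfolding inj_def by (metis nat_neq_iff)
    define y where "y = (S ^^ j) b"
    have Ty: "(T ^^ s) y = (S ^^ (j - s)) b" if "s \<le> j" for s using T_back[OF bin ok that] by (simp add: y_def)
    have "F.Ok (j - i) y"
      unfolding ok_def
    proof (intro allI impI)
      fix s assume s: "s < j - i"
      then obtain n where n: "j - s = Suc n" by (metis Suc_diff_Suc diff_le_self less_le_trans)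
      have "(S ^^ n) b \<in> {lo<..<hi} - D'" using ok[of "Suc n"] by (simp add: ok_Suc)
      then show "(T ^^ s) y \<in> {lo<..<hi} - D" using B.maps Ty[of s] s n by simp
    qed
    moreover have "(T ^^ (j - i)) y = y" using Ty[of "j - i"] ij by (simp add: y_def)
    ultimately show False using fixed[of y "j - i"] ij B.ok_in[OF bin ok order_refl] by (auto simp: y_def)
  qed
  then obtain k' where k': "B.Ok k' b" "(S ^^ k') b \<in> D'" using B.not_ok_first[OF bin] by metis
  have "(T ^^ k') ((S ^^ k') b) = b" using T_back[OF bin k'(1), of k'] by simp
  then have "(T ^^ (k + k')) ((S ^^ k') b) \<in> D" using k by (simp add: funpow_add)
  then show False using NC[OF k'(2), of "k + k'"] by simp
qed

end

context iet_data
begin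

lemma T_S_funpow: "x \<in> {0..<L} \<Longrightarrow> (T ^^ t) ((S ^^ t) x) = x"
  using funpow_left_inverse[of "{0..<L}" S T x t] S_range T_S by blast

lemma S_T_funpow: "x \<in> {0..<L} \<Longrightarrow> (S ^^ t) ((T ^^ t) x) = x"
  using funpow_left_inverse[of "{0..<L}" T S x t] T_range S_T by blast

lemma emeasure_S_vimage:
  assumes "A \<in> sets borel" "A \<subseteq> {0..<L}"
  shows "emeasure lborel (S -` A \<inter> {0..<L}) = emeasure lborel A"
  using iet_data.emeasure_T_vimage[OF inverse_data, unfolded L_inverse, OF assms] .

lemma S_vimage_borel: "A \<in> sets borel \<Longrightarrow> S -` A \<inter> {0..<L} \<in> sets borel"
  using iet_data.T_vimage_borel[OF inverse_data, unfolded L_inverse] .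

lemma funpow_S_vimage:
  assumes "A \<in> sets borel" "A \<subseteq> {0..<L}"
  shows "(S ^^ t) -` A \<inter> {0..<L} \<in> sets borel \<and> emeasure lborel ((S ^^ t) -` A \<inter> {0..<L}) = emeasure lborel A"
proof (induction t)
  case 0
  then show ?case using assms by (simp add: Int_absorb2)
next
  case (Suc t)
  let ?B = "(S ^^ t) -` A \<inter> {0..<L}"
  have B: "?B \<in> sets borel" "?B \<subseteq> {0..<L}" "emeasure lborel ?B = emeasure lborel A"
    using conjunct1[OF Suc] conjunct2[OF Suc] by blast+
  have eq: "(S ^^ Suc t) -` A \<inter> {0..<L} = S -` ?B \<inter> {0..<L}" by (rule funpow_Suc_vimage) (rule S_range)
  have "S -` ?B \<inter> {0..<L} \<in> sets borel" "emeasure lborel (S -` ?B \<inter> {0..<L}) = emeasure lborel A"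
    using S_vimage_borel[OF B(1)] emeasure_S_vimage[OF B(1,2)] B(3) by argo+
  then show ?case unfolding eq by blast
qed

text \<open>If the intervals \<open>Y\<close> returned to themselves within \<open>K\<close> steps, their saturation \<open>V\<close> under \<open>K\<close> steps would be
  invariant up to null sets and not of full measure. Its essential boundary \<open>\<Delta>\<close> would then be finite,
  nonempty and invariant away from \<open>D\<close>.\<close>
lemma no_trap_iet:
  assumes "exch 0 L w0 T S D D'"
  shows "no_trap 0 L T D"
  unfolding no_trap_def
proof (intro allI impI)
  interpret exch 0 L w0 T S D D' by fact
  fix P K
  define Y where "Y = (\<Union>(p, r)\<in>P. {p<..<r :: real})"
  assume "finite P \<and> P \<noteq> {} \<and> (\<forall>(p, r)\<in>P. 0 \<le> p \<and> p < r \<and> r \<le> L) \<and>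
          (\<forall>y\<in>\<Union>(p, r)\<in>P. {p<..<r}. F.Ok K y \<longrightarrow> (\<exists>t\<in>{1..K}. (T ^^ t) y \<in> (\<Union>(p, r)\<in>P. {p<..<r})))"
  then have P: "finite P" "P \<noteq> {}" "\<And>p r. (p, r) \<in> P \<Longrightarrow> 0 \<le> p \<and> p < r \<and> r \<le> L"
    and ret: "\<And>y. y \<in> Y \<Longrightarrow> F.Ok K y \<Longrightarrow> \<exists>t\<in>{1..K}. (T ^^ t) y \<in> Y"
    by (auto simp: Y_def)
  have Yin: "Y \<subseteq> {0<..<L}" using P(3) by (fastforce simp: Y_def)
  have Yopen: "open Y" unfolding Y_def by (auto intro!: open_UN)
  have Yb: "Y \<in> sets borel" using Yopen by simp
  have "Y \<noteq> {}"
  proof -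
    obtain p r where "(p, r) \<in> P" using P(2) by auto
    then show ?thesis using P(3)[of p r] dense[of p r] by (force simp: Y_def)
  qed
  have Yne: "\<exists>y\<in>Y. F.Ok K y"
  proof (rule ccontr)
    assume "\<not> ?thesis"
    then have "Y \<subseteq> {y \<in> {0<..<L}. \<not> F.Ok K y}" using Yin by auto
    then have "finite Y" using finite_obs[of K] finite_subset by blast
    then show False using Yopen \<open>Y \<noteq> {}\<close> finite_imp_not_open by blast
  qed
  then have K: "0 < K" using ret by fastforce
  show "L - 0 \<le> real K * (\<Sum>(p, r)\<in>P. r - p)"
  proof (rule ccontr)
    assume small: "\<not> ?thesis"
    define V where "V = (\<Union>t<K. (S ^^ t) -` Y \<inter> {0..<L})"
    have Y0L: "Y \<subseteq> {0..<L}" using Yin by auto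
    have Vb: "V \<in> sets borel" unfolding V_def
      by (intro sets.finite_UN) (use funpow_S_vimage[OF Yb Y0L] in blast)+
    have YV: "Y \<subseteq> V" using K Y0L by (force simp: V_def)
    have VL: "V \<subseteq> {0..<L}" by (auto simp: V_def)
    have emV: "emeasure lborel V < L"
    proof -
      have "emeasure lborel Y \<le> (\<Sum>z\<in>P. emeasure lborel (case z of (p, r) \<Rightarrow> {p<..<r}))"
        unfolding Y_def by (rule emeasure_subadditive_finite) (use P in auto)
      also have "\<dots> = (\<Sum>z\<in>P. ennreal (case z of (p, r) \<Rightarrow> r - p))"
      proof (rule sum.cong[OF refl])
        fix z assume "z \<in> P"
        then show "emeasure lborel (case z of (p, r) \<Rightarrow> {p<..<r}) = ennreal (case z of (p, r) \<Rightarrow> r - p)"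
          using P(3)[of "fst z" "snd z"] by (auto split: prod.splits)
      qed
      also have "\<dots> = ennreal (\<Sum>(p, r)\<in>P. r - p)"
        by (rule sum_ennreal) (use P(3) in force)
      finally have eY: "emeasure lborel Y \<le> ennreal (\<Sum>(p, r)\<in>P. r - p)" .
      have s0: "0 \<le> (\<Sum>(p, r)\<in>P. r - p)" by (rule sum_nonneg) (use P(3) in force)
      have "emeasure lborel V \<le> (\<Sum>t<K. emeasure lborel ((S ^^ t) -` Y \<inter> {0..<L}))"
        unfolding V_def by (rule emeasure_subadditive_finite) (use funpow_S_vimage[OF Yb Y0L] in auto)
      also have "\<dots> = of_nat K * emeasure lborel Y" using funpow_S_vimage[OF Yb Y0L] by simp
      also have "\<dots> \<le> of_nat K * ennreal (\<Sum>(p, r)\<in>P. r - p)" by (intro mult_left_mono eY) simp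
      also have "\<dots> = ennreal (real K * (\<Sum>(p, r)\<in>P. r - p))" using s0 by (simp add: ennreal_mult ennreal_of_nat_eq_real_of_nat)
      also have "\<dots> < ennreal L" using small s0 by (intro ennreal_lessI) (auto simp: L_pos)
      finally show ?thesis .
    qed
    define E where "E = {y \<in> {0<..<L}. \<not> F.Ok K y}"
    have finE: "finite E" unfolding E_def by (rule finite_obs)
    define E1 where "E1 = (\<Union>t<K. (T ^^ t) ` E)"
    have finE1: "finite E1" using finE by (simp add: E1_def)
    \<comment> \<open>\<open>T\<close> can lead out of \<open>V\<close> only from the last level
      \<open>K - 1\<close>, and there \<open>ret\<close> brings the point back to a level of
      \<open>V\<close>, unless the orbit of its base point meets \<open>D\<close>; the exceptions
      form the finite set \<open>E1\<close>.\<close>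
    have fwd: "T z \<in> V" if z: "z \<in> V" "z \<notin> E1" for z
    proof -
      obtain t where t: "t < K" "(S ^^ t) z \<in> Y" "z \<in> {0..<L}" using z by (auto simp: V_def)
      define y where "y = (S ^^ t) z"
      have Tz: "T z \<in> {0..<L}" using T_range t by blast
      have zy: "z = (T ^^ t) y" using T_S_funpow[OF t(3)] by (simp add: y_def)
      show ?thesis
      proof (cases "Suc t < K")
        case True
        have "(S ^^ Suc t) (T z) = y" using S_T[OF t(3)] by (simp add: funpow_Suc_right y_def del: funpow.simps)
        then show ?thesis using True t Tz by (auto simp: V_def y_def intro!: bexI[of _ "Suc t"])
      next
        case False
        then have tK: "K = Suc t" using t by simp
        have "F.Ok K y"
        proof (rule ccontr)
          assume "\<not> F.Ok K y"
          then have "y \<in> E" using t(2) Yin by (auto simp: E_def y_def)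
          then have "z \<in> E1" using zy t(1) by (auto simp: E1_def)
          then show False using z by simp
        qed
        then obtain s where s: "s \<in> {1..K}" "(T ^^ s) y \<in> Y" using ret t y_def by blast
        have "T z = (T ^^ K) y" using zy tK by simp
        also have "\<dots> = (T ^^ (K - s)) ((T ^^ s) y)" using s by (metis atLeastAtMost_iff comp_apply funpow_add le_add_diff_inverse2)
        finally have "(S ^^ (K - s)) (T z) = (T ^^ s) y" using S_T_funpow[of "(T ^^ s) y" "K - s"] s Y0L by auto
        then show ?thesis using s Tz K by (auto simp: V_def intro!: bexI[of _ "K - s"])
      qed
    qed
    define N where "N = {z \<in> {0..<L}. (z \<in> V) \<noteq> (T z \<in> V)}"
    \<comment> \<open>\<open>V\<close> is contained in its preimage up to a finite set, and both
      have the same finite measure; so they agree up to a null set.\<close>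
    have N: "N \<in> null_sets lborel"
    proof -
      let ?W = "T -` V \<inter> {0..<L}"
      have Wb: "?W \<in> sets borel" using T_vimage_borel[OF Vb] .
      have eW: "emeasure lborel ?W = emeasure lborel V" using emeasure_T_vimage[OF Vb VL] .
      have E1b: "E1 \<in> sets borel" "E1 \<in> null_sets lborel" using finE1 by (simp_all add: finite_imp_null_set_lborel borel_closed finite_imp_closed)
      have sub: "V - E1 \<subseteq> ?W" using fwd VL by auto
      have "emeasure lborel (V - E1) = emeasure lborel V" using E1b Vb by (intro emeasure_Diff_null_set) auto
      moreover have "emeasure lborel (?W - (V - E1)) = emeasure lborel ?W - emeasure lborel (V - E1)"
        using sub Vb E1b Wb emV calculation by (intro emeasure_Diff) auto
      moreover have "emeasure lborel V \<noteq> top" using emV by auto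
      ultimately have "emeasure lborel (?W - (V - E1)) = 0" using eW by (simp add: ennreal_diff_self)
      then have "?W - (V - E1) \<in> null_sets lborel" using Vb E1b Wb by (intro null_setsI) auto
      then have "(?W - (V - E1)) \<union> E1 \<in> null_sets lborel" using E1b by blast
      moreover have "N \<subseteq> (?W - (V - E1)) \<union> E1" using fwd by (auto simp: N_def)
      moreover have "N \<in> sets lborel"
      proof -
        have "N = (V - ?W) \<union> (?W - V)" using VL by (auto simp: N_def)
        then show ?thesis using Vb Wb by auto
      qed
      ultimately show ?thesis by (metis null_sets_subset)
    qed
    \<comment> \<open>Around points of \<open>U1\<close> the set \<open>V\<close> has full measure,
      around points of \<open>U0\<close> measure zero. Being defined through null sets, both are
      insensitive to \<open>N\<close>, hence invariant under \<open>T\<close> away from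
      \<open>D\<close>.\<close>
    define U1 where "U1 = {z \<in> {0<..<L}. \<exists>\<eta>>0. {z - \<eta><..<z + \<eta>} - V \<in> null_sets lborel}"
    define U0 where "U0 = {z \<in> {0<..<L}. \<exists>\<eta>>0. {z - \<eta><..<z + \<eta>} \<inter> V \<in> null_sets lborel}"
    have locT: "p \<in> U1 \<longleftrightarrow> T p \<in> U1" "p \<in> U0 \<longleftrightarrow> T p \<in> U0" if p: "p \<in> {0<..<L} - D" for p
    proof -
      have "F.Ok 1 p" using p by (simp add: ok_def)
      then obtain \<eta>0 where \<eta>0: "\<eta>0 > 0" "F.Free (p - \<eta>0) (p + \<eta>0) 1" using F.ok_nbhd p by blast
      have Tp: "T p \<in> {0<..<L}" using F.maps[OF p] by auto
      define c where "c = T p - p"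
      have tr: "T z = z + c" if "p - \<eta>0 < z" "z < p + \<eta>0" for z
        using F.free_tr_pt[OF \<eta>0(2) order_refl _ \<open>F.Ok 1 p\<close>, of z] that \<eta>0 p by (auto simp: c_def)
      note bd = free_bounds[OF \<eta>0(2)]
      have push: "{T p - \<eta><..<T p + \<eta>} \<inter> - Q \<in> null_sets lborel"
        if \<eta>: "\<eta> \<le> \<eta>0" "{p - \<eta><..<p + \<eta>} \<inter> - Q \<in> null_sets lborel" and Q: "Q = V \<or> Q = - V" for Q \<eta>
      proof (rule null_sets_borel_subset)
        show "(\<lambda>x. x + c) ` (({p - \<eta><..<p + \<eta>} \<inter> - Q) \<union> N) \<in> null_sets lborel" using \<eta> N by (intro null_sets_translate) blast
        show "{T p - \<eta><..<T p + \<eta>} \<inter> - Q \<subseteq> (\<lambda>x. x + c) ` (({p - \<eta><..<p + \<eta>} \<inter> - Q) \<union> N)"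
        proof
          fix y assume y: "y \<in> {T p - \<eta><..<T p + \<eta>} \<inter> - Q"
          define z where "z = y - c"
          have z: "p - \<eta> < z" "z < p + \<eta>" using y by (auto simp: z_def c_def)
          have "T z = y" using tr[of z] z \<eta> by (auto simp: z_def)
          then have "z \<in> ({p - \<eta><..<p + \<eta>} \<inter> - Q) \<union> N" using z y Q bd \<eta> by (auto simp: N_def)
          then show "y \<in> (\<lambda>x. x + c) ` (({p - \<eta><..<p + \<eta>} \<inter> - Q) \<union> N)" by (intro image_eqI[of _ _ z]) (auto simp: z_def)
        qed
        show "{T p - \<eta><..<T p + \<eta>} \<inter> - Q \<in> sets borel" using Q Vb by (auto intro: borel_comp)
      qed
      have pull: "{p - \<eta><..<p + \<eta>} \<inter> - Q \<in> null_sets lborel"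
        if \<eta>: "\<eta> \<le> \<eta>0" "{T p - \<eta><..<T p + \<eta>} \<inter> - Q \<in> null_sets lborel" and Q: "Q = V \<or> Q = - V" for Q \<eta>
      proof (rule null_sets_borel_subset)
        show "(\<lambda>x. x + (- c)) ` ({T p - \<eta><..<T p + \<eta>} \<inter> - Q) \<union> N \<in> null_sets lborel" using null_sets_translate[OF \<eta>(2), of "- c"] N by blast
        show "{p - \<eta><..<p + \<eta>} \<inter> - Q \<subseteq> (\<lambda>x. x + (- c)) ` ({T p - \<eta><..<T p + \<eta>} \<inter> - Q) \<union> N"
        proof
          fix z assume z: "z \<in> {p - \<eta><..<p + \<eta>} \<inter> - Q"
          have "T z = z + c" using tr[of z] z \<eta> by auto
          then have "z \<in> N \<or> z + c \<in> {T p - \<eta><..<T p + \<eta>} \<inter> - Q" using z Q bd \<eta> by (auto simp: N_def c_def)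
          then show "z \<in> (\<lambda>x. x + (- c)) ` ({T p - \<eta><..<T p + \<eta>} \<inter> - Q) \<union> N"
            by (auto intro!: image_eqI[of _ _ "z + c"])
        qed
        show "{p - \<eta><..<p + \<eta>} \<inter> - Q \<in> sets borel" using Q Vb by (auto intro: borel_comp)
      qed
      have shrink: "\<exists>\<eta>'>0. \<eta>' \<le> \<eta>0 \<and> {q - \<eta>'<..<q + \<eta>'} \<inter> - Q \<in> null_sets lborel"
        if "\<eta> > 0" "{q - \<eta><..<q + \<eta>} \<inter> - Q \<in> null_sets lborel" "Q = V \<or> Q = - V" for q Q \<eta>
      proof (intro exI[of _ "min \<eta> \<eta>0"] conjI null_sets_borel_subset[OF that(2)])
        show "{q - min \<eta> \<eta>0<..<q + min \<eta> \<eta>0} \<inter> - Q \<in> sets borel" using that(3) Vb by (auto intro: borel_comp)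
      qed (use that \<eta>0 in auto)
      have eqv: "(\<exists>\<eta>>0. {p - \<eta><..<p + \<eta>} \<inter> - Q \<in> null_sets lborel) \<longleftrightarrow> (\<exists>\<eta>>0. {T p - \<eta><..<T p + \<eta>} \<inter> - Q \<in> null_sets lborel)"
        if Q: "Q = V \<or> Q = - V" for Q
        using shrink[OF _ _ Q] push[OF _ _ Q] pull[OF _ _ Q] by meson
      show "p \<in> U1 \<longleftrightarrow> T p \<in> U1" "p \<in> U0 \<longleftrightarrow> T p \<in> U0"
        using eqv[of V] eqv[of "- V"] p Tp by (auto simp: U1_def U0_def Diff_eq)
    qed
    define \<Delta> where "\<Delta> = {0<..<L} - (U1 \<union> U0)"
    \<comment> \<open>Away from the finite set \<open>G\<close>, the backward iterates up to time
      \<open>K\<close> move rigidly and avoid all ends of the intervals in \<open>P\<close>, so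
      \<open>V\<close> is locally constant.\<close>
    define G where "G = {z \<in> {0<..<L}. \<not> B.Ok K z} \<union> (\<Union>t<K. (T ^^ t) ` (fst ` P \<union> snd ` P))"
    interpret I: exch 0 L w0 S T D' D by (rule inverse)
    have finG: "finite G" unfolding G_def using I.finite_obs[of K] P by auto
    have loc: "\<exists>\<eta>>0. {z - \<eta><..<z + \<eta>} \<subseteq> V \<or> {z - \<eta><..<z + \<eta>} \<inter> V = {}" if z: "z \<in> {0<..<L}" "z \<notin> G" for z
    proof -
      have "B.Ok K z" using z by (auto simp: G_def)
      then obtain \<eta>0 where \<eta>0: "\<eta>0 > 0" "B.Free (z - \<eta>0) (z + \<eta>0) K" using B.ok_nbhd z by blast
      note bd = free_bounds[OF \<eta>0(2)]
      have tr: "(S ^^ t) y = (S ^^ t) z + (y - z)" if "z - \<eta>0 < y" "y < z + \<eta>0" "t < K" for y t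
        using B.free_tr_pt[OF \<eta>0(2) _ _ \<open>B.Ok K z\<close>, of t y] that \<eta>0 z by auto
      show ?thesis
      proof (cases "\<exists>t<K. (S ^^ t) z \<in> Y")
        case True
        then obtain t where t: "t < K" "(S ^^ t) z \<in> Y" by blast
        then obtain e where e: "e > 0" "\<And>y. dist y ((S ^^ t) z) < e \<Longrightarrow> y \<in> Y" using Yopen unfolding open_dist by blast
        have "y \<in> V" if "y \<in> {z - min e \<eta>0<..<z + min e \<eta>0}" for y
        proof -
          have "(S ^^ t) y \<in> Y" using tr[of y t] that t by (intro e(2)) (auto simp: dist_real_def)
          then show ?thesis using t that bd by (auto simp: V_def)
        qed
        then show ?thesis using e \<eta>0 by (intro exI[of _ "min e \<eta>0"]) auto
      next
        case False
        have "(S ^^ t) z \<notin> (\<Union>(p, r)\<in>P. {p..r})" if t: "t < K" for t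
        proof
          assume "(S ^^ t) z \<in> (\<Union>(p, r)\<in>P. {p..r})"
          then obtain p r where pr: "(p, r) \<in> P" "p \<le> (S ^^ t) z" "(S ^^ t) z \<le> r" by auto
          have "\<not> (p < (S ^^ t) z \<and> (S ^^ t) z < r)" using False t pr by (force simp: Y_def)
          then have "(S ^^ t) z = p \<or> (S ^^ t) z = r" using pr by auto
          then have "(S ^^ t) z \<in> fst ` P \<union> snd ` P" using pr by force
          moreover have "z = (T ^^ t) ((S ^^ t) z)" using T_S_funpow z by auto
          ultimately show False using z t by (auto simp: G_def)
        qed
        moreover have "closed (\<Union>(p, r)\<in>P. {p..r})" using P by (intro closed_UN) auto
        then have "open (- (\<Union>(p, r)\<in>P. {p..r}))" by (rule open_Compl)
        ultimately have "\<forall>t\<in>{..<K}. \<exists>e>0. \<forall>y. dist y ((S ^^ t) z) < e \<longrightarrow> y \<in> - (\<Union>(p, r)\<in>P. {p..r})"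
          unfolding open_dist by blast
        then obtain e where e: "\<And>t. t < K \<Longrightarrow> e t > 0 \<and> (\<forall>y. dist y ((S ^^ t) z) < e t \<longrightarrow> y \<in> - (\<Union>(p, r)\<in>P. {p..r}))"
          by (metis lessThan_iff)
        define m where "m = Min (insert \<eta>0 (e ` {..<K}))"
        have m: "m > 0" "m \<le> \<eta>0" "\<And>t. t < K \<Longrightarrow> m \<le> e t" unfolding m_def using e \<eta>0 by auto
        have "y \<notin> V" if y: "y \<in> {z - m<..<z + m}" for y
        proof
          assume "y \<in> V"
          then obtain t where t: "t < K" "(S ^^ t) y \<in> Y" by (auto simp: V_def)
          have "dist ((S ^^ t) y) ((S ^^ t) z) < e t" using tr[of y t] y t m(2) m(3)[OF t(1)] by (auto simp: dist_real_def)
          then show False using e t by (force simp: Y_def)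
        qed
        then show ?thesis using m by (intro exI[of _ m]) auto
      qed
    qed
    have locU: "z \<in> (if z \<in> V then U1 else U0)" if z: "z \<in> {0<..<L}" "z \<notin> G" for z
    proof -
      obtain \<eta> where \<eta>: "\<eta> > 0" "{z - \<eta><..<z + \<eta>} \<subseteq> V \<or> {z - \<eta><..<z + \<eta>} \<inter> V = {}" using loc[OF z] by blast
      have zi: "z \<in> {z - \<eta><..<z + \<eta>}" using \<eta> by auto
      show ?thesis
      proof (cases "z \<in> V")
        case True
        then have "{z - \<eta><..<z + \<eta>} - V = {}" using \<eta>(2) zi by blast
        then have "{z - \<eta><..<z + \<eta>} - V \<in> null_sets lborel" by (simp only: null_sets.empty_sets)
        then have "z \<in> U1" unfolding U1_def using z \<eta>(1) by blast
        then show ?thesis using True by simp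
      next
        case False
        then have "{z - \<eta><..<z + \<eta>} \<inter> V = {}" using \<eta>(2) zi by blast
        then have "{z - \<eta><..<z + \<eta>} \<inter> V \<in> null_sets lborel" by (simp only: null_sets.empty_sets)
        then have "z \<in> U0" unfolding U0_def using z \<eta>(1) by blast
        then show ?thesis using False by simp
      qed
    qed
    have op: "open {z \<in> {0<..<L}. \<exists>\<eta>>0. {z - \<eta><..<z + \<eta>} \<inter> - Q \<in> null_sets lborel}" if Q: "Q \<in> sets borel" for Q
      unfolding open_dist
    proof (intro ballI)
      fix z assume "z \<in> {z \<in> {0<..<L}. \<exists>\<eta>>0. {z - \<eta><..<z + \<eta>} \<inter> - Q \<in> null_sets lborel}"
      then obtain \<eta> where z: "0 < z" "z < L" and \<eta>: "\<eta> > 0" "{z - \<eta><..<z + \<eta>} \<inter> - Q \<in> null_sets lborel" by auto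
      show "\<exists>e>0. \<forall>y. dist y z < e \<longrightarrow> y \<in> {z \<in> {0<..<L}. \<exists>\<eta>>0. {z - \<eta><..<z + \<eta>} \<inter> - Q \<in> null_sets lborel}"
      proof (intro exI[of _ "min (\<eta> / 2) (min z (L - z))"] conjI allI impI)
        fix y assume y: "dist y z < min (\<eta> / 2) (min z (L - z))"
        have "{y - \<eta> / 2<..<y + \<eta> / 2} \<inter> - Q \<in> null_sets lborel"
        proof (rule null_sets_borel_subset[OF \<eta>(2)])
          have "\<bar>y - z\<bar> < \<eta> / 2" using y by (simp add: dist_real_def)
          then have "y - z < \<eta> / 2" "z - y < \<eta> / 2" by linarith+
          moreover have "\<eta> / 2 + \<eta> / 2 = \<eta>" by simp
          ultimately have "z - \<eta> \<le> y - \<eta> / 2" "y + \<eta> / 2 \<le> z + \<eta>" by linarith+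
          then have "{y - \<eta> / 2<..<y + \<eta> / 2} \<subseteq> {z - \<eta><..<z + \<eta>}" by auto
          then show "{y - \<eta> / 2<..<y + \<eta> / 2} \<inter> - Q \<subseteq> {z - \<eta><..<z + \<eta>} \<inter> - Q" by blast
          show "{y - \<eta> / 2<..<y + \<eta> / 2} \<inter> - Q \<in> sets borel" using Q by (auto intro: borel_comp)
        qed
        then show "y \<in> {z \<in> {0<..<L}. \<exists>\<eta>>0. {z - \<eta><..<z + \<eta>} \<inter> - Q \<in> null_sets lborel}"
          using y \<eta> by (auto simp: dist_real_def abs_less_iff intro!: exI[of _ "\<eta> / 2"])
      qed (use z \<eta> in auto)
    qed
    have opens: "open U1" "open U0"
      using op[OF Vb] op[of "- V"] Vb by (auto simp: U1_def U0_def Diff_eq borel_comp)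
    have disj: "U1 \<inter> U0 = {}"
    proof (rule ccontr)
      assume "U1 \<inter> U0 \<noteq> {}"
      then obtain z \<eta> \<eta>' where z: "\<eta> > 0" "{z - \<eta><..<z + \<eta>} - V \<in> null_sets lborel" "\<eta>' > 0" "{z - \<eta>'<..<z + \<eta>'} \<inter> V \<in> null_sets lborel"
        by (auto simp: U1_def U0_def)
      define e where "e = min \<eta> \<eta>'"
      have "({z - \<eta><..<z + \<eta>} - V) \<union> ({z - \<eta>'<..<z + \<eta>'} \<inter> V) \<in> null_sets lborel" using z by blast
      then have "{z - e<..<z + e} \<in> null_sets lborel" by (rule null_sets_borel_subset) (auto simp: e_def)
      then have "emeasure lborel {z - e<..<z + e} = 0" by auto
      moreover have e: "0 < e" using z by (simp add: e_def)
      then have "emeasure lborel {z - e<..<z + e} = ennreal ((z + e) - (z - e))" by (intro emeasure_lborel_Ioo) simp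
      ultimately show False using e by (simp add: ennreal_eq_0_iff)
    qed
    obtain y0 where "y0 \<in> Y" "y0 \<notin> G"
    proof -
      have "infinite Y" using Yopen \<open>Y \<noteq> {}\<close> finite_imp_not_open by blast
      then show thesis using that finG by (meson finite_subset subsetI)
    qed
    moreover have "y0 \<in> V" "y0 \<in> {0<..<L}" using \<open>y0 \<in> Y\<close> YV Yin by blast+
    ultimately have "y0 \<in> U1" using locU[of y0] by simp
    obtain z0 where "z0 \<in> {0<..<L}" "z0 \<notin> G" "z0 \<notin> V"
    proof -
      have "\<not> {0<..<L} \<subseteq> V \<union> G"
      proof
        assume "{0<..<L} \<subseteq> V \<union> G"
        then have "emeasure lborel {0<..<L} \<le> emeasure lborel (V \<union> G)" using Vb finG by (intro emeasure_mono) (auto simp: borel_closed finite_imp_closed)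
        also have "\<dots> = emeasure lborel V" using Vb finG by (intro emeasure_Un_null_set) (auto simp: finite_imp_null_set_lborel)
        finally show False using emV L_pos by simp
      qed
      then show thesis using that by blast
    qed
    then have "z0 \<in> U0" using locU[of z0] by auto
    \<comment> \<open>Otherwise the connected interval would be the union of two disjoint open sets,
      both nonempty since \<open>V\<close> is neither null nor of full measure.\<close>
    have "\<Delta> \<noteq> {}"
    proof
      assume "\<Delta> = {}"
      then have "{0<..<L} \<subseteq> U1 \<union> U0" by (auto simp: \<Delta>_def)
      then have "U1 \<inter> {0<..<L} = {} \<or> U0 \<inter> {0<..<L} = {}"
        using connectedD[OF connected_Ioo[of 0 L] opens] disj by blast
      then show False using \<open>y0 \<in> U1\<close> \<open>z0 \<in> U0\<close> by (auto simp: U1_def U0_def)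
    qed
    moreover have "finite \<Delta>"
    proof (rule finite_subset[OF _ finG])
      show "\<Delta> \<subseteq> G" using locU by (force simp: \<Delta>_def split: if_splits)
    qed
    moreover have "p \<in> \<Delta> \<longleftrightarrow> T p \<in> \<Delta>" if "p \<in> {0<..<L} - D" for p
      using locT[OF that] F.maps[OF that] that by (auto simp: \<Delta>_def)
    ultimately show False using no_invariant_boundary[of \<Delta>] by (auto simp: \<Delta>_def)
  qed
qed

end

section \<open>A criterion for unique ergodicity\<close>

context exch
begin

text \<open>If both failed, a backward hit of \<open>D'\<close> at time \<open>t2\<close> followed
  by a forward hit of \<open>D\<close> at time \<open>t1\<close> would give an orbit from
  \<open>D'\<close> that comes \<open>l\<close>-close to \<open>D\<close> at time
  \<open>t1 + t2 < 2 * n\<close>.\<close>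

lemma free_either:
  assumes ns: "\<And>x' k. x' \<in> D' \<Longrightarrow> k < H \<Longrightarrow> \<not> near D l ((T ^^ k) x')" and n: "2 * n \<le> H"
    and J: "lo \<le> p" "p < q" "q \<le> hi" "q - p \<le> l"
  shows "F.Free p q n \<or> B.Free p q n"
proof (rule ccontr)
  assume "\<not> ?thesis"
  then have nf: "\<not> F.Free p q n" "\<not> B.Free p q n" by auto
  obtain t1 y1 where 1: "t1 < n" "p < y1" "y1 < q" "F.Free p q t1" "(T ^^ t1) y1 \<in> D"
    using F.first_hit[OF nf(1) J(1-3)] by metis
  obtain t2 y2 where 2: "t2 < n" "p < y2" "y2 < q" "B.Free p q t2" "(S ^^ t2) y2 \<in> D'"
    using B.first_hit[OF nf(2) J(1-3)] by metis
  obtain c where c: "\<And>y. p < y \<Longrightarrow> y < q \<Longrightarrow> (T ^^ t1) y = y + c" using F.free_tr[OF 1(4) order_refl] by blast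
  have "(T ^^ t2) ((S ^^ t2) y2) = y2" using T_back[of y2 t2 t2] free_ok[OF 2(4)] 2 J by auto
  then have "(T ^^ (t1 + t2)) ((S ^^ t2) y2) = (T ^^ t1) y1 + (y2 - y1)" using c[of y1] c[of y2] 1 2 by (simp add: funpow_add)
  then have "near D l ((T ^^ (t1 + t2)) ((S ^^ t2) y2))" using 1 2 J unfolding near_def
    by (intro bexI[of _ "(T ^^ t1) y1"]) auto
  then show False using ns[OF 2(5), of "t1 + t2"] 1 2 n by auto
qed

text \<open>A return to the left is a shift by less than the length of the interval. If the shift is
  zero, the cylinder is periodic; otherwise \<open>cylinder_boundary\<close> turns it into a
  near-connection within \<open>l\<close>.\<close>

lemma free_no_left_return:
  assumes ns: "\<And>x' k. x' \<in> D' \<Longrightarrow> k < H \<Longrightarrow> \<not> near D l ((T ^^ k) x')" and n: "n \<le> H"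
    and J: "F.Free p q n" "q - p \<le> l" "l < w0" and r: "0 < r" "r \<le> n" and y: "p < y" "y < q"
  shows "\<not> (p < (T ^^ r) y \<and> (T ^^ r) y \<le> y)"
proof
  assume a: "p < (T ^^ r) y \<and> (T ^^ r) y \<le> y"
  obtain c where c: "\<And>y. p < y \<Longrightarrow> y < q \<Longrightarrow> (T ^^ r) y = y + c" using F.free_tr[OF J(1) r(2)] by blast
  have fr: "F.Free p (p + (q - p)) r" using free_mono[OF J(1) r(2)] free_bounds[OF J(1)] by auto
  have c0: "c \<le> 0" "- c < q - p" using a c[OF y] y by auto
  show False
  proof (cases "c = 0")
    case True
    then show False using no_periodic[OF fr _ r(1)] c by auto
  next
    case False
    obtain x' t where "x' \<in> D'" "t < r" "near D (- c) ((T ^^ t) x')"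
      by (rule cylinder_boundary[OF fr, of "- c"]) (use c c0 False J r in auto)
    then show False using ns[of x' t] near_mono[of D "- c" _ l] c0 J n r by auto
  qed
qed

lemma free_disjoint:
  assumes ns: "\<And>x' k. x' \<in> D' \<Longrightarrow> k < H \<Longrightarrow> \<not> near D l ((T ^^ k) x')" and n: "n \<le> H"
    and J: "F.Free p q n" "q - p \<le> l" "l < w0" and r: "0 < r" "r \<le> n" and y: "p < y" "y < q"
  shows "\<not> (p < (T ^^ r) y \<and> (T ^^ r) y < q)"
proof -
  interpret M: exch "-hi" "-lo" w0 "mir T" "mir S" "uminus ` D" "uminus ` D'" by (rule mirror)
  have "\<not> near (uminus ` D) l ((mir T ^^ k) x')" if "x' \<in> uminus ` D'" "k < H" for x' k
    using ns[of "- x'" k] that by (auto simp: mir_funpow near_mir mem_uminus_image)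
  then show ?thesis
    using free_no_left_return[OF ns n J r y] M.free_no_left_return[of H l n "-q" "-p" r "-y"] n J r y
    by (auto simp: free_mir mir_funpow)
qed

end

section \<open>Invariant measures and towers\<close>

context iet_data
begin

abbreviation "I \<equiv> {0..<L}"
abbreviation "BI \<equiv> restrict_space borel I"

lemma sets_BI: "Q \<in> sets BI \<longleftrightarrow> Q \<in> sets borel \<and> Q \<subseteq> I"
  by (subst sets_restrict_space_iff) auto

lemma T_measurable: "sets M = sets BI \<Longrightarrow> T \<in> measurable M M"
proof -
  assume s: "sets M = sets BI"
  then have sp: "space M = I" using sets_eq_imp_space_eq[OF s] by (simp add: space_restrict_space)
  show ?thesis
  proof (rule measurableI)
    show "T x \<in> space M" if "x \<in> space M" for x using that T_range sp by simp
    show "T -` A \<inter> space M \<in> sets M" if "A \<in> sets M" for A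
      using that T_vimage_borel[of A] unfolding s sets_BI sp by auto
  qed
qed

lemma S_measurable: "sets M = sets BI \<Longrightarrow> S \<in> measurable M M"
  using iet_data.T_measurable[OF inverse_data, unfolded L_inverse] .

lemma funpow_measurable: "sets M = sets BI \<Longrightarrow> (T ^^ t) \<in> measurable M M"
  using T_measurable[of M] by (induction t) (auto intro: measurable_comp simp: id_def)

lemma distr_funpow:
  assumes "sets M = sets BI" "distr M M T = M"
  shows "distr M M (T ^^ t) = M"
proof (induction t)
  case 0
  then show ?case by (simp add: id_def distr_id)
next
  case (Suc t)
  have "distr M M (T ^^ Suc t) = distr (distr M M (T ^^ t)) M T"
    using distr_distr[OF T_measurable[OF assms(1)] funpow_measurable[OF assms(1), of t]] by (simp only: funpow.simps)
  then show ?case unfolding Suc assms(2) .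
qed

lemma AE_funpow:
  assumes M: "sets M = sets BI" "distr M M T = M" and A: "AE x in M. x \<in> A \<longleftrightarrow> T x \<in> A"
  shows "AE x in M. x \<in> A \<longleftrightarrow> (T ^^ t) x \<in> A"
proof (induction t)
  case (Suc t)
  have "AE x in distr M M (T ^^ t). x \<in> A \<longleftrightarrow> T x \<in> A" unfolding distr_funpow[OF M] by (rule A)
  then have "AE x in M. (T ^^ t) x \<in> A \<longleftrightarrow> T ((T ^^ t) x) \<in> A"
    by (rule AE_distrD[OF funpow_measurable[OF M(1)]])
  with Suc show ?case by eventually_elim simp
qed simp

text \<open>The \<open>n\<close> images of an interval are disjoint, so one of them carries at most the average mass of \<open>W\<close>, while
  an invariant set has the same trace on all of them.\<close>
lemma tower_level:
  assumes ex: "exch 0 L w0 T S D D'"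
    and M: "sets M = sets BI" "distr M M T = M" "finite_measure M"
    and ns: "\<And>x' k. x' \<in> D' \<Longrightarrow> k < H \<Longrightarrow> \<not> near D l0 ((T ^^ k) x')"
    and l: "0 < l" "l \<le> l0" "l0 < w0" and n: "2 * n \<le> H" "0 < n" and p: "0 \<le> p" "p + l \<le> L"
    and W: "W \<in> sets M"
  shows "\<exists>r. 0 \<le> r \<and> r + l \<le> L \<and> measure M ({r<..<r + l} \<inter> W) \<le> measure M W / n \<and>
    (\<forall>A\<in>sets M. (AE x in M. x \<in> A \<longleftrightarrow> T x \<in> A) \<longrightarrow> measure M ({r<..<r + l} \<inter> A) = measure M ({p<..<p + l} \<inter> A))"
proof -
  interpret exch 0 L w0 T S D D' by fact
  interpret M: finite_measure M by fact
  have sp: "space M = I" using sets_eq_imp_space_eq[OF M(1)] by (simp add: space_restrict_space)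
  \<comment> \<open>If the given interval is free only backwards, the tower starts at its image
    \<open>n\<close> steps back and the interval becomes level \<open>n\<close>; otherwise it is
    level 0.\<close>
  obtain p' j where p': "F.Free p' (p' + l) n" "j \<le> n" "\<And>z. p' < z \<Longrightarrow> z < p' + l \<Longrightarrow> (T ^^ j) z = z + (p - p')"
  proof -
    have "F.Free p (p + l) n \<or> B.Free p (p + l) n" using free_either[OF ns n(1), of p "p + l"] p l by auto
    then show thesis
    proof
      assume "F.Free p (p + l) n"
      then show thesis using that[of p 0] by simp
    next
      assume fr: "B.Free p (p + l) n"
      obtain c where c: "\<And>y. p < y \<Longrightarrow> y < p + l \<Longrightarrow> (S ^^ n) y = y + c" using B.free_tr[OF fr order_refl] by blast
      note d = dual_free[OF fr c]
      show thesis by (rule that[of "p + c" n]) (use d in \<open>auto simp: algebra_simps\<close>)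
    qed
  qed
  have "\<exists>c. 0 \<le> p' + c \<and> p' + l + c \<le> L \<and> (\<forall>y. p' < y \<longrightarrow> y < p' + l \<longrightarrow> (T ^^ t) y = y + c)" if "t \<le> n" for t
    using F.free_tr[OF p'(1) that] by metis
  then obtain c where c: "\<And>t. t \<le> n \<Longrightarrow> 0 \<le> p' + c t \<and> p' + l + c t \<le> L \<and> (\<forall>y. p' < y \<longrightarrow> y < p' + l \<longrightarrow> (T ^^ t) y = y + c t)"
    by metis
  define J where "J t = {p' + c t<..<p' + c t + l}" for t
  have p'b: "0 \<le> p'" "p' + l \<le> L" using free_bounds[OF p'(1)] by auto
  have JB: "J t \<in> sets M" "J t \<subseteq> I" if "t \<le> n" for t
    unfolding M(1) sets_BI using c[OF that] by (auto simp: J_def)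
  \<comment> \<open>\<open>T\<close> is injective on \<open>I\<close>, so only points of the base
    can be on level \<open>t\<close> after \<open>t\<close> steps.\<close>
  have vim: "(T ^^ t) -` (J t \<inter> A) \<inter> I = {p'<..<p' + l} \<inter> ((T ^^ t) -` A \<inter> I)" if t: "t \<le> n" for t A
  proof (intro set_eqI iffI)
    fix z assume z: "z \<in> (T ^^ t) -` (J t \<inter> A) \<inter> I"
    define z' where "z' = (T ^^ t) z - c t"
    have z': "p' < z'" "z' < p' + l" using z by (auto simp: z'_def J_def)
    have "(T ^^ t) z' = (T ^^ t) z" using c[OF t] z' by (simp add: z'_def)
    moreover have "z' \<in> I" using z' p'b by auto
    ultimately have "z' = z" using S_T_funpow[of z' t] S_T_funpow[of z t] z by (metis IntD2)
    then show "z \<in> {p'<..<p' + l} \<inter> ((T ^^ t) -` A \<inter> I)" using z z' by auto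
  next
    fix z assume z: "z \<in> {p'<..<p' + l} \<inter> ((T ^^ t) -` A \<inter> I)"
    then have "(T ^^ t) z = z + c t" using c[OF t] by auto
    then show "z \<in> (T ^^ t) -` (J t \<inter> A) \<inter> I" using z by (auto simp: J_def)
  qed
  have meas: "measure M (J t \<inter> A) = measure M ({p'<..<p' + l} \<inter> A)"
    if t: "t \<le> n" and A: "A \<in> sets M" "AE x in M. x \<in> A \<longleftrightarrow> T x \<in> A" for t A
  proof -
    have JA: "J t \<inter> A \<in> sets M" using JB t A by auto
    have "measure M (J t \<inter> A) = measure (distr M M (T ^^ t)) (J t \<inter> A)" by (simp only: distr_funpow[OF M(1,2)])
    also have "\<dots> = measure M ((T ^^ t) -` (J t \<inter> A) \<inter> space M)"
      by (rule measure_distr[OF funpow_measurable[OF M(1)] JA])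
    also have "\<dots> = measure M ({p'<..<p' + l} \<inter> ((T ^^ t) -` A \<inter> space M))" unfolding sp vim[OF t] ..
    also have "\<dots> = measure M ({p'<..<p' + l} \<inter> A)"
    proof (rule measure_eq_AE)
      show "AE x in M. x \<in> {p'<..<p' + l} \<inter> ((T ^^ t) -` A \<inter> space M) \<longleftrightarrow> x \<in> {p'<..<p' + l} \<inter> A"
        using AE_funpow[OF M(1,2) A(2), of t] AE_space by eventually_elim auto
      have "{p'<..<p' + l} \<in> sets M" unfolding M(1) sets_BI using p'b by auto
      then show "{p'<..<p' + l} \<inter> ((T ^^ t) -` A \<inter> space M) \<in> sets M" "{p'<..<p' + l} \<inter> A \<in> sets M"
        using measurable_sets[OF funpow_measurable[OF M(1)] A(1), of t] A(1) by auto
    qed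
    finally show ?thesis .
  qed
  have disj: "J s \<inter> J t = {}" if st: "s < t" "t \<le> n" for s t
  proof (rule ccontr)
    assume "J s \<inter> J t \<noteq> {}"
    then obtain w where w: "w \<in> J s" "w \<in> J t" by auto
    define y where "y = w - c t"
    define z where "z = w - c s"
    have y: "p' < y" "y < p' + l" "(T ^^ t) y = w" using w c[of t] st by (auto simp: y_def J_def)
    have z: "p' < z" "z < p' + l" "(T ^^ s) z = w" using w c[of s] st by (auto simp: z_def J_def)
    have ts: "t - s \<le> n" using st by simp
    from c[OF this] have yI: "(T ^^ (t - s)) y \<in> I" using y by auto
    have "(T ^^ s) ((T ^^ (t - s)) y) = w" using y st by (metis comp_apply funpow_add le_add_diff_inverse less_imp_le)
    then have "(T ^^ (t - s)) y = (S ^^ s) w" using S_T_funpow[OF yI, of s] by simp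
    also have "\<dots> = z" using S_T_funpow[of z s] z p'b by auto
    finally have "(T ^^ (t - s)) y = z" .
    moreover have "\<not> (p' < (T ^^ (t - s)) y \<and> (T ^^ (t - s)) y < p' + l)"
      by (rule free_disjoint[of H l0 n]) (use ns y l n st ts p'(1) in auto)
    ultimately show False using z by simp
  qed
  obtain t where t: "t < n" "measure M (J t \<inter> W) \<le> measure M W / n"
  proof -
    have "(\<Sum>t<n. measure M (J t \<inter> W)) = measure M (\<Union>t<n. J t \<inter> W)"
    proof (rule M.finite_measure_finite_Union[symmetric])
      show "disjoint_family_on (\<lambda>t. J t \<inter> W) {..<n}"
        unfolding disjoint_family_on_def
      proof (intro ballI impI)
        fix i j assume "i \<in> {..<n}" "j \<in> {..<n}" "i \<noteq> j"
        then have "J i \<inter> J j = {}" using disj[of i j] disj[of j i] by (cases i j rule: linorder_cases) auto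
        then show "J i \<inter> W \<inter> (J j \<inter> W) = {}" by blast
      qed
    qed (use JB W in auto)
    also have "\<dots> \<le> measure M W" by (intro M.finite_measure_mono) (use W in auto)
    finally have sum: "(\<Sum>t<n. measure M (J t \<inter> W)) \<le> measure M W" .
    have "\<exists>t<n. measure M (J t \<inter> W) \<le> measure M W / n"
    proof (rule ccontr)
      assume "\<not> ?thesis"
      then have "(\<Sum>t<n. measure M W / n) < (\<Sum>t<n. measure M (J t \<inter> W))" using n by (intro sum_strict_mono) auto
      then show False using sum n by simp
    qed
    then show thesis using that by blast
  qed
  have Jj: "J j = {p<..<p + l}"
  proof -
    obtain z where z: "p' < z" "z < p' + l" using dense[of p' "p' + l"] l by auto
    have "c j = p - p'" using c[OF p'(2)] p'(3)[OF z] z by auto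
    then show ?thesis by (simp add: J_def)
  qed
  show ?thesis
  proof (intro exI[of _ "p' + c t"] conjI ballI impI)
    show "0 \<le> p' + c t" "p' + c t + l \<le> L" using c[of t] t by auto
    show "measure M ({p' + c t<..<p' + c t + l} \<inter> W) \<le> measure M W / n" using t by (simp add: J_def)
    show "measure M ({p' + c t<..<p' + c t + l} \<inter> A) = measure M ({p<..<p + l} \<inter> A)"
      if "A \<in> sets M" "AE x in M. x \<in> A \<longleftrightarrow> T x \<in> A" for A
      using meas[of t A] meas[OF p'(2), of A] t that Jj by (simp add: J_def)
  qed
qed

definition well_separated :: "real \<Rightarrow> nat \<Rightarrow> bool" where
  "well_separated e H \<longleftrightarrow> (\<forall>x'\<in>D'. \<forall>k<H. \<not> near D (e / H) ((T ^^ k) x'))"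

text \<open>With \<open>l = 2 * L / M\<close>, steps of \<open>l / 2\<close> exhaust
  \<open>I\<close> exactly, ready for half-overlapping intervals. Rounding costs constant factors
  only: \<open>H \<le> 3 * n\<close> and \<open>M * (e / H) \<le> 3 * L\<close>. The last two
  inequalities make \<open>n * l\<close> bounded below and \<open>M\<close> at most of order
  \<open>n\<close>, so that errors \<open>\<eta> / n\<close> on \<open>M\<close> intervals sum to
  order \<open>\<eta>\<close>.\<close>

lemma scale_choice:
  assumes "0 < e" "0 < \<delta>" and io: "\<And>N0. \<exists>H\<ge>N0. well_separated e H"
  obtains H M l n where "well_separated e H" "2 \<le> M" "l = 2 * L / real M" "0 < l" "l \<le> e / H" "e / H < \<delta>"
    "2 * n \<le> H" "0 < n" "e \<le> 6 * (real n * l)" "real M * e \<le> 9 * L * real n" "N0 \<le> n"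
proof -
  obtain N1 :: nat where N1: "real N1 > max (e / \<delta>) (e / L)" using reals_Archimedean2 by blast
  obtain H where H: "H \<ge> max (max N1 (2 * N0)) 2" "well_separated e H" using io by blast
  have H0: "real H > 0" "2 \<le> H" using H by auto
  have "real H > e / \<delta>" "real H > e / L" using H(1) N1 by auto
  then have eH: "e / H < \<delta>" "e / H < L" using assms L_pos H0 by (simp_all add: field_simps)
  define l0 where "l0 = e / H"
  have l0: "0 < l0" "l0 < L" "l0 < \<delta>" using eH assms H0 by (simp_all add: l0_def)
  define M where "M = nat \<lceil>2 * L / l0\<rceil>"
  have q: "2 < 2 * L / l0" using l0 by (simp add: field_simps)
  have M: "2 * L / l0 \<le> real M" "real M \<le> 2 * L / l0 + 1" using q unfolding M_def by linarith+
  have M2: "2 \<le> M" using M(1) q by linarith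
  define l where "l = 2 * L / real M"
  define n where "n = H div 2"
  have "H \<le> 3 * n" using H0(2) unfolding n_def by presburger
  then have "real H \<le> 3 * real n" by linarith
  then have n: "2 * n \<le> H" "real H \<le> 3 * real n" "0 < n" "N0 \<le> n" using H0 H(1) unfolding n_def by auto
  have l: "0 < l" "l \<le> l0" using M(1) M2 L_pos l0 by (simp_all add: l_def field_simps)
  have "real M \<le> 3 * L / l0" using M(2) q by simp
  then have Ml: "real M * l0 \<le> 3 * L" using l0 by (simp add: field_simps)
  have "2 * l0 \<le> 3 * l" using Ml M2 unfolding l_def by (simp add: field_simps)
  then have "2 * (real n * l0) \<le> 3 * (real n * l)" using mult_left_mono[of "2 * l0" "3 * l" "real n"] by simp
  moreover have "e \<le> 3 * (real n * l0)"
  proof -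
    have "e = real H * l0" using H0 by (simp add: l0_def)
    also have "\<dots> \<le> 3 * real n * l0" using n(2) l0 by (intro mult_right_mono) auto
    finally show ?thesis by simp
  qed
  ultimately have 1: "e \<le> 6 * (real n * l)" using l0 l by (smt (verit) mult_nonneg_nonneg of_nat_0_le_iff)
  have "real M * e = real M * l0 * real H" using H0 by (simp add: l0_def)
  also have "\<dots> \<le> 3 * L * (3 * real n)" by (rule mult_mono[OF Ml n(2)]) (use L_pos in auto)
  finally have 2: "real M * e \<le> 9 * L * real n" by simp
  show thesis using that[of H M l n] H(2) M2 l_def l eH n 1 2 l0_def by simp
qed

text \<open>The intervals used in \<open>ergodic\<close> are open and miss 0, so an atom there is
  excluded separately. Its image \<open>x1\<close> is an interior point of the same mass, and
  \<open>tower_level\<close> with \<open>W = A = I\<close> bounds the mass of an interval around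
  \<open>x1\<close> by a fraction \<open>1 / n\<close> of the total, for arbitrarily large
  \<open>n\<close>.\<close>

lemma measure_0_zero:
  assumes ex: "exch 0 L w0 T S D D'" and w0: "0 < w0"
    and M: "sets M = sets BI" "distr M M T = M" "finite_measure M"
    and e: "0 < e" and io: "\<And>N0. \<exists>H\<ge>N0. well_separated e H"
  shows "measure M {0} = 0"
proof -
  interpret exch 0 L w0 T S D D' by fact
  interpret M: finite_measure M by fact
  have sp: "space M = I" using sets_eq_imp_space_eq[OF M(1)] by (simp add: space_restrict_space)
  have IM: "I \<in> sets M" using sets.top[of M] unfolding sp .
  have 0: "0 \<in> I" using L_pos by simp
  obtain x1 where x1: "x1 \<in> D'" "T 0 = x1"
  proof -
    have 1: "1 \<in> {1..d}" using d2 by simp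
    have X1: "X 1 = a 1" using endpt_Suc(1)[of 0] by simp
    have "T 0 = X' (\<sigma> 1 - 1)" using T_eq[OF 1, of 0] pos[OF 1] X1 by simp
    moreover have "\<sigma> 1 - 1 \<in> {1..d - 1}" using sigma_1 sigma_in[of 1] 1 by auto
    ultimately show thesis using that by blast
  qed
  have x1in: "0 < x1" "x1 < L" using D'_in[OF x1(1)] by auto
  have "{x1} \<in> sets M" "{0} \<in> sets M" unfolding M(1) sets_BI using x1in L_pos by auto
  have "T -` {x1} \<inter> space M = {0}"
    unfolding sp
  proof (intro set_eqI iffI)
    fix z assume "z \<in> T -` {x1} \<inter> I"
    then have "T z = T 0" "z \<in> I" using x1(2) by auto
    then show "z \<in> {0}" using S_T[of z] S_T[OF 0] by simp
  qed (use 0 x1(2) in simp)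
  then have m: "measure M {0} = measure M {x1}"
    using measure_distr[OF T_measurable[OF M(1)] \<open>{x1} \<in> sets M\<close>] M(2) by simp
  have bound: "real N0 * measure M {x1} \<le> measure M I" for N0
  proof -
    define \<delta> where "\<delta> = min w0 (min x1 (L - x1))"
    have "0 < \<delta>" using w0 x1in by (simp add: \<delta>_def)
    obtain H K l n where s: "well_separated e H" "2 \<le> K" "l = 2 * L / real K" "0 < l" "l \<le> e / H" "e / H < \<delta>"
      "2 * n \<le> H" "0 < n" "e \<le> 6 * (real n * l)" "real K * e \<le> 9 * L * real n" "N0 \<le> n"
      by (rule scale_choice[OF e \<open>0 < \<delta>\<close> io])
    have ns: "\<not> near D (e / H) ((T ^^ k) x')" if "x' \<in> D'" "k < H" for x' k using s(1) that by (auto simp: well_separated_def)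
    have lw: "e / H < w0" "e / H < L - x1" "e / H < x1" using s(6) by (auto simp: \<delta>_def)
    have p: "0 \<le> x1 - l / 2" "x1 - l / 2 + l \<le> L" using s(4,5) lw by (auto simp: field_simps)
    obtain r where r: "measure M ({r<..<r + l} \<inter> I) \<le> measure M I / n"
      "\<forall>A\<in>sets M. (AE x in M. x \<in> A \<longleftrightarrow> T x \<in> A) \<longrightarrow> measure M ({r<..<r + l} \<inter> A) = measure M ({x1 - l / 2<..<x1 - l / 2 + l} \<inter> A)"
      using tower_level[OF ex M ns s(4,5) lw(1) s(7,8) p IM] by blast
    have "AE x in M. x \<in> I \<longleftrightarrow> T x \<in> I" by (rule AE_I2) (use sp T_range in auto)
    from r(2)[rule_format, OF IM this] have "measure M ({x1 - l / 2<..<x1 - l / 2 + l} \<inter> I) \<le> measure M I / n" using r(1) by simp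
    moreover have "measure M {x1} \<le> measure M ({x1 - l / 2<..<x1 - l / 2 + l} \<inter> I)"
    proof (rule M.finite_measure_mono)
      show "{x1 - l / 2<..<x1 - l / 2 + l} \<inter> I \<in> sets M" unfolding M(1) sets_BI by auto
    qed (use s(4) x1in in auto)
    ultimately have "measure M {x1} \<le> measure M I / n" by simp
    then have "real n * measure M {x1} \<le> measure M I" using s(8) by (simp add: field_simps)
    moreover have "real N0 * measure M {x1} \<le> real n * measure M {x1}" using s(11) by (intro mult_right_mono) auto
    ultimately show ?thesis by simp
  qed
  have "measure M {x1} = 0"
  proof (rule ccontr)
    assume "measure M {x1} \<noteq> 0"
    then have pos: "0 < measure M {x1}" by (simp add: zero_less_measure_iff)
    obtain N0 :: nat where "real N0 > measure M I / measure M {x1}" using reals_Archimedean2 by blast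
    then show False using bound[of N0] pos by (simp add: field_simps)
  qed
  then show ?thesis using m by simp
qed

text \<open>With \<open>W = U - K\<close>, where \<open>K \<subseteq> A \<subseteq> U\<close> with \<open>K\<close> compact, \<open>U\<close> open and \<open>W\<close> of small measure, the level
  meets \<open>W\<close> little and, being short, lies in \<open>U\<close> or misses \<open>K\<close>. So every interval of length \<open>l\<close> is almost
  contained in \<open>A\<close> or in its complement, and overlapping intervals agree on which.\<close>
lemma ergodic:
  assumes ex: "exch 0 L w0 T S D D'" and w0: "0 < w0"
    and M: "sets M = sets BI" "distr M M T = M" "finite_measure M"
    and c: "0 < c" "\<And>p q. 0 \<le> p \<Longrightarrow> p < q \<Longrightarrow> q \<le> L \<Longrightarrow> c * (q - p) \<le> measure M {p<..<q}"
    and e: "0 < e" and io: "\<And>N0. \<exists>H\<ge>N0. well_separated e H"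
    and A: "A \<in> sets M" "AE x in M. x \<in> A \<longleftrightarrow> T x \<in> A"
  shows "measure M A = 0 \<or> measure M (I - A) = 0"
proof (rule ccontr)
  assume neg: "\<not> ?thesis"
  interpret exch 0 L w0 T S D D' by fact
  interpret M: finite_measure M by fact
  have sp: "space M = I" using sets_eq_imp_space_eq[OF M(1)] by (simp add: space_restrict_space)
  have IA: "I - A \<in> sets M" using A(1) sets.compl_sets[of A M] sp by simp
  have IAinv: "AE x in M. x \<in> I - A \<longleftrightarrow> T x \<in> I - A" using A(2) AE_space by eventually_elim (use sp T_range in auto)
  define m where "m = min (measure M A) (measure M (I - A))"
  have m: "0 < m" using neg unfolding m_def by (simp add: zero_less_measure_iff)
  \<comment> \<open>The first entry makes the overlap of two neighbouring intervals, of mass at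
    least \<open>c * l / 2\<close>, too heavy to be almost inside and almost outside
    \<open>A\<close> (used in \<open>ov\<close>); the second makes \<open>k\<close> errors
    \<open>\<eta> / n\<close> sum to less than \<open>m\<close> (used in
    \<open>total\<close>).\<close>
  define \<eta> where "\<eta> = min (c * e / 48) (m * e / (18 * L))"
  have \<eta>: "0 < \<eta>" "\<eta> < c * e / 24" "9 * L * \<eta> < m * e"
  proof -
    show "0 < \<eta>" using c e m L_pos by (simp add: \<eta>_def)
    have "0 < c * e" "0 < m * e" using c e m by auto
    moreover have "\<eta> \<le> c * e / 48" by (simp add: \<eta>_def)
    ultimately show "\<eta> < c * e / 24" by linarith
    have "\<eta> \<le> m * e / (18 * L)" by (simp add: \<eta>_def)
    then have "18 * (L * \<eta>) \<le> m * e" using L_pos by (simp add: field_simps)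
    then show "9 * L * \<eta> < m * e" using \<open>0 < m * e\<close> by linarith
  qed
  \<comment> \<open>The image of \<open>M\<close> on the Borel sets of the whole line, where inner
    and outer regularity apply.\<close>
  define N where "N = distr M borel (\<lambda>x. x)"
  have id: "(\<lambda>x. x) \<in> measurable M borel"
  proof (rule measurableI)
    show "(\<lambda>x. x) -` B \<inter> space M \<in> sets M" if "B \<in> sets borel" for B using that unfolding M(1) sets_BI sp by auto
  qed simp
  have emN: "emeasure N B = emeasure M (B \<inter> I)" if "B \<in> sets borel" for B
    using that emeasure_distr[OF id, of B] sp by (simp add: N_def)
  have N: "sets N = sets borel" "emeasure N (space N) \<noteq> \<infinity>"
    using emN[of UNIV] by (auto simp: N_def)
  have Ab: "A \<in> sets borel" "A \<subseteq> I" using A(1) unfolding M(1) sets_BI by auto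
  have mN: "emeasure N B = ennreal (measure M (B \<inter> I))" if "B \<in> sets borel" for B using emN[OF that] by (simp add: M.emeasure_eq_measure)
  obtain K where K: "compact K" "K \<subseteq> A" "measure M A - \<eta> / 2 < measure M K"
  proof -
    have "ennreal (measure M A - \<eta> / 2) < emeasure N A \<or> measure M A - \<eta> / 2 < 0"
      using mN[OF Ab(1)] Ab(2) \<eta> by (auto simp: Int_absorb2 ennreal_less_iff not_less)
    then show thesis
    proof
      assume "ennreal (measure M A - \<eta> / 2) < emeasure N A"
      then obtain K where K: "K \<subseteq> A" "compact K" "ennreal (measure M A - \<eta> / 2) < emeasure N K"
        unfolding inner_regular[OF N Ab(1)] less_SUP_iff by auto
      have "K \<subseteq> I" "K \<in> sets borel" using K Ab by (auto simp: borel_compact)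
      then have "ennreal (measure M A - \<eta> / 2) < ennreal (measure M K)" using K(3) mN[of K] by (simp add: Int_absorb2)
      moreover have "0 \<le> measure M K" by simp
      ultimately have "measure M A - \<eta> / 2 < measure M K"
        by (cases "0 \<le> measure M A - \<eta> / 2") (simp add: ennreal_less_iff, linarith)
      then show thesis by (rule that[OF K(2,1)])
    next
      assume "measure M A - \<eta> / 2 < 0"
      then show thesis using that[of "{}"] by simp
    qed
  qed
  obtain U where U: "open U" "A \<subseteq> U" "measure M (U \<inter> I) < measure M A + \<eta> / 2"
  proof -
    have "emeasure N A < ennreal (measure M A + \<eta> / 2)"
      using mN[OF Ab(1)] Ab(2) \<eta> by (auto simp: Int_absorb2 intro!: ennreal_lessI)
    then obtain U where U: "A \<subseteq> U" "open U" "emeasure N U < ennreal (measure M A + \<eta> / 2)"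
      unfolding outer_regular[OF N Ab(1)] INF_less_iff by auto
    then have "ennreal (measure M (U \<inter> I)) < ennreal (measure M A + \<eta> / 2)" using mN[of U] by simp
    then show thesis using that[OF U(2,1)] by (simp add: ennreal_less_iff)
  qed
  have Kb: "K \<in> sets M" "K \<subseteq> I" using K Ab unfolding M(1) sets_BI by (auto simp: borel_compact)
  have Ub: "U \<inter> I \<in> sets M" unfolding M(1) sets_BI using U by auto
  define W where "W = U \<inter> I - K"
  have Wb: "W \<in> sets M" using Kb Ub by (auto simp: W_def)
  have mW: "measure M W \<le> \<eta>"
  proof -
    have "measure M W = measure M (U \<inter> I) - measure M K"
      unfolding W_def using Kb Ub K U by (intro M.finite_measure_Diff) auto
    then show ?thesis using K U by simp
  qed
  obtain \<delta> where \<delta>: "0 < \<delta>" "(\<Union>x\<in>K. ball x \<delta>) \<subseteq> U"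
    using compact_subset_open_imp_ball_epsilon_subset[OF K(1) U(1)] K U by blast
  have "0 < min \<delta> w0" using \<delta> w0 by simp
  obtain H k l n where s: "well_separated e H" "2 \<le> k" "l = 2 * L / real k" "0 < l" "l \<le> e / H" "e / H < min \<delta> w0"
    "2 * n \<le> H" "0 < n" "e \<le> 6 * (real n * l)" "real k * e \<le> 9 * L * real n"
    by (rule scale_choice[OF e \<open>0 < min \<delta> w0\<close> io, of 0])
  have ns: "\<not> near D (e / H) ((T ^^ i) x')" if "x' \<in> D'" "i < H" for x' i using s(1) that by (auto simp: well_separated_def)
  have lw: "e / H < w0" "l < \<delta>" using s(5,6) by auto
  have dich: "measure M ({p<..<p + l} \<inter> (I - A)) \<le> \<eta> / n \<or> measure M ({p<..<p + l} \<inter> A) \<le> \<eta> / n"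
    if p: "0 \<le> p" "p + l \<le> L" for p
  proof -
    obtain r where r: "0 \<le> r" "r + l \<le> L" "measure M ({r<..<r + l} \<inter> W) \<le> measure M W / n"
      "\<forall>A\<in>sets M. (AE x in M. x \<in> A \<longleftrightarrow> T x \<in> A) \<longrightarrow> measure M ({r<..<r + l} \<inter> A) = measure M ({p<..<p + l} \<inter> A)"
      using tower_level[OF ex M ns s(4,5) lw(1) s(7,8) p Wb] by blast
    have rJ: "{r<..<r + l} \<in> sets M" unfolding M(1) sets_BI using r by auto
    have le: "measure M ({r<..<r + l} \<inter> W) \<le> \<eta> / n" using r(3) mW by (meson divide_right_mono of_nat_0_le_iff order_trans)
    show ?thesis
    proof (cases "{r<..<r + l} \<inter> K = {}")
      case True
      have "measure M ({r<..<r + l} \<inter> A) \<le> measure M ({r<..<r + l} \<inter> W)"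
        using True U(2) Ab rJ Wb by (intro M.finite_measure_mono) (auto simp: W_def)
      then show ?thesis using le r(4)[rule_format, OF A] by auto
    next
      case False
      then obtain z where z: "z \<in> K" "r < z" "z < r + l" by auto
      have "{r<..<r + l} \<subseteq> ball z \<delta>" using z lw by (auto simp: dist_real_def)
      then have "{r<..<r + l} \<subseteq> U" using \<delta>(2) z(1) by blast
      then have "measure M ({r<..<r + l} \<inter> (I - A)) \<le> measure M ({r<..<r + l} \<inter> W)"
        using K(2) rJ Wb by (intro M.finite_measure_mono) (auto simp: W_def)
      then show ?thesis using le r(4)[rule_format, OF IA IAinv] by auto
    qed
  qed
  define J where "J i = {real i * (l / 2)<..<real i * (l / 2) + l}" for i :: nat
  have kl: "real k * (l / 2) = L" using s(2,3) by simp
  have Jin: "0 \<le> real i * (l / 2)" "real i * (l / 2) + l \<le> L" if "i + 2 \<le> k" for i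
  proof -
    have "real (i + 2) * (l / 2) \<le> real k * (l / 2)" using that s(4) by (intro mult_right_mono) auto
    then show "real i * (l / 2) + l \<le> L" unfolding kl by (simp add: algebra_simps)
  qed (use s(4) in simp)
  have JM: "J i \<in> sets M" if "i + 2 \<le> k" for i
  proof -
    have "{p<..<q} \<subseteq> I" if "0 \<le> p" "q \<le> L" for p q using that by auto
    from this[OF Jin[OF that]] show ?thesis unfolding M(1) sets_BI J_def by simp
  qed
  define P where "P i \<longleftrightarrow> measure M (J i \<inter> A) \<le> \<eta> / n" for i
  define Q where "Q i \<longleftrightarrow> measure M (J i \<inter> (I - A)) \<le> \<eta> / n" for i
  have PQ: "P i \<or> Q i" if "i + 2 \<le> k" for i
    using dich[OF Jin[OF that]] by (auto simp: P_def Q_def J_def)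
  have ov: "\<not> (measure M (J i \<inter> B) \<le> \<eta> / n \<and> measure M (J j \<inter> (I - B)) \<le> \<eta> / n)"
    if ij: "i + 2 \<le> k" "j + 2 \<le> k" "j = i \<or> j = Suc i \<or> i = Suc j" and B: "B \<in> sets M" for i j B
  proof
    assume as: "measure M (J i \<inter> B) \<le> \<eta> / n \<and> measure M (J j \<inter> (I - B)) \<le> \<eta> / n"
    define t where "t = real (max i j) * (l / 2)"
    have t: "{t<..<t + l / 2} \<subseteq> J i \<inter> J j" "0 \<le> t" "t + l / 2 \<le> L"
    proof -
      define h where "h = l / 2"
      have h: "l = h + h" "0 < h" using s(4) by (auto simp: h_def)
      have Sh: "real (Suc i) * h = real i * h + h" for i by (simp add: algebra_simps)
      show "{t<..<t + l / 2} \<subseteq> J i \<inter> J j" "0 \<le> t" "t + l / 2 \<le> L"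
        using ij(3) h Jin[OF ij(1)] Jin[OF ij(2)] unfolding t_def J_def h_def[symmetric]
        by (auto simp: max_def Sh simp del: of_nat_Suc)
    qed
    have Bs: "J i \<inter> B \<in> sets M" "J j \<inter> (I - B) \<in> sets M"
      using JM[OF ij(1)] JM[OF ij(2)] B sets.compl_sets[OF B] sp by auto
    have tI: "{t<..<t + l / 2} \<subseteq> I" using t by auto
    have "c * (l / 2) \<le> measure M {t<..<t + l / 2}" using c(2)[of t "t + l / 2"] t s(4) by simp
    also have "\<dots> \<le> measure M ((J i \<inter> B) \<union> (J j \<inter> (I - B)))"
      using t tI Bs by (intro M.finite_measure_mono) auto
    also have "\<dots> \<le> measure M (J i \<inter> B) + measure M (J j \<inter> (I - B))" using Bs by (rule measure_Un_le)
    also have "\<dots> \<le> 2 * (\<eta> / n)" using as by simp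
    finally have "c * l * n \<le> 4 * \<eta>" using s(8) by (simp add: field_simps)
    moreover have "c * e \<le> 6 * (c * l * n)" using mult_left_mono[OF s(9), of c] c by (simp add: algebra_simps)
    ultimately show False using \<eta>(2) by simp
  qed
  have IIA: "I - (I - A) = A" using Ab by auto
  have consistent: "P i = P 0" if "i + 2 \<le> k" for i
    using that
  proof (induction i)
    case (Suc i)
    have "P (Suc i) = P i"
      using ov[OF _ Suc.prems, of i A] ov[OF Suc.prems _ _ A(1), of i] PQ[OF Suc.prems] PQ[of i] Suc.prems A(1)
      unfolding P_def Q_def by auto
    then show ?case using Suc by simp
  qed simp
  have cover: "I - {0} \<subseteq> (\<Union>i<k - 1. J i)"
  proof
    fix z assume z: "z \<in> I - {0}"
    define i where "i = nat \<lceil>z / (l / 2)\<rceil> - 1"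
    have zp: "0 < z / (l / 2)" "z < L" using z s(4) by auto
    have c1: "real (nat \<lceil>z / (l / 2)\<rceil>) = of_int \<lceil>z / (l / 2)\<rceil>" "1 \<le> nat \<lceil>z / (l / 2)\<rceil>" using zp by (auto simp: le_nat_iff one_le_ceiling)
    have ri: "real i = of_int \<lceil>z / (l / 2)\<rceil> - 1" using c1 by (simp add: i_def of_nat_diff)
    have "real i < z / (l / 2)" "z / (l / 2) \<le> real i + 1" using ri by linarith+
    then have zi: "real i * (l / 2) < z" "z \<le> (real i + 1) * (l / 2)" using s(4) by (simp_all add: field_simps)
    have "real i < real k"
    proof (rule ccontr)
      assume "\<not> real i < real k"
      then have "real k * (l / 2) \<le> real i * (l / 2)" using s(4) by (intro mult_right_mono) auto
      then show False using zi zp kl by simp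
    qed
    show "z \<in> (\<Union>i<k - 1. J i)"
    proof (cases "i < k - 1")
      case True
      have "(real i + 1) * (l / 2) < real i * (l / 2) + l" using s(4) by (simp add: algebra_simps)
      then show ?thesis using True zi by (auto simp: J_def)
    next
      case False
      then have ik: "real i = real (k - 2) + 1" using \<open>real i < real k\<close> s(2) by auto
      have "z < real (k - 2) * (l / 2) + l"
      proof -
        have "real k = real (k - 2) + 2" using s(2) by simp
        then have "L = (real (k - 2) + 2) * (l / 2)" using kl by metis
        also have "\<dots> = real (k - 2) * (l / 2) + l" unfolding distrib_right by simp
        finally show ?thesis using zp by linarith
      qed
      moreover have "real (k - 2) * (l / 2) < z"
      proof -
        have "real i * (l / 2) = real (k - 2) * (l / 2) + l / 2" unfolding ik distrib_right by simp
        then show ?thesis using zi s(4) by linarith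
      qed
      ultimately have "z \<in> J (k - 2)" by (simp add: J_def)
      moreover have "k - 2 \<in> {..<k - 1}" using s(2) by auto
      ultimately show ?thesis by blast
    qed
  qed
  have total: "measure M B < m" if B: "B \<in> sets M" "\<And>i. i + 2 \<le> k \<Longrightarrow> measure M (J i \<inter> B) \<le> \<eta> / n" for B
  proof -
    have BI: "B \<subseteq> I" using sets.sets_into_space[OF B(1)] sp by simp
    have z0: "{0} \<in> sets M" unfolding M(1) sets_BI using L_pos by auto
    have UJ: "(\<Union>i<k - 1. J i \<inter> B) \<in> sets M"
    proof (rule sets.finite_UN)
      fix i assume "i \<in> {..<k - 1}"
      then have "J i \<in> sets M" by (intro JM) auto
      then show "J i \<inter> B \<in> sets M" using B(1) by (rule sets.Int)
    qed simp
    have "measure M B \<le> measure M ({0} \<union> (\<Union>i<k - 1. J i \<inter> B))"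
    proof (rule M.finite_measure_mono)
      show "B \<subseteq> {0} \<union> (\<Union>i<k - 1. J i \<inter> B)" using cover BI by blast
    qed (rule sets.Un[OF z0 UJ])
    also have "\<dots> \<le> measure M {0} + measure M (\<Union>i<k - 1. J i \<inter> B)"
      by (rule measure_Un_le[OF z0 UJ])
    also have "measure M (\<Union>i<k - 1. J i \<inter> B) \<le> (\<Sum>i<k - 1. measure M (J i \<inter> B))"
    proof (rule measure_UNION_le)
      fix i assume "i \<in> {..<k - 1}"
      then have "J i \<in> sets M" by (intro JM) auto
      then show "J i \<inter> B \<in> sets M" using B(1) by (rule sets.Int)
    qed simp
    also have "\<dots> \<le> (\<Sum>i<k - 1. \<eta> / n)" using B(2) by (intro sum_mono) auto
    also have "(\<Sum>i<k - 1. \<eta> / n) = real (k - 1) * (\<eta> / n)" by simp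
    also have "\<dots> \<le> real k * (\<eta> / n)" by (rule mult_right_mono) (use \<eta>(1) in auto)
    finally have "measure M B \<le> real k * \<eta> / n" using measure_0_zero[OF ex w0 M e io] by simp
    then have "measure M B * n * e \<le> real k * \<eta> * e" using s(8) e by (simp add: field_simps)
    also have "\<dots> = (real k * e) * \<eta>" by simp
    also have "\<dots> \<le> (9 * L * real n) * \<eta>" using s(10) \<eta>(1) by (intro mult_right_mono) auto
    also have "\<dots> < (m * e) * real n" using \<eta>(3) s(8) mult_strict_right_mono[OF \<eta>(3), of "real n"] by (simp add: algebra_simps)
    finally have "measure M B * (n * e) < m * (n * e)" by (simp add: algebra_simps)
    then show ?thesis using s(8) e by (simp add: mult_less_cancel_right)
  qed
  show False
  proof (cases "P 0")
    case True
    then have "measure M A < m" using consistent by (intro total A(1)) (auto simp: P_def)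
    then show False by (simp add: m_def)
  next
    case False
    then have "Q i" if "i + 2 \<le> k" for i using consistent[OF that] PQ[OF that] by auto
    then have "measure M (I - A) < m" by (intro total IA) (auto simp: Q_def)
    then show False by (simp add: m_def)
  qed
qed

section \<open>From ergodicity to uniqueness\<close>

abbreviation "Leb \<equiv> uniform_measure (restrict_space lborel I) I"

lemma sets_Leb: "sets Leb = sets BI"
  by (simp add: sets_restrict_space_cong[of lborel borel])

lemma emeasure_Leb: "Q \<in> sets BI \<Longrightarrow> emeasure Leb Q = emeasure lborel Q / ennreal L"
proof -
  assume Q: "Q \<in> sets BI"
  then have Qb: "Q \<in> sets borel" "Q \<subseteq> I" unfolding sets_BI by auto
  have s: "I \<in> sets (restrict_space lborel I)" "Q \<in> sets (restrict_space lborel I)"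
    using Qb by (subst sets_restrict_space_iff; simp)+
  have "emeasure Leb Q = emeasure (restrict_space lborel I) (I \<inter> Q) / emeasure (restrict_space lborel I) I"
    using s by (rule emeasure_uniform_measure)
  then show ?thesis using Qb L_pos by (simp add: emeasure_restrict_space Int_absorb1)
qed

lemma space_BI: "sets M = sets BI \<Longrightarrow> space M = I"
  using sets_eq_imp_space_eq[of M BI] by (simp add: space_restrict_space)

lemma prob_Leb: "prob_space Leb"
proof (rule prob_spaceI)
  have "I \<in> sets BI" unfolding sets_BI by simp
  then show "emeasure Leb (space Leb) = 1" unfolding space_BI[OF sets_Leb]
    using emeasure_Leb[of I] L_pos by (simp add: ennreal_divide_self)
qed

lemma invariantI:
  assumes "sets M = sets BI" "\<And>Q. Q \<in> sets BI \<Longrightarrow> emeasure M (T -` Q \<inter> I) = emeasure M Q"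
  shows "distr M M T = M"
proof (rule measure_eqI)
  show "emeasure (distr M M T) A = emeasure M A" if "A \<in> sets (distr M M T)" for A
    using that assms emeasure_distr[OF T_measurable[OF assms(1)], of A] space_BI[OF assms(1)] by simp
qed simp

lemma invariantD:
  assumes "sets M = sets BI" "distr M M T = M" "Q \<in> sets BI"
  shows "emeasure M (T -` Q \<inter> I) = emeasure M Q"
  using emeasure_distr[OF T_measurable[OF assms(1)], of Q] assms space_BI[OF assms(1)] by simp

lemma invariant_Leb: "distr Leb Leb T = Leb"
proof (rule invariantI[OF sets_Leb])
  fix Q assume Q: "Q \<in> sets BI"
  then have "T -` Q \<inter> I \<in> sets BI" using T_vimage_borel[of Q] by (auto simp: sets_BI)
  then show "emeasure Leb (T -` Q \<inter> I) = emeasure Leb Q"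
    using Q emeasure_T_vimage[of Q] by (simp add: emeasure_Leb sets_BI)
qed

lemma invariant_S:
  assumes M: "sets M = sets BI" "distr M M T = M"
  shows "distr M M S = M"
proof -
  have "distr M M S = distr (distr M M T) M S" using M by simp
  also have "\<dots> = distr M M (S \<circ> T)" by (rule distr_distr[OF S_measurable[OF M(1)] T_measurable[OF M(1)]])
  also have "\<dots> = distr M M (\<lambda>x. x)" by (rule distr_cong) (use S_T space_BI[OF M(1)] in auto)
  finally show ?thesis by simp
qed

text \<open>Apply \<open>ergodic\<close> to \<open>N = (M + Leb) / 2\<close> and to the invariant set \<open>{g > 1 / 2}\<close>, where \<open>g\<close> is the density
  of \<open>Leb\<close> with respect to \<open>N\<close>.\<close>
lemma unique_invariant:
  assumes ex: "exch 0 L w0 T S D D'" and w0: "0 < w0"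
    and e: "0 < e" and io: "\<And>N0. \<exists>H\<ge>N0. well_separated e H"
    and M: "sets M = sets BI" "prob_space M" "distr M M T = M"
  shows "M = Leb"
proof -
  interpret M: prob_space M by fact
  interpret Lb: prob_space Leb by (rule prob_Leb)
  \<comment> \<open>\<open>N\<close> is taken as the sum, of total mass 2; a density 1 / 2 of
    \<open>Leb\<close> with respect to it means that \<open>M\<close> and \<open>Leb\<close> weigh
    equally.\<close>
  define N where "N = measure_of (space BI) (sets BI) (\<lambda>Q. emeasure M Q + emeasure Leb Q)"
  have sN: "sets N = sets BI" unfolding N_def by (rule sets.sets_measure_of_eq)
  have eN: "emeasure N Q = emeasure M Q + emeasure Leb Q" if "Q \<in> sets BI" for Q
  proof (rule emeasure_measure_of[OF N_def sets.space_closed])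
    show "positive (sets N) (\<lambda>Q. emeasure M Q + emeasure Leb Q)" by (simp add: positive_def)
    show "countably_additive (sets N) (\<lambda>Q. emeasure M Q + emeasure Leb Q)"
    proof (rule countably_additiveI)
      fix A :: "nat \<Rightarrow> real set" assume A: "range A \<subseteq> sets N" "disjoint_family A"
      have "(\<Sum>i. emeasure M (A i) + emeasure Leb (A i)) = (\<Sum>i. emeasure M (A i)) + (\<Sum>i. emeasure Leb (A i))"
        by (intro suminf_add[symmetric] summableI)
      then show "(\<Sum>i. emeasure M (A i) + emeasure Leb (A i)) = emeasure M (\<Union> (range A)) + emeasure Leb (\<Union> (range A))"
        using suminf_emeasure[of A M] suminf_emeasure[of A Leb] A sN M(1) sets_Leb by simp
    qed
    show "Q \<in> sets N" using that sN by simp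
  qed
  have spN: "space N = I" by (rule space_BI[OF sN])
  have IB: "I \<in> sets BI" by (simp add: sets_BI)
  have tot: "emeasure M I = 1" "emeasure Leb I = 1"
    using M.emeasure_space_1 Lb.emeasure_space_1 unfolding space_BI[OF M(1)] space_BI[OF sets_Leb] by auto
  have eNI: "emeasure N I = 2" using eN[OF IB] tot by (simp add: one_add_one)
  have finN: "finite_measure N" by standard (simp add: spN eNI)
  interpret N: finite_measure N by fact
  have vB: "T -` Q \<inter> I \<in> sets BI" if "Q \<in> sets BI" for Q using that T_vimage_borel[of Q] by (auto simp: sets_BI)
  have invN: "distr N N T = N"
  proof (rule invariantI[OF sN])
    fix Q assume Q: "Q \<in> sets BI"
    show "emeasure N (T -` Q \<inter> I) = emeasure N Q"
      unfolding eN[OF Q] eN[OF vB[OF Q]]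
      using invariantD[OF M(1,3) Q] invariantD[OF sets_Leb invariant_Leb Q] by simp
  qed
  have "absolutely_continuous N Leb"
    unfolding absolutely_continuous_def
  proof
    fix Q assume "Q \<in> null_sets N"
    then have "Q \<in> sets BI" "emeasure N Q = 0" using sN by auto
    then show "Q \<in> null_sets Leb" using eN[of Q] sets_Leb by (auto intro!: null_setsI)
  qed
  then obtain g where g: "g \<in> borel_measurable N" "density N g = Leb"
    using N.Radon_Nikodym[of Leb] sN sets_Leb by auto
  have Tm: "T \<in> measurable N N" and Sm: "S \<in> measurable N N" using T_measurable[OF sN] S_measurable[OF sN] by auto
  have gT: "g \<circ> T \<in> borel_measurable N" using measurable_comp[OF Tm g(1)] .
  \<comment> \<open>Pushing \<open>density N g = Leb\<close> forward by \<open>S\<close> replaces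
    \<open>g\<close> by \<open>g \<circ> T\<close>; as \<open>Leb\<close> is invariant under
    \<open>S\<close>, uniqueness of densities gives \<open>g \<circ> T = g\<close> almost
    everywhere.\<close>
  have "distr (density (distr N N T) g) N S = density N (g \<circ> T)"
    by (rule distr_density_distr[OF Tm Sm _ g(1)]) (use S_T spN in auto)
  then have "density N (g \<circ> T) = distr Leb N S" using invN g(2) by simp
  also have "\<dots> = distr Leb Leb S" by (rule distr_cong[OF refl _ refl]) (simp only: sN sets_Leb)
  also have "\<dots> = density N g" using invariant_S[OF sets_Leb invariant_Leb] g(2) by simp
  finally have gAE: "AE x in N. (g \<circ> T) x = g x" using N.density_unique[OF gT g(1)] by blast
  define A where "A = {x \<in> space N. 1 / 2 < g x}"
  have A: "A \<in> sets N" unfolding A_def using g(1) by measurable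
  have Ainv: "AE x in N. x \<in> A \<longleftrightarrow> T x \<in> A"
    using gAE AE_space by eventually_elim (use T_range spN in \<open>auto simp: A_def\<close>)
  \<comment> \<open>The lower bound that \<open>ergodic\<close> asks for comes from the summand
    \<open>Leb\<close> of \<open>N\<close>.\<close>
  have c: "1 / L * (q - p) \<le> measure N {p<..<q}" if pq: "0 \<le> p" "p < q" "q \<le> L" for p q
  proof -
    have B: "{p<..<q} \<in> sets BI" unfolding sets_BI using pq by auto
    have "ennreal (1 / L * (q - p)) = emeasure Leb {p<..<q}"
      using pq L_pos by (simp add: emeasure_Leb[OF B] divide_ennreal)
    also have "\<dots> \<le> emeasure N {p<..<q}" unfolding eN[OF B] by simp
    also have "\<dots> = ennreal (measure N {p<..<q})" by (rule N.emeasure_eq_measure)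
    finally show ?thesis by simp
  qed
  have "measure N A = 0 \<or> measure N (I - A) = 0"
    by (rule ergodic[OF ex w0 sN invN finN _ c e io A Ainv]) (use L_pos in auto)
  have half: "emeasure Leb Q = (\<integral>\<^sup>+x. g x * indicator Q x \<partial>N)" if "Q \<in> sets BI" for Q
    unfolding g(2)[symmetric] by (rule emeasure_density[OF g(1)]) (use that sN in simp)
  have h2: "(\<integral>\<^sup>+x. 1 / 2 * indicator Q x \<partial>N) = (emeasure M Q + emeasure Leb Q) / 2" if "Q \<in> sets BI" for Q
    using that sN nn_integral_cmult_indicator[of Q N "1 / 2"] eN[OF that] by (simp add: divide_ennreal_def mult.commute)
  have fin: "emeasure M Q = ennreal (measure M Q)" "emeasure Leb Q = ennreal (measure Leb Q)" for Q
    by (rule M.emeasure_eq_measure, rule Lb.emeasure_eq_measure)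
  have avg: "(emeasure M Q + emeasure Leb Q) / 2 = ennreal ((measure M Q + measure Leb Q) / 2)" for Q
  proof -
    have "ennreal ((measure M Q + measure Leb Q) / 2) = ennreal (measure M Q + measure Leb Q) / ennreal 2"
      by (rule divide_ennreal[symmetric]) auto
    then show ?thesis unfolding fin by (simp add: ennreal_plus)
  qed
  have cmpl: "measure M (I - Q) = 1 - measure M Q" "measure Leb (I - Q) = 1 - measure Leb Q" "I - Q \<in> sets BI" if "Q \<in> sets BI" for Q
  proof -
    show "measure M (I - Q) = 1 - measure M Q" using M.prob_compl[of Q] that M(1) space_BI[OF M(1)] by simp
    show "measure Leb (I - Q) = 1 - measure Leb Q" using Lb.prob_compl[of Q] that sets_Leb space_BI[OF sets_Leb] by simp
    show "I - Q \<in> sets BI" using that IB by blast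
  qed
  \<comment> \<open>If \<open>g \<le> 1 / 2\<close> almost everywhere, then
    \<open>Leb \<le> M\<close> on every set; both have mass 1, so passing to complements yields
    equality. The other case reverses the inequalities.\<close>
  have "measure M Q = measure Leb Q" if Q: "Q \<in> sets BI" for Q
    using \<open>measure N A = 0 \<or> measure N (I - A) = 0\<close>
  proof
    assume "measure N A = 0"
    then have "A \<in> null_sets N" using A N.emeasure_eq_measure by auto
    then have le: "AE x in N. g x \<le> 1 / 2"
      by (rule AE_I') (auto simp: A_def not_le)
    have "measure Leb Q \<le> (measure M Q + measure Leb Q) / 2" if Q: "Q \<in> sets BI" for Q
    proof -
      have "emeasure Leb Q \<le> (\<integral>\<^sup>+x. 1 / 2 * indicator Q x \<partial>N)"
        unfolding half[OF Q] by (rule nn_integral_mono_AE) (use le in eventually_elim, auto intro: mult_right_mono)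
      then have "ennreal (measure Leb Q) \<le> ennreal ((measure M Q + measure Leb Q) / 2)" unfolding h2[OF Q] avg by (simp only: fin(2))
      then show ?thesis by (subst (asm) ennreal_le_iff) auto
    qed
    from this[OF Q] this[OF cmpl(3)[OF Q]] cmpl(1,2)[OF Q] show ?thesis by simp
  next
    assume "measure N (I - A) = 0"
    moreover have "I - A \<in> sets N" using A spN sets.compl_sets by metis
    ultimately have "I - A \<in> null_sets N" using N.emeasure_eq_measure by auto
    then have le: "AE x in N. 1 / 2 \<le> g x"
      by (rule AE_I') (auto simp: A_def spN not_le intro: less_imp_le)
    have "(measure M Q + measure Leb Q) / 2 \<le> measure Leb Q" if Q: "Q \<in> sets BI" for Q
    proof -
      have "(\<integral>\<^sup>+x. 1 / 2 * indicator Q x \<partial>N) \<le> emeasure Leb Q"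
        unfolding half[OF Q] by (rule nn_integral_mono_AE) (use le in eventually_elim, auto intro: mult_right_mono)
      then have "ennreal ((measure M Q + measure Leb Q) / 2) \<le> ennreal (measure Leb Q)" unfolding h2[OF Q] avg by (simp only: fin(2))
      then show ?thesis by (subst (asm) ennreal_le_iff) auto
    qed
    from this[OF Q] this[OF cmpl(3)[OF Q]] cmpl(1,2)[OF Q] show ?thesis by simp
  qed
  then show ?thesis using M(1) sets_Leb fin by (intro measure_eqI) auto
qed

theorem uniquely_ergodic_iet:
  assumes "exch 0 L w0 T S D D'" "0 < w0" "0 < e" "\<And>N0. \<exists>H\<ge>N0. well_separated e H"
  shows "uniquely_ergodic_on (iet_domain d a) T"
  unfolding uniquely_ergodic_on_def domain_eq invariant_measure_def
  using unique_invariant[OF assms] sets_Leb prob_Leb invariant_Leb T_measurable by auto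

end

section \<open>Weighted lengths\<close>

definition clamp :: "real \<Rightarrow> real \<Rightarrow> real" where
  "clamp t w = max 0 (min t w)"

text \<open>The primitive of the step function with value \<open>\<rho> i\<close> on the \<open>i\<close>-th interval of lengths \<open>w\<close>. For
  \<open>w i = s ^ i\<close> its value at the \<open>i\<close>-th endpoint is \<open>s\<close> times the \<open>s\<close>-derivative of that endpoint when
  \<open>\<rho> i = i\<close>.\<close>
definition ramp :: "nat \<Rightarrow> (nat \<Rightarrow> real) \<Rightarrow> (nat \<Rightarrow> real) \<Rightarrow> real \<Rightarrow> real" where
  "ramp d \<rho> w y = (\<Sum>i=1..d. \<rho> i * clamp (y - iet_endpt w (i - 1)) (w i))"

lemma clamp_simps:
  "t \<le> 0 \<Longrightarrow> clamp t w = 0" "w \<le> t \<Longrightarrow> 0 \<le> w \<Longrightarrow> clamp t w = w" "0 \<le> t \<Longrightarrow> t \<le> w \<Longrightarrow> clamp t w = t"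
  "0 \<le> clamp t w" "0 \<le> w \<Longrightarrow> clamp t w \<le> w" "0 < clamp t w \<Longrightarrow> 0 < t"
  by (auto simp: clamp_def)

lemma clamp_lipschitz: "\<bar>clamp t w - clamp t' w\<bar> \<le> \<bar>t - t'\<bar>"
  by (auto simp: clamp_def)

lemma endpt_mono:
  assumes "\<And>i. i \<in> {1..d} \<Longrightarrow> 0 \<le> w i" "i \<le> j" "j \<le> d"
  shows "iet_endpt w i \<le> iet_endpt w j"
  unfolding iet_endpt_def using assms by (intro sum_mono2) auto

lemma ramp_eq:
  assumes w: "\<And>i. i \<in> {1..d} \<Longrightarrow> 0 \<le> w i" and j: "j \<in> {1..d}" "iet_endpt w (j - 1) \<le> y" "y \<le> iet_endpt w j"
  shows "ramp d \<rho> w y = (\<Sum>i=1..j - 1. \<rho> i * w i) + \<rho> j * (y - iet_endpt w (j - 1))"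
proof -
  have Sj: "iet_endpt w j = iet_endpt w (j - 1) + w j" using j(1) by (cases j) (auto simp: iet_endpt_def)
  have "ramp d \<rho> w y = (\<Sum>i\<in>{1..d}. if i < j then \<rho> i * w i else if i = j then \<rho> j * (y - iet_endpt w (j - 1)) else 0)"
    unfolding ramp_def
  proof (rule sum.cong[OF refl])
    fix i assume i: "i \<in> {1..d}"
    consider "i < j" | "i = j" | "j < i" by linarith
    then show "\<rho> i * clamp (y - iet_endpt w (i - 1)) (w i) = (if i < j then \<rho> i * w i else if i = j then \<rho> j * (y - iet_endpt w (j - 1)) else 0)"
    proof cases
      case 1
      have "iet_endpt w i \<le> iet_endpt w (j - 1)" using 1 j w by (intro endpt_mono[of d]) auto
      moreover have "iet_endpt w i = iet_endpt w (i - 1) + w i" using i by (cases i) (auto simp: iet_endpt_def)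
      ultimately have "w i \<le> y - iet_endpt w (i - 1)" using j by simp
      then show ?thesis using 1 clamp_simps(2) w[OF i] by simp
    next
      case 2
      then show ?thesis using clamp_simps(3)[of "y - iet_endpt w (j - 1)" "w j"] j Sj by simp
    next
      case 3
      have "iet_endpt w j \<le> iet_endpt w (i - 1)" using 3 i w by (intro endpt_mono[of d]) auto
      then show ?thesis using 3 j clamp_simps(1) by simp
    qed
  qed
  also have "\<dots> = (\<Sum>i\<in>{1..j - 1} \<union> {j}. if i < j then \<rho> i * w i else if i = j then \<rho> j * (y - iet_endpt w (j - 1)) else 0)"
    by (rule sum.mono_neutral_right) (use j in auto)
  also have "\<dots> = (\<Sum>i\<in>{1..j - 1}. if i < j then \<rho> i * w i else if i = j then \<rho> j * (y - iet_endpt w (j - 1)) else 0) + \<rho> j * (y - iet_endpt w (j - 1))"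
    using j by (subst sum.union_disjoint) auto
  also have "(\<Sum>i\<in>{1..j - 1}. if i < j then \<rho> i * w i else if i = j then \<rho> j * (y - iet_endpt w (j - 1)) else 0) = (\<Sum>i=1..j - 1. \<rho> i * w i)"
    by (rule sum.cong) auto
  finally show ?thesis .
qed

lemma ramp_lipschitz:
  assumes "\<And>i. i \<in> {1..d} \<Longrightarrow> 0 \<le> \<rho> i"
  shows "\<bar>ramp d \<rho> w y - ramp d \<rho> w z\<bar> \<le> (\<Sum>i=1..d. \<rho> i) * \<bar>y - z\<bar>"
proof -
  have "\<bar>ramp d \<rho> w y - ramp d \<rho> w z\<bar> = \<bar>\<Sum>i=1..d. \<rho> i * (clamp (y - iet_endpt w (i - 1)) (w i) - clamp (z - iet_endpt w (i - 1)) (w i))\<bar>"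
    unfolding ramp_def by (simp add: sum_subtractf right_diff_distrib)
  also have "\<dots> \<le> (\<Sum>i=1..d. \<bar>\<rho> i * (clamp (y - iet_endpt w (i - 1)) (w i) - clamp (z - iet_endpt w (i - 1)) (w i))\<bar>)"
    by (rule sum_abs)
  also have "\<dots> \<le> (\<Sum>i=1..d. \<rho> i * \<bar>y - z\<bar>)"
  proof (rule sum_mono)
    fix i assume "i \<in> {1..d}"
    then show "\<bar>\<rho> i * (clamp (y - iet_endpt w (i - 1)) (w i) - clamp (z - iet_endpt w (i - 1)) (w i))\<bar> \<le> \<rho> i * \<bar>y - z\<bar>"
      using assms clamp_lipschitz[of "y - iet_endpt w (i - 1)" "w i" "z - iet_endpt w (i - 1)"]
      by (auto simp: abs_mult intro!: mult_mono)
  qed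
  finally show ?thesis by (simp add: sum_distrib_right)
qed

lemma abel_sum: "(\<Sum>l=1..d. real l * c l) = real d * (\<Sum>l=1..d. c l) - (\<Sum>p=1..<d. \<Sum>l=1..p. c l)"
proof (induction d)
  case (Suc d)
  have "(\<Sum>p=1..<Suc d. \<Sum>l=1..p. c l) = (\<Sum>p=1..<d. \<Sum>l=1..p. c l) + (\<Sum>l=1..d. c l)"
    by (cases d) auto
  then show ?case using Suc by (simp add: algebra_simps)
qed simp

text \<open>The \<open>d - p\<close> images of the upper block all lie above
  \<open>\<sigma> l\<close>, which leaves \<open>\<sigma> l \<le> p\<close>.\<close>

lemma perm_initial:
  fixes p d :: nat
  assumes "\<sigma> permutes {1..d}" "p \<le> d" "\<And>l l'. l \<in> {1..p} \<Longrightarrow> l' \<in> {p + 1..d} \<Longrightarrow> \<sigma> l < \<sigma> l'"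
  shows "\<sigma> ` {1..p} \<subseteq> {1..p}"
proof
  fix y assume "y \<in> \<sigma> ` {1..p}"
  then obtain l where l: "l \<in> {1..p}" "y = \<sigma> l" by auto
  have in_d: "\<sigma> i \<in> {1..d}" if "i \<in> {1..d}" for i using permutes_in_image[OF assms(1)] that by blast
  have "\<sigma> ` {p + 1..d} \<subseteq> {\<sigma> l + 1..d}"
  proof
    fix z assume "z \<in> \<sigma> ` {p + 1..d}"
    then obtain l' where l': "l' \<in> {p + 1..d}" "z = \<sigma> l'" by auto
    then have "\<sigma> l' \<in> {1..d}" by (intro in_d) auto
    then show "z \<in> {\<sigma> l + 1..d}" using assms(3)[OF l(1) l'(1)] l'(2) by simp
  qed
  then have "card (\<sigma> ` {p + 1..d}) \<le> card {\<sigma> l + 1..d}" by (intro card_mono) auto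
  moreover have "card (\<sigma> ` {p + 1..d}) = card {p + 1..d}"
    by (intro card_image inj_on_subset[OF permutes_inj[OF assms(1)]]) simp
  ultimately have "d - p \<le> d - \<sigma> l" by simp
  moreover have "\<sigma> l \<in> {1..d}" using in_d l assms(2) by auto
  ultimately show "y \<in> {1..p}" using l assms(2) by auto
qed

section \<open>The ramp gap: sign, transport by the exchange, sums along orbits\<close>

context iet_data
begin

text \<open>It compares the index-weighted length of \<open>[0, y]\<close> after and before the
  exchange. Before it, the indices increase from left to right, so every \<open>[0, y]\<close>
  carries the least possible weight; the gap is a rearrangement inequality.\<close>

definition "ramp_gap y = ramp d (\<lambda>i. real (inv \<sigma> i)) (a \<circ> inv \<sigma>) y - ramp d real a y"

lemma ramp_top_reindex:
  "ramp d (\<rho> \<circ> inv \<sigma>) (a \<circ> inv \<sigma>) y = (\<Sum>l=1..d. \<rho> l * clamp (y - X' (\<sigma> l - 1)) (a l))"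
  unfolding ramp_def inverse_endpt
  using sum.permute[OF perm, of "\<lambda>i. (\<rho> \<circ> inv \<sigma>) i * clamp (y - X' (i - 1)) ((a \<circ> inv \<sigma>) i)"]
  by (simp add: comp_def)

lemma ramp_one:
  assumes "0 \<le> y" "y \<le> L"
  shows "ramp d (\<lambda>_. 1) a y = y"
proof -
  obtain j where j: "j \<in> {1..d}" "X (j - 1) \<le> y" "y \<le> X j"
  proof (cases "y = L")
    case True
    then show thesis using that[of d] d2 endpt_less[of "d - 1" d] by (auto simp: L_def)
  next
    case False
    then show thesis using index_ex[of y] that assms by (metis less_imp_le order_le_less)
  qed
  have "ramp d (\<lambda>_. 1) a y = (\<Sum>i=1..j - 1. 1 * a i) + 1 * (y - X (j - 1))"
    by (rule ramp_eq[OF _ j]) (use pos less_imp_le in blast)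
  then show ?thesis by (simp add: iet_endpt_def)
qed

text \<open>Summation by parts turns the gap into a sum of the differences \<open>\<Sum>l\<le>p. c l - c' l\<close>, which are nonnegative
  and, by irreducibility, not all zero.\<close>
lemma ramp_gap_pos:
  assumes "0 < y" "y < L"
  shows "0 < ramp_gap y"
proof -
  define c where "c l = clamp (y - X (l - 1)) (a l)" for l
  define c' where "c' l = clamp (y - X' (\<sigma> l - 1)) (a l)" for l
  have a0: "0 \<le> a l" if "l \<in> {1..d}" for l using pos[OF that] by simp
  have b: "0 \<le> c l" "0 \<le> c' l" for l by (auto simp: c_def c'_def clamp_simps)
  have bl: "c l \<le> a l" "c' l \<le> a l" if "l \<in> {1..d}" for l using a0[OF that] by (auto simp: c_def c'_def clamp_simps)
  have sc: "(\<Sum>l=1..d. c l) = y" using ramp_one[of y] assms by (simp add: ramp_def c_def)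
  have sc': "(\<Sum>l=1..d. c' l) = y"
  proof -
    have "ramp d ((\<lambda>_. 1) \<circ> inv \<sigma>) (a \<circ> inv \<sigma>) y = y"
      using iet_data.ramp_one[OF inverse_data, unfolded L_inverse, of y] assms by (simp add: comp_def)
    then show ?thesis unfolding ramp_top_reindex by (simp add: c'_def)
  qed
  have "ramp_gap y = (\<Sum>l=1..d. real l * (c' l - c l))"
    using ramp_top_reindex[of real y] unfolding ramp_gap_def
    by (simp add: ramp_def c_def c'_def comp_def sum_subtractf right_diff_distrib)
  also have "\<dots> = (\<Sum>p=1..<d. \<Sum>l=1..p. c l - c' l)"
    unfolding abel_sum using sc sc' by (simp add: sum_subtractf)
  finally have ramp_gap: "ramp_gap y = (\<Sum>p=1..<d. \<Sum>l=1..p. c l - c' l)" .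
  have split: "(\<Sum>l=1..p. f l) = (\<Sum>l=1..d. f l) - (\<Sum>l=p + 1..d. f l)" if "p \<le> d" for p and f :: "nat \<Rightarrow> real"
  proof -
    have "{1..d} = {1..p} \<union> {p + 1..d}" using that by auto
    then have "(\<Sum>l=1..d. f l) = (\<Sum>l=1..p. f l) + (\<Sum>l=p + 1..d. f l)" by (simp add: sum.union_disjoint)
    then show ?thesis by simp
  qed
  \<comment> \<open>For \<open>X p \<le> y\<close> the first \<open>p\<close> original intervals
    count in full, for \<open>y \<le> X p\<close> (in \<open>lo\<close>) the later ones count not at
    all; each form shows the partial sum to be nonnegative.\<close>
  have hi: "(\<Sum>l=1..p. c l - c' l) = (\<Sum>l=1..p. a l - c' l)" if p: "p < d" "X p \<le> y" for p
  proof (rule sum.cong[OF refl])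
    fix l assume l: "l \<in> {1..p}"
    then have ld: "l \<in> {1..d}" using p by auto
    have "X l \<le> X p" using endpt_le[of l p] l p by auto
    then have "c l = a l" using endpt_pred(1)[OF ld] a0[OF ld] p by (simp add: c_def clamp_simps)
    then show "c l - c' l = a l - c' l" by simp
  qed
  have lo: "(\<Sum>l=1..p. c l - c' l) = (\<Sum>l=p + 1..d. c' l)" if p: "p < d" "y \<le> X p" for p
  proof -
    have "(\<Sum>l=1..p. c l - c' l) = (\<Sum>l=1..d. c l - c' l) - (\<Sum>l=p + 1..d. c l - c' l)" using split[of p] p by simp
    also have "(\<Sum>l=1..d. c l - c' l) = 0" using sc sc' by (simp add: sum_subtractf)
    also have "(\<Sum>l=p + 1..d. c l - c' l) = (\<Sum>l=p + 1..d. - c' l)"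
    proof (rule sum.cong[OF refl])
      fix l assume l: "l \<in> {p + 1..d}"
      have "X p \<le> X (l - 1)" using endpt_le[of p "l - 1"] l p by auto
      then show "c l - c' l = - c' l" using p by (simp add: c_def clamp_simps)
    qed
    finally show ?thesis by (simp add: sum_negf)
  qed
  have nonneg: "0 \<le> (\<Sum>l=1..p. c l - c' l)" if p: "p < d" for p
  proof (cases "X p \<le> y")
    case True
    show ?thesis unfolding hi[OF p True] by (rule sum_nonneg) (use bl(2) p in auto)
  next
    case False
    then show ?thesis using lo[OF p] b(2) by (simp add: sum_nonneg)
  qed
  \<comment> \<open>If all partial sums vanish and \<open>y\<close> lies in the \<open>j\<close>-th
    interval, the images of earlier intervals lie fully in \<open>[0, y]\<close> and those of later
    ones have no length there. So \<open>\<sigma>\<close> places \<open>{1..j - 1}\<close> before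
    the rest, or, for \<open>j = 1\<close>, places 1 before the rest: an invariant initial
    block.\<close>
  have "ramp_gap y \<noteq> 0"
  proof
    assume "ramp_gap y = 0"
    then have "(\<Sum>p=1..<d. \<Sum>l=1..p. c l - c' l) = 0" using ramp_gap by simp
    then have "\<forall>p\<in>{1..<d}. (\<Sum>l=1..p. c l - c' l) = 0"
      by (rule iffD1[OF sum_nonneg_eq_0_iff, rotated 2]) (simp, rule nonneg, simp)
    then have z: "(\<Sum>l=1..p. c l - c' l) = 0" if "p \<in> {1..<d}" for p using that by blast
    obtain j where j: "j \<in> {1..d}" "X (j - 1) \<le> y" "y < X j" using index_ex[of y] assms by auto
    have full: "c' l = a l" if l: "l \<in> {1..j - 1}" for l
    proof -
      have p: "j - 1 \<in> {1..<d}" using l j by auto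
      then have "(\<Sum>l=1..j - 1. a l - c' l) = 0" using hi[of "j - 1"] z[of "j - 1"] j by auto
      moreover have "0 \<le> a i - c' i" if "i \<in> {1..j - 1}" for i using bl(2)[of i] that j by auto
      ultimately show ?thesis using l sum_nonneg_eq_0_iff[of "{1..j - 1}" "\<lambda>l. a l - c' l"] by auto
    qed
    have zero: "c' l = 0" if l: "l \<in> {j + 1..d}" for l
    proof -
      have p: "j \<in> {1..<d}" using l j by auto
      then have "(\<Sum>l=j + 1..d. c' l) = 0" using lo[of j] z[of j] j by auto
      then show ?thesis using l sum_nonneg_eq_0_iff[of "{j + 1..d}" c'] b(2) by auto
    qed
    have cj: "c' j < a j"
    proof -
      have e: "{1..d} = insert j ({1..j - 1} \<union> {j + 1..d})" using j(1) by auto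
      have "(\<Sum>l=1..d. c' l) = c' j + (\<Sum>l\<in>{1..j - 1} \<union> {j + 1..d}. c' l)"
        unfolding e using j(1) by (intro sum.insert) auto
      also have "(\<Sum>l\<in>{1..j - 1} \<union> {j + 1..d}. c' l) = (\<Sum>l=1..j - 1. c' l) + (\<Sum>l=j + 1..d. c' l)"
        by (rule sum.union_disjoint) auto
      also have "(\<Sum>l=1..j - 1. c' l) = X (j - 1)" unfolding iet_endpt_def by (rule sum.cong) (use full in auto)
      also have "(\<Sum>l=j + 1..d. c' l) = 0" by (rule sum.neutral) (use zero in auto)
      finally show ?thesis using sc' j endpt_pred(1)[OF j(1)] by simp
    qed
    have order: "c' l' = a l'" if l: "l \<in> {1..d}" "l' \<in> {1..d}" "\<sigma> l' < \<sigma> l" "0 < c' l" for l l'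
    proof -
      have s: "\<sigma> l \<in> {1..d}" "\<sigma> l' \<in> {1..d}" using l sigma_in by blast+
      have "X' (\<sigma> l') \<le> X' (\<sigma> l - 1)" using endpt'_le[of "\<sigma> l'" "\<sigma> l - 1"] l s by auto
      moreover have "0 < y - X' (\<sigma> l - 1)" using clamp_simps(6)[OF l(4)[unfolded c'_def]] .
      ultimately have "a l' \<le> y - X' (\<sigma> l' - 1)" using endpt_pred(2)[OF s(2)] by simp
      then show ?thesis using a0[OF l(2)] by (simp add: c'_def clamp_simps)
    qed
    have sub: False if p: "p \<in> {1..d}" "p < d" "\<And>l l'. l \<in> {1..p} \<Longrightarrow> l' \<in> {p + 1..d} \<Longrightarrow> \<sigma> l < \<sigma> l'" for p
    proof -
      have "\<sigma> ` {1..p} \<subseteq> {1..p}" using perm_initial[OF perm] p by auto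
      then have "p = d" using irr p(1) unfolding irreducible_perm_def by blast
      then show False using p(2) by simp
    qed
    have neq: "\<sigma> l \<noteq> \<sigma> l'" if "l \<noteq> l'" for l l' using inj_eq[OF permutes_inj[OF perm], of l l'] that by blast
    have lt: "\<sigma> l < \<sigma> l'" if l: "l \<in> {1..j - 1}" "l' \<in> {j..d}" for l l'
    proof (rule ccontr)
      assume "\<not> \<sigma> l < \<sigma> l'"
      moreover have "l \<noteq> l'" using l by auto
      ultimately have "\<sigma> l' < \<sigma> l" using neq[of l l'] by linarith
      moreover have "0 < c' l" using full[OF l(1)] pos[of l] l j by auto
      ultimately have "c' l' = a l'" using order[of l l'] l j by auto
      then show False using cj zero[of l'] pos[of l'] l j by (cases "l' = j") auto
    qed
    show False
    proof (cases "j = 1")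
      case False
      have "j - 1 \<in> {1..d}" "j - 1 < d" using False j by auto
      then show False using sub[of "j - 1"] lt j by auto
    next
      case True
      have "0 < c' j"
      proof -
        have "(\<Sum>l=1..d. c' l) = c' j"
        proof -
          have "{1..d} = insert j {j + 1..d}" using j(1) True by auto
          then show ?thesis using zero by simp
        qed
        then show ?thesis using sc' assms by simp
      qed
      have "\<sigma> l < \<sigma> l'" if l: "l \<in> {1..1}" "l' \<in> {1 + 1..d}" for l l'
      proof (rule ccontr)
        assume "\<not> \<sigma> l < \<sigma> l'"
        moreover have "l \<noteq> l'" "l = j" using l True by auto
        ultimately have "\<sigma> l' < \<sigma> j" using neq[of l l'] by simp
        then have "c' l' = a l'" using order[of j l'] \<open>0 < c' j\<close> j l by auto
        then show False using zero[of l'] pos[of l'] l True by auto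
      qed
      then show False using sub[of 1] d2 by auto
    qed
  qed
  moreover have "0 \<le> ramp_gap y" unfolding ramp_gap by (rule sum_nonneg) (use nonneg in auto)
  ultimately show ?thesis by simp
qed

lemma ramp_gap_nonneg: "0 \<le> y \<Longrightarrow> y < L \<Longrightarrow> 0 \<le> ramp_gap y"
proof (cases "y = 0")
  case True
  have "ramp d \<rho> w 0 = 0" if "\<And>i. i \<in> {1..d} \<Longrightarrow> 0 \<le> w i" for \<rho> w
  proof -
    have 1: "1 \<in> {1..d}" using d2 by simp
    have "iet_endpt w 1 = w 1" "iet_endpt w 0 = 0" by (auto simp: iet_endpt_def)
    then have "ramp d \<rho> w 0 = (\<Sum>i=1..1 - 1. \<rho> i * w i) + \<rho> 1 * (0 - iet_endpt w (1 - 1))"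
      by (intro ramp_eq[OF that 1]) (use that[OF 1] in auto)
    then show ?thesis using \<open>iet_endpt w 0 = 0\<close> by simp
  qed
  then show ?thesis unfolding ramp_gap_def True using pos inv_in by (simp add: less_imp_le)
next
  case False
  then show "0 \<le> y \<Longrightarrow> y < L \<Longrightarrow> 0 \<le> ramp_gap y" using ramp_gap_pos[of y] by simp
qed

text \<open>The \<open>j\<close>-th interval and its image carry the same weight \<open>j\<close>,
  so the two ramps grow at the same rate there and their difference is constant. For lengths
  \<open>s ^ i\<close> the constant is \<open>s\<close> times the \<open>s\<close>-derivative of the
  translation.\<close>

lemma ramp_T:
  assumes "j \<in> {1..d}" "X (j - 1) \<le> y" "y < X j"
  shows "ramp d (\<lambda>i. real (inv \<sigma> i)) (a \<circ> inv \<sigma>) (T y) - ramp d real a y =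
    (\<Sum>i=1..\<sigma> j - 1. real (inv \<sigma> i) * a (inv \<sigma> i)) - (\<Sum>i=1..j - 1. real i * a i)"
proof -
  have s: "\<sigma> j \<in> {1..d}" using assms sigma_in by blast
  have "ramp d real a y = (\<Sum>i=1..j - 1. real i * a i) + real j * (y - X (j - 1))"
    by (rule ramp_eq) (use assms pos less_imp_le in auto)
  moreover have "ramp d (\<lambda>i. real (inv \<sigma> i)) (a \<circ> inv \<sigma>) (T y) =
      (\<Sum>i=1..\<sigma> j - 1. real (inv \<sigma> i) * (a \<circ> inv \<sigma>) i) + real (inv \<sigma> (\<sigma> j)) * (T y - iet_endpt (a \<circ> inv \<sigma>) (\<sigma> j - 1))"
    by (rule ramp_eq[OF _ s]) (use pos inv_in T_in[OF assms] in \<open>auto simp: inverse_endpt intro: less_imp_le\<close>)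
  ultimately show ?thesis using T_eq[OF assms] by (simp add: inverse_endpt)
qed

text \<open>Near an end of \<open>I\<close> there is no positive lower bound for the gap. But a
  point within \<open>w0 / 2\<close> of an end lies in an extreme interval, which the exchange moves
  at least \<open>w0\<close> inwards since \<open>\<sigma>\<close> fixes neither 1 nor
  \<open>d\<close>.\<close>

lemma T_escape:
  assumes w0: "\<And>i. i \<in> {1..d} \<Longrightarrow> w0 \<le> a i" "0 < w0" and y: "0 \<le> y" "y < L"
  shows "(w0 / 2 \<le> y \<and> y \<le> L - w0 / 2) \<or> (w0 / 2 \<le> T y \<and> T y \<le> L - w0 / 2)"
proof -
  have 1: "1 \<in> {1..d}" and dd: "d \<in> {1..d}" using d2 by auto
  have X1: "X 1 = a 1" using endpt_Suc(1)[of 0] by simp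
  have Xd: "L = X (d - 1) + a d" using endpt_pred(1)[OF dd] by (simp add: L_def)
  have Lw: "w0 \<le> L" using X1 w0(1)[OF 1] endpt_bounds(3)[of 1] d2 by auto
  consider "y < w0 / 2" | "L - w0 / 2 < y" | "w0 / 2 \<le> y \<and> y \<le> L - w0 / 2" by linarith
  then show ?thesis
  proof cases
    case 1
    have s: "\<sigma> 1 \<in> {1..d}" using \<open>1 \<in> {1..d}\<close> sigma_in by blast
    then have s1: "\<sigma> 1 - 1 \<in> {1..d}" "\<sigma> 1 \<le> d" using sigma_1 by auto
    have "T y = y + X' (\<sigma> 1 - 1)" using T_eq[OF \<open>1 \<in> {1..d}\<close>, of y] 1 X1 y w0(1)[OF \<open>1 \<in> {1..d}\<close>] w0(2) by simp
    moreover have "w0 \<le> X' (\<sigma> 1 - 1)"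

    proof -
      have "\<sigma> 1 - 1 - 1 \<le> d" "inv \<sigma> (\<sigma> 1 - 1) \<in> {1..d}" using s1 inv_in by auto
      then show ?thesis using endpt_pred(2)[OF s1(1)] endpt_bounds(2)[of "\<sigma> 1 - 1 - 1"] w0(1)[of "inv \<sigma> (\<sigma> 1 - 1)"] by linarith
    qed
    moreover have "X' (\<sigma> 1 - 1) \<le> L - w0" using endpt_pred(2)[OF s] endpt_bounds(4)[OF s1(2)] w0(1)[OF \<open>1 \<in> {1..d}\<close>] by simp
    ultimately show ?thesis using 1 y w0(2) by auto
  next
    case 2
    have s: "\<sigma> d \<in> {1..d}" using dd sigma_in by blast
    then have s1: "\<sigma> d + 1 \<in> {1..d}" "\<sigma> d - 1 \<le> d" using sigma_d by auto
    have "T y = y - X (d - 1) + X' (\<sigma> d - 1)" using T_eq[OF dd, of y] 2 Xd y w0(1)[OF dd] w0(2) by (simp add: L_def)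
    then have "T y = X' (\<sigma> d) - (L - y)" using endpt_pred(2)[OF s] Xd by simp
    moreover have "X' (\<sigma> d) \<le> L - w0"

    proof -
      have "\<sigma> d + 1 \<le> d" "inv \<sigma> (\<sigma> d + 1) \<in> {1..d}" using s1 inv_in by auto
      then show ?thesis using endpt_pred(2)[OF s1(1)] endpt_bounds(4)[of "\<sigma> d + 1"] w0(1)[of "inv \<sigma> (\<sigma> d + 1)"] by simp
    qed
    moreover have "w0 \<le> X' (\<sigma> d)" using endpt_pred(2)[OF s] endpt_bounds(2)[OF s1(2)] w0(1)[OF dd] by simp
    ultimately show ?thesis using 2 y w0(2) by auto
  qed auto
qed

text \<open>If \<open>T z\<close> is close to an end of \<open>I\<close>, then \<open>z\<close> is
  close to a singularity: the interval that \<open>\<sigma>\<close> places first (last) is not the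
  first (last) one, so its left (right) end lies in \<open>D\<close>. Distance from \<open>D\<close>
  at earlier times thus yields a margin at 0 and \<open>L\<close> too.\<close>

lemma orbit_margin:
  assumes w0: "\<And>i. i \<in> {1..d} \<Longrightarrow> w0 \<le> a i" and W: "0 < W" "W \<le> w0"
    and far: "\<And>t. t < k \<Longrightarrow> \<not> near D W ((T ^^ t) (X' j))" and j: "j \<in> {1..d - 1}" and t: "t < k"
  obtains c where "c \<in> {1..d}" "X (c - 1) + W \<le> (T ^^ t) (X' j)" "(T ^^ t) (X' j) \<le> X c - W"
proof -
  have jd: "j \<in> {1..d}" "j + 1 \<in> {1..d}" using j by auto
  have X'j: "w0 \<le> X' j" "X' j \<le> L - w0"
  proof -
    have i: "inv \<sigma> j \<in> {1..d}" "inv \<sigma> (j + 1) \<in> {1..d}" using jd inv_in by blast+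
    have "j - 1 \<le> d" using jd by auto
    then show "w0 \<le> X' j" using endpt_pred(2)[OF jd(1)] endpt_bounds(2)[of "j - 1"] w0[OF i(1)] by linarith
    show "X' j \<le> L - w0" using endpt_pred(2)[OF jd(2)] endpt_bounds(4)[of "j + 1"] w0[OF i(2)] jd by auto
  qed
  have range: "(T ^^ t) (X' j) \<in> I" for t
  proof (induction t)
    case 0
    then show ?case using X'j W by auto
  next
    case (Suc t)
    then show ?case using T_range[OF Suc] by simp
  qed
  have edge: "W \<le> (T ^^ t) (X' j) \<and> (T ^^ t) (X' j) \<le> L - W"
  proof (cases t)
    case 0
    then show ?thesis using X'j W by auto
  next
    case (Suc u)
    define z where "z = (T ^^ u) (X' j)"
    have nz: "\<not> near D W z" using far[of u] t Suc by (simp add: z_def)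
    obtain l where l: "l \<in> {1..d}" "X (l - 1) \<le> z" "z < X l" using index_ex[of z] range[of u] by (auto simp: z_def)
    have s: "\<sigma> l \<in> {1..d}" using l sigma_in by blast
    have Tz: "(T ^^ t) (X' j) = T z" using Suc by (simp add: z_def)
    note Tl = T_eq[OF l] T_in[OF l]
    have "W \<le> T z"
    proof (rule ccontr)
      assume n: "\<not> W \<le> T z"
      have "\<sigma> l = 1"
      proof (rule ccontr)
        assume "\<sigma> l \<noteq> 1"
        then have s1: "\<sigma> l - 1 \<in> {1..d}" using s by auto
        have "inv \<sigma> (\<sigma> l - 1) \<in> {1..d}" using iffD2[OF inv_in s1] .
        moreover have "\<sigma> l - 1 - 1 \<le> d" using s by auto
        ultimately have "w0 \<le> X' (\<sigma> l - 1)" using endpt_pred(2)[OF s1] endpt_bounds(2)[of "\<sigma> l - 1 - 1"] w0[of "inv \<sigma> (\<sigma> l - 1)"] by linarith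
        then show False using Tl n W by simp
      qed
      have "l \<noteq> 1" using sigma_1 \<open>\<sigma> l = 1\<close> by metis
      moreover have "T z = z - X (l - 1)" using Tl(1) \<open>\<sigma> l = 1\<close> by simp
      moreover have "l - 1 \<in> {1..d - 1}" using l \<open>l \<noteq> 1\<close> by auto
      ultimately have "near D W z" using n l unfolding near_def by (intro bexI[of _ "X (l - 1)"]) auto
      then show False using nz by simp
    qed
    moreover have "T z \<le> L - W"
    proof (rule ccontr)
      assume n: "\<not> T z \<le> L - W"
      have "\<sigma> l = d"
      proof (rule ccontr)
        assume "\<sigma> l \<noteq> d"
        then have s1: "\<sigma> l + 1 \<in> {1..d}" using s by auto
        have "inv \<sigma> (\<sigma> l + 1) \<in> {1..d}" using iffD2[OF inv_in s1] .
        moreover have "\<sigma> l + 1 \<le> d" using s1 by simp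
        ultimately have "X' (\<sigma> l) \<le> L - w0" using endpt_pred(2)[OF s1] endpt_bounds(4)[of "\<sigma> l + 1"] w0[of "inv \<sigma> (\<sigma> l + 1)"] by simp
        then show False using Tl n W by simp
      qed
      then have "l \<noteq> d" using sigma_d by metis
      have "X l - z = L - T z" using Tl endpt_pred(1)[OF l(1)] endpt_pred(2)[OF s] X'_d \<open>\<sigma> l = d\<close> by auto
      moreover have "l \<in> {1..d - 1}" using l \<open>l \<noteq> d\<close> by auto
      ultimately have "near D W z" using n l unfolding near_def by (intro bexI[of _ "X l"]) auto
      then show False using nz by simp
    qed
    ultimately show ?thesis unfolding Tz by simp
  qed
  obtain c where c: "c \<in> {1..d}" "X (c - 1) \<le> (T ^^ t) (X' j)" "(T ^^ t) (X' j) < X c" using index_ex[of "(T ^^ t) (X' j)"] range[of t] by auto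
  show thesis
  proof (rule that[OF c(1)])
    show "X (c - 1) + W \<le> (T ^^ t) (X' j)"
    proof (cases "c = 1")
      case True
      then show ?thesis using edge by simp
    next
      case False
      then have "c - 1 \<in> {1..d - 1}" using c by auto
      then show ?thesis using far[OF t] c unfolding near_def by force
    qed
    show "(T ^^ t) (X' j) \<le> X c - W"
    proof (cases "c = d")
      case True
      then show ?thesis using edge by (simp add: L_def)
    next
      case False
      then have "c \<in> {1..d - 1}" using c by auto
      then show ?thesis using far[OF t] c unfolding near_def by force
    qed
  qed
qed

text \<open>Times are paired: by \<open>T_escape\<close> one of two consecutive points contributes
  at least \<open>c0\<close>, and the other a nonnegative amount.\<close>

lemma ramp_gap_orbit_sum:
  assumes w0: "\<And>i. i \<in> {1..d} \<Longrightarrow> w0 \<le> a i" "0 < w0"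
    and c0: "\<And>y. w0 / 2 \<le> y \<Longrightarrow> y \<le> L - w0 / 2 \<Longrightarrow> c0 \<le> ramp_gap y" "0 \<le> c0"
    and z: "\<And>t. t < k \<Longrightarrow> z t \<in> I" "\<And>t. Suc t < k \<Longrightarrow> z (Suc t) = T (z t)"
  shows "c0 * real (k div 2) \<le> (\<Sum>t<k. ramp_gap (z t))"
  using z
proof (induction k rule: less_induct)
  case (less k)
  have nn: "0 \<le> ramp_gap (z t)" if "t < k" for t using less.prems(1)[OF that] ramp_gap_nonneg by auto
  show ?case
  proof (cases "k < 2")
    case True
    then show ?thesis using nn by (auto intro!: sum_nonneg simp: div_less)
  next
    case False
    then obtain n where n: "k = Suc (Suc n)" by (metis Suc_diff_Suc less_2_cases_iff not_less_eq numeral_2_eq_2 old.nat.exhaust)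
    have ih: "c0 * real (n div 2) \<le> (\<Sum>t<n. ramp_gap (z t))" using less n by auto
    have "z n \<in> I" "z (Suc n) = T (z n)" using less.prems n by auto
    then have "c0 \<le> ramp_gap (z n) \<or> c0 \<le> ramp_gap (z (Suc n))" using T_escape[OF w0, of "z n"] c0(1) by auto
    then have "c0 \<le> ramp_gap (z n) + ramp_gap (z (Suc n))" using nn[of n] nn[of "Suc n"] n by auto
    then show ?thesis using ih n by (simp add: algebra_simps)
  qed
qed

end

text \<open>Greedy from left to right: the points below \<open>s + r\<close>, for a point \<open>s\<close> near the infimum, lie in an
  interval of radius \<open>\<kappa> r\<close>, and the others are at least \<open>r\<close> further right.\<close>
lemma interval_cover:
  fixes S :: "real set"
  assumes r0: "0 < r0" and lam: "0 \<le> \<kappa>" and loc: "\<And>s. s \<in> S \<Longrightarrow> \<exists>r. r0 \<le> r \<and> r \<le> R \<and> S \<inter> {s - r..s + r} \<subseteq> {s - \<kappa> * r..s + \<kappa> * r}"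
    and S: "S \<subseteq> {\<alpha>..\<beta>}" and n: "\<beta> - \<alpha> \<le> real n * r0"
  shows "\<exists>U\<in>sets borel. S \<subseteq> U \<and> emeasure lborel U \<le> ennreal (2 * \<kappa> * (\<bar>\<beta> - \<alpha>\<bar> + R))"
  using loc S n
proof (induction n arbitrary: S \<alpha>)
  case 0
  show ?case
  proof (cases "S = {}")
    case True
    then show ?thesis by (intro bexI[of _ "{}"]) auto
  next
    case False
    then obtain s where s: "s \<in> S" by auto
    obtain r where r: "r0 \<le> r" "r \<le> R" using 0(1)[OF s] by blast
    have "x = s" if "x \<in> S" for x
    proof -
      have "\<alpha> \<le> x" "x \<le> \<beta>" "\<alpha> \<le> s" "s \<le> \<beta>" using 0(2) s that by auto
      then show ?thesis using 0(3) by simp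
    qed
    then have "S \<subseteq> {s}" by blast
    then show ?thesis by (intro bexI[of _ "{s}"]) auto
  qed
next
  case (Suc n)
  show ?case
  proof (cases "S = {}")
    case True
    then show ?thesis by (intro bexI[of _ "{}"]) auto
  next
    case False
    have bdd: "bdd_below S" using Suc.prems(2) by (meson bdd_below_Icc bdd_below_mono)
    obtain s where s: "s \<in> S" "s < Inf S + r0" using cInf_lessD[OF False, of "Inf S + r0"] r0 by auto
    obtain r where r: "r0 \<le> r" "r \<le> R" "S \<inter> {s - r..s + r} \<subseteq> {s - \<kappa> * r..s + \<kappa> * r}" using Suc.prems(1)[OF s(1)] by blast
    have sab: "\<alpha> \<le> s" "s \<le> \<beta>" using s Suc.prems(2) by auto
    define S' where "S' = S \<inter> {s + r..}"
    define V where "V = {s - \<kappa> * r..s + \<kappa> * r}"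
    have emV: "emeasure lborel V = ennreal (2 * \<kappa> * r)" using r r0 lam by (simp add: V_def)
    have split: "S \<subseteq> V \<union> S'"
    proof
      fix x assume x: "x \<in> S"
      have "Inf S \<le> x" using x bdd by (rule cInf_lower)
      then have "s - r \<le> x" using s r by simp
      then show "x \<in> V \<union> S'" using x r(3) by (cases "x \<le> s + r") (auto simp: V_def S'_def)
    qed
    show ?thesis
    proof (cases "S' = {}")
      \<comment> \<open>The last interval is paid for by \<open>R\<close>, every earlier one by the
        length \<open>r\<close> by which the left end advances.\<close>
      case True
      have "2 * \<kappa> * r \<le> 2 * \<kappa> * (\<bar>\<beta> - \<alpha>\<bar> + R)" using r lam by (intro mult_left_mono) auto
      then show ?thesis using split True emV by (intro bexI[of _ V]) (auto simp: V_def intro: ennreal_leI)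
    next
      case False
      then obtain y where "y \<in> S" "s + r \<le> y" by (auto simp: S'_def)
      then have le: "s + r \<le> \<beta>" using Suc.prems(2) by auto
      have "\<exists>U\<in>sets borel. S' \<subseteq> U \<and> emeasure lborel U \<le> ennreal (2 * \<kappa> * (\<bar>\<beta> - (s + r)\<bar> + R))"
      proof (rule Suc.IH)
        show "\<exists>r. r0 \<le> r \<and> r \<le> R \<and> S' \<inter> {x - r..x + r} \<subseteq> {x - \<kappa> * r..x + \<kappa> * r}" if "x \<in> S'" for x
          using Suc.prems(1)[of x] that unfolding S'_def by blast
        show "S' \<subseteq> {s + r..\<beta>}" using Suc.prems(2) by (auto simp: S'_def)
        show "\<beta> - (s + r) \<le> real n * r0" using Suc.prems(3) sab r by (simp add: algebra_simps)
      qed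
      then obtain U where U: "U \<in> sets borel" "S' \<subseteq> U" "emeasure lborel U \<le> ennreal (2 * \<kappa> * (\<bar>\<beta> - (s + r)\<bar> + R))" by blast
      have R0: "0 \<le> R" using r r0 by simp
      have "emeasure lborel (V \<union> U) \<le> emeasure lborel V + emeasure lborel U"
        by (rule emeasure_subadditive) (use U in \<open>auto simp: V_def\<close>)
      also have "\<dots> \<le> ennreal (2 * \<kappa> * r) + ennreal (2 * \<kappa> * (\<bar>\<beta> - (s + r)\<bar> + R))" using emV U by (simp add: add_left_mono)
      also have "\<dots> = ennreal (2 * \<kappa> * r + 2 * \<kappa> * (\<bar>\<beta> - (s + r)\<bar> + R))"
        using r r0 lam R0 by (intro ennreal_plus[symmetric]) auto
      also have "\<dots> \<le> ennreal (2 * \<kappa> * (\<bar>\<beta> - \<alpha>\<bar> + R))"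
      proof (rule ennreal_leI)
        have "2 * \<kappa> * r + 2 * \<kappa> * (\<bar>\<beta> - (s + r)\<bar> + R) = 2 * \<kappa> * (\<beta> - s + R)" using le by (simp add: algebra_simps)
        also have "\<dots> \<le> 2 * \<kappa> * (\<bar>\<beta> - \<alpha>\<bar> + R)" using sab lam by (intro mult_left_mono) auto
        finally show "2 * \<kappa> * r + 2 * \<kappa> * (\<bar>\<beta> - (s + r)\<bar> + R) \<le> 2 * \<kappa> * (\<bar>\<beta> - \<alpha>\<bar> + R)" .
      qed
      finally show ?thesis using split U by (intro bexI[of _ "V \<union> U"]) (auto simp: V_def)
    qed
  qed
qed

section \<open>The one-parameter family\<close>

locale iet_family =
  fixes d :: nat and \<sigma> :: "nat \<Rightarrow> nat" and \<alpha> \<beta> :: real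
  assumes d2: "d \<ge> 2" and irr: "irreducible_perm d \<sigma>" and ab: "0 < \<alpha>" "\<alpha> \<le> \<beta>"
begin

abbreviation "K \<equiv> {\<alpha>..\<beta>}"
abbreviation "xx s \<equiv> iet_endpt (\<lambda>i. s ^ i)"
abbreviation "xx' s \<equiv> iet_endpt' \<sigma> (\<lambda>i. s ^ i)"
abbreviation "TT s \<equiv> iet d \<sigma> (\<lambda>i. s ^ i)"
abbreviation "DD s \<equiv> xx s ` {1..d - 1}"
abbreviation "DD' s \<equiv> xx' s ` {1..d - 1}"
abbreviation "LL s \<equiv> xx s d"

definition "dx s i = (\<Sum>j=1..i. real j * s ^ (j - 1))" for s :: real
definition "dx' s i = (\<Sum>j=1..i. real (inv \<sigma> j) * s ^ (inv \<sigma> j - 1))" for s :: real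
text \<open>The orbit of \<open>xx' s j\<close> along the itinerary \<open>c\<close>, as a polynomial in \<open>s\<close>, and its derivative:\<close>
definition "yy c j t s = xx' s j + (\<Sum>u<t. xx' s (\<sigma> (c u) - 1) - xx s (c u - 1))" for s :: real and t :: nat
definition "dyy c j t s = dx' s j + (\<Sum>u<t. dx' s (\<sigma> (c u) - 1) - dx s (c u - 1))" for s :: real and t :: nat
text \<open>The ramp gap for the lengths \<open>s ^ i\<close>, written out so that its joint
  continuity in \<open>s\<close> and \<open>y\<close> is visible; \<open>FF_lower\<close> rests on
  that.\<close>

definition "FF s y = ramp d (\<lambda>i. real (inv \<sigma> i)) ((\<lambda>i. s ^ i) \<circ> inv \<sigma>) y - ramp d real (\<lambda>i. s ^ i) y" for s :: real

lemma perm: "\<sigma> permutes {1..d}"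
  using irr by (simp add: irreducible_perm_def)

lemma data: "0 < s \<Longrightarrow> iet_data d \<sigma> (\<lambda>i. s ^ i)"
  by unfold_locales (use d2 irr in auto)

lemma K_pos: "s \<in> K \<Longrightarrow> 0 < s"
  using ab by auto

lemma L_eq: "0 < s \<Longrightarrow> iet_data.L d (\<lambda>i. s ^ i) = LL s"
  by (simp add: iet_data.L_def[OF data])

lemma ramp_gap_eq: "0 < s \<Longrightarrow> iet_data.ramp_gap d \<sigma> (\<lambda>i. s ^ i) y = FF s y"
  by (simp add: iet_data.ramp_gap_def[OF data] FF_def)

lemma xx_deriv: "((\<lambda>s. xx s i) has_real_derivative dx s i) (at s)"
  unfolding iet_endpt_def dx_def by (auto intro!: derivative_eq_intros)

lemma xx'_deriv: "((\<lambda>s. xx' s i) has_real_derivative dx' s i) (at s)"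
  unfolding iet_endpt'_def dx'_def by (auto intro!: derivative_eq_intros)

lemma yy_deriv: "(yy c j t has_real_derivative dyy c j t s) (at s)"
  unfolding yy_def[abs_def] dyy_def
  by (intro derivative_intros xx_deriv xx'_deriv)

section \<open>Dependence of orbits on the parameter\<close>

definition "Cd = real d * (real d * max 1 \<beta> ^ d) + 1"

lemma Cd1: "1 \<le> Cd"
  using ab by (simp add: Cd_def)

lemma deriv_bounds:
  assumes "s \<in> K" "i \<le> d"
  shows "0 \<le> dx s i" "dx s i \<le> Cd" "0 \<le> dx' s i" "dx' s i \<le> Cd"
proof -
  have s: "0 \<le> s" "s \<le> max 1 \<beta>" using assms ab by auto
  have pw: "s ^ n \<le> max 1 \<beta> ^ d" if "n \<le> d" for n
  proof -
    have "s ^ n \<le> max 1 \<beta> ^ n" using s by (intro power_mono) auto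
    also have "\<dots> \<le> max 1 \<beta> ^ d" using that by (intro power_increasing) auto
    finally show ?thesis .
  qed
  have tm: "0 \<le> real j * s ^ (j - 1) \<and> real j * s ^ (j - 1) \<le> real d * max 1 \<beta> ^ d" if "j \<le> d" for j
    using that s pw[of "j - 1"] by (auto intro!: mult_mono)
  have inv: "inv \<sigma> j \<le> d" if "j \<in> {1..d}" for j
    using permutes_in_image[OF permutes_inv[OF perm]] that by (metis atLeastAtMost_iff)
  have id: "real i * (real d * max 1 \<beta> ^ d) \<le> Cd" using assms(2) unfolding Cd_def
    by (intro order_trans[OF mult_right_mono[of "real i" "real d"]]) auto
  show "0 \<le> dx s i" unfolding dx_def by (rule sum_nonneg) (use tm assms in auto)
  have "dx s i \<le> (\<Sum>j=1..i. real d * max 1 \<beta> ^ d)" unfolding dx_def by (rule sum_mono) (use tm assms in auto)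
  then show "dx s i \<le> Cd" using id by simp
  show "0 \<le> dx' s i" unfolding dx'_def by (rule sum_nonneg) (use tm inv assms in auto)
  have "dx' s i \<le> (\<Sum>j=1..i. real d * max 1 \<beta> ^ d)" unfolding dx'_def by (rule sum_mono) (use tm inv assms in auto)
  then show "dx' s i \<le> Cd" using id by simp
qed

lemma dyy_bound:
  assumes "s \<in> K" "j \<le> d" "\<And>u. u < t \<Longrightarrow> c u \<in> {1..d}"
  shows "\<bar>dyy c j t s\<bar> \<le> Cd * (real t + 1)"
proof -
  have sg: "\<sigma> i \<in> {1..d}" if "i \<in> {1..d}" for i using permutes_in_image[OF perm] that by blast
  have "\<bar>dx' s (\<sigma> (c u) - 1) - dx s (c u - 1)\<bar> \<le> Cd" if "u < t" for u
  proof -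
    have "\<sigma> (c u) - 1 \<le> d" "c u - 1 \<le> d" using assms(3)[OF that] sg[OF assms(3)[OF that]] by auto
    then show ?thesis using deriv_bounds[OF assms(1)] by (smt (verit))
  qed
  then have "\<bar>\<Sum>u<t. dx' s (\<sigma> (c u) - 1) - dx s (c u - 1)\<bar> \<le> (\<Sum>u<t. Cd)"
    by (intro order_trans[OF sum_abs] sum_mono) auto
  moreover have "\<bar>dx' s j\<bar> \<le> Cd" using deriv_bounds(3,4)[OF assms(1,2)] by simp
  ultimately show ?thesis unfolding dyy_def by (simp add: algebra_simps)
qed

lemma diff_bound:
  assumes s: "s0 \<in> K" "s \<in> K" and i: "i \<le> d" "j \<le> d" and c: "\<And>u. u < t \<Longrightarrow> c u \<in> {1..d}"
  shows "\<bar>(yy c j t s - xx s i) - (yy c j t s0 - xx s0 i)\<bar> \<le> 2 * Cd * (real t + 1) * \<bar>s - s0\<bar>"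
proof -
  have "norm ((yy c j t s - xx s i) - (yy c j t s0 - xx s0 i)) \<le> 2 * Cd * (real t + 1) * norm (s - s0)"
  proof (rule field_differentiable_bound[of K])
    show "((\<lambda>s. yy c j t s - xx s i) has_field_derivative dyy c j t z - dx z i) (at z within K)" for z
      by (intro derivative_intros has_field_derivative_at_within[OF yy_deriv] has_field_derivative_at_within[OF xx_deriv])
    show "norm (dyy c j t z - dx z i) \<le> 2 * Cd * (real t + 1)" if z: "z \<in> K" for z
    proof -
      have "\<bar>dx z i\<bar> \<le> Cd * (real t + 1)"
        using deriv_bounds(1,2)[OF z i(1)] Cd1 mult_left_mono[of 1 "real t + 1" Cd] by linarith
      moreover have "\<bar>dyy c j t z\<bar> \<le> Cd * (real t + 1)" by (rule dyy_bound[OF z i(2) c])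
      ultimately show ?thesis by (simp add: algebra_simps)
    qed
  qed (use s in auto)
  then show ?thesis by simp
qed

definition "w0 = Min ((\<lambda>i. \<alpha> ^ i) ` {1..d})"

lemma w0: "0 < w0" "s \<in> K \<Longrightarrow> i \<in> {1..d} \<Longrightarrow> w0 \<le> s ^ i"
proof -
  have fin: "finite ((\<lambda>i. \<alpha> ^ i) ` {1..d})" "(\<lambda>i. \<alpha> ^ i) ` {1..d} \<noteq> {}" using d2 by auto
  show "0 < w0" unfolding w0_def using fin ab by (subst Min_gr_iff) auto
  show "w0 \<le> s ^ i" if "s \<in> K" "i \<in> {1..d}"
  proof -
    have "w0 \<le> \<alpha> ^ i" unfolding w0_def using fin that by (intro Min_le) auto
    also have "\<dots> \<le> s ^ i" using that ab by (intro power_mono) auto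
    finally show ?thesis .
  qed
qed

text \<open>By \<open>diff_bound\<close>, within the stated window no difference between an orbit
  point and an endpoint changes by more than \<open>W / 4\<close>. The margin \<open>W\<close> at
  \<open>s0\<close> therefore leaves at least \<open>W / 2\<close>, and the itinerary of
  \<open>s0\<close> remains valid.\<close>

lemma stable_orbit:
  assumes s0: "s0 \<in> K" and j: "j \<in> {1..d - 1}" and W: "0 < W" "W \<le> w0"
    and far: "\<And>t. t < k \<Longrightarrow> \<not> near (DD s0) W ((TT s0 ^^ t) (xx' s0 j))"
  obtains c where "\<And>t. t < k \<Longrightarrow> c t \<in> {1..d}"
    "\<And>s t. s \<in> K \<Longrightarrow> 8 * Cd * (real k + 1) * \<bar>s - s0\<bar> \<le> W \<Longrightarrow> t \<le> k \<Longrightarrow> (TT s ^^ t) (xx' s j) = yy c j t s"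
    "\<And>s t. s \<in> K \<Longrightarrow> 8 * Cd * (real k + 1) * \<bar>s - s0\<bar> \<le> W \<Longrightarrow> t < k \<Longrightarrow>
       xx s (c t - 1) + W / 2 \<le> yy c j t s \<and> yy c j t s \<le> xx s (c t) - W / 2"
    "\<And>s t i. s \<in> K \<Longrightarrow> 8 * Cd * (real k + 1) * \<bar>s - s0\<bar> \<le> W \<Longrightarrow> t \<le> k \<Longrightarrow> i \<le> d \<Longrightarrow>
       \<bar>(yy c j t s - xx s i) - (yy c j t s0 - xx s0 i)\<bar> \<le> W / 4"
proof -
  have jd: "j \<le> d" using j by auto
  have "\<exists>c. c \<in> {1..d} \<and> xx s0 (c - 1) + W \<le> (TT s0 ^^ t) (xx' s0 j) \<and> (TT s0 ^^ t) (xx' s0 j) \<le> xx s0 c - W" if "t < k" for t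
    by (rule iet_data.orbit_margin[OF data[OF K_pos[OF s0]] w0(2)[OF s0] W far j that]) blast+
  then obtain c where c: "\<And>t. t < k \<Longrightarrow> c t \<in> {1..d} \<and> xx s0 (c t - 1) + W \<le> (TT s0 ^^ t) (xx' s0 j) \<and> (TT s0 ^^ t) (xx' s0 j) \<le> xx s0 (c t) - W"
    by metis
  have step: "TT s (yy c j t s) = yy c j (Suc t) s" if s: "s \<in> K" "t < k" "xx s (c t - 1) \<le> yy c j t s" "yy c j t s < xx s (c t)" for s t
    using iet_data.T_eq[OF data[OF K_pos[OF s(1)]], of "c t" "yy c j t s"] s c[OF s(2)] by (simp add: yy_def)
  have at0: "(TT s0 ^^ t) (xx' s0 j) = yy c j t s0" if "t \<le> k" for t
    using that
  proof (induction t)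
    case (Suc t)
    then have "(TT s0 ^^ t) (xx' s0 j) = yy c j t s0" "t < k" by auto
    then show ?case using step[of s0 t] c[of t] s0 W by simp
  qed (simp add: yy_def)
  have close: "\<bar>(yy c j t s - xx s i) - (yy c j t s0 - xx s0 i)\<bar> \<le> W / 4"
    if s: "s \<in> K" "8 * Cd * (real k + 1) * \<bar>s - s0\<bar> \<le> W" and t: "t \<le> k" and i: "i \<le> d" for s t i
  proof -
    have "\<bar>(yy c j t s - xx s i) - (yy c j t s0 - xx s0 i)\<bar> \<le> 2 * Cd * (real t + 1) * \<bar>s - s0\<bar>"
      by (rule diff_bound[OF s0 s(1) i jd]) (use c t in auto)
    also have "\<dots> \<le> 2 * Cd * (real k + 1) * \<bar>s - s0\<bar>" using t Cd1 by (intro mult_right_mono mult_left_mono) auto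
    also have "\<dots> \<le> W / 4" using s(2) by simp
    finally show ?thesis .
  qed
  have margin: "xx s (c t - 1) + W / 2 \<le> yy c j t s \<and> yy c j t s \<le> xx s (c t) - W / 2"
    if s: "s \<in> K" "8 * Cd * (real k + 1) * \<bar>s - s0\<bar> \<le> W" and t: "t < k" for s t
  proof -
    have "c t - 1 \<le> d" "c t \<le> d" using c[OF t] by auto
    then have "\<bar>(yy c j t s - xx s (c t - 1)) - (yy c j t s0 - xx s0 (c t - 1))\<bar> \<le> W / 4"
      "\<bar>(yy c j t s - xx s (c t)) - (yy c j t s0 - xx s0 (c t))\<bar> \<le> W / 4"
      using close[OF s less_imp_le[OF t]] by blast+
    then show ?thesis using c[OF t] at0[OF less_imp_le[OF t]] W by linarith
  qed
  have orb: "(TT s ^^ t) (xx' s j) = yy c j t s"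
    if s: "s \<in> K" "8 * Cd * (real k + 1) * \<bar>s - s0\<bar> \<le> W" and t: "t \<le> k" for s t
    using t
  proof (induction t)
    case (Suc t)
    then have "(TT s ^^ t) (xx' s j) = yy c j t s" "t < k" by auto
    then show ?case using step[of s t] margin[OF s, of t] s W by simp
  qed (simp add: yy_def)
  show thesis using that[of c] c orb margin close by blast
qed

text \<open>With \<open>y\<close> kept \<open>w0 / 2\<close> away from both ends, the pairs of
  parameter and point form a compact set, on which the continuous positive gap attains its
  minimum.\<close>

lemma FF_lower:
  obtains c0 where "0 < c0" "\<And>s y. s \<in> K \<Longrightarrow> w0 / 2 \<le> y \<Longrightarrow> y \<le> LL s - w0 / 2 \<Longrightarrow> c0 \<le> FF s y"
proof -
  define Q where "Q = {p :: real \<times> real. fst p \<in> K \<and> w0 / 2 \<le> snd p \<and> snd p \<le> LL (fst p) - w0 / 2}"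
  have contL: "continuous_on A (\<lambda>p. xx (fst p) i)" for A :: "(real \<times> real) set" and i
    unfolding iet_endpt_def by (intro continuous_intros)
  have cont: "continuous_on A (\<lambda>p. FF (fst p) (snd p))" for A
    unfolding FF_def ramp_def clamp_def iet_endpt_def comp_def by (intro continuous_intros)
  have Lmax: "LL s \<le> LL \<beta>" if "s \<in> K" for s
    unfolding iet_endpt_def using that ab by (intro sum_mono power_mono) auto
  have "Q = (K \<times> {w0 / 2..LL \<beta>}) \<inter> {p. snd p \<le> LL (fst p) - w0 / 2}"
    using Lmax w0(1) unfolding Q_def by (auto intro: order_trans[OF _ Lmax] simp: field_simps) (smt (verit) Lmax atLeastAtMost_iff)
  moreover have "closed {p :: real \<times> real. snd p \<le> LL (fst p) - w0 / 2}"
    by (intro closed_Collect_le continuous_intros contL)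
  ultimately have "compact Q" by (auto intro!: compact_Int_closed compact_Times)
  show thesis
  proof (cases "Q = {}")
    case True
    show thesis by (rule that[of 1]) (use True in \<open>auto simp: Q_def\<close>)
  next
    case False
    obtain p where p: "p \<in> Q" "\<And>q. q \<in> Q \<Longrightarrow> FF (fst p) (snd p) \<le> FF (fst q) (snd q)"
      using continuous_attains_inf[OF \<open>compact Q\<close> False cont] by blast
    have s: "0 < fst p" using p(1) ab by (auto simp: Q_def)
    have "0 < FF (fst p) (snd p)"
      using iet_data.ramp_gap_pos[OF data[OF s], of "snd p"] p(1) w0(1) by (simp add: ramp_gap_eq[OF s] L_eq[OF s] Q_def)
    then show thesis using p(2) by (intro that[of "FF (fst p) (snd p)"]) (auto simp: Q_def)
  qed
qed

text \<open>With \<open>F\<close> and \<open>G\<close> the two ramps whose difference is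
  \<open>FF\<close>, step \<open>t\<close> contributes \<open>F\<close> at the next point minus
  \<open>G\<close> at the current one, by \<open>ramp_T\<close>. This equals the increment of
  \<open>F\<close> along the orbit plus \<open>FF\<close> at the current point; the increments
  telescope.\<close>

lemma deriv_formula:
  assumes s: "0 < s" and i: "i \<in> {1..d - 1}" and j: "j \<in> {1..d - 1}"
    and c: "\<And>t. t < k \<Longrightarrow> c t \<in> {1..d} \<and> xx s (c t - 1) \<le> yy c j t s \<and> yy c j t s < xx s (c t)"
  shows "s * (dyy c j k s - dx s i) = ramp d (\<lambda>i. real (inv \<sigma> i)) ((\<lambda>i. s ^ i) \<circ> inv \<sigma>) (yy c j k s)
     - ramp d real (\<lambda>i. s ^ i) (xx s i) + (\<Sum>t<k. FF s (yy c j t s))"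
proof -
  interpret iet_data d \<sigma> "\<lambda>i. s ^ i" by (rule data[OF s])
  let ?F = "ramp d (\<lambda>i. real (inv \<sigma> i)) ((\<lambda>i. s ^ i) \<circ> inv \<sigma>)" and ?G = "ramp d real (\<lambda>i. s ^ i)"
  have sp: "s * (real m * s ^ (m - 1)) = real m * s ^ m" for m by (cases m) auto
  have sdx: "s * dx s m = (\<Sum>i=1..m. real i * s ^ i)" for m
    unfolding dx_def sum_distrib_left by (rule sum.cong[OF refl]) (rule sp)
  have sdx': "s * dx' s m = (\<Sum>i=1..m. real (inv \<sigma> i) * s ^ inv \<sigma> i)" for m
    unfolding dx'_def sum_distrib_left by (rule sum.cong[OF refl]) (rule sp)
  have sum_pred: "(\<Sum>i=1..m. f i) = (\<Sum>i=1..m - 1. f i) + f m" if "1 \<le> m" for m and f :: "nat \<Rightarrow> real"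
    using that by (cases m) auto
  have G: "?G (xx s i) = s * dx s i"
  proof -
    have id: "i \<in> {1..d}" using i by auto
    have "?G (xx s i) = (\<Sum>l=1..i - 1. real l * s ^ l) + real i * (xx s i - xx s (i - 1))"
      by (rule ramp_eq[OF _ id]) (use endpt_pred(1)[OF id] s in auto)
    then show ?thesis unfolding sdx using sum_pred[of i "\<lambda>l. real l * s ^ l"] endpt_pred(1)[OF id] id by simp
  qed
  have F: "?F (xx' s j) = s * dx' s j"
  proof -
    have jd: "j \<in> {1..d}" using j by auto
    have "?F (xx' s j) = (\<Sum>l=1..j - 1. real (inv \<sigma> l) * ((\<lambda>i. s ^ i) \<circ> inv \<sigma>) l) + real (inv \<sigma> j) * (xx' s j - iet_endpt ((\<lambda>i. s ^ i) \<circ> inv \<sigma>) (j - 1))"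
      by (rule ramp_eq[OF _ jd]) (use endpt_pred(2)[OF jd] s in \<open>auto simp: inverse_endpt\<close>)
    then show ?thesis unfolding sdx' inverse_endpt
      using sum_pred[of j "\<lambda>l. real (inv \<sigma> l) * s ^ inv \<sigma> l"] endpt_pred(2)[OF jd] jd by simp
  qed
  have tau: "s * (dx' s (\<sigma> (c t) - 1) - dx s (c t - 1)) = ?F (yy c j (Suc t) s) - ?G (yy c j t s)" if t: "t < k" for t :: nat
  proof -
    have T: "T (yy c j t s) = yy c j (Suc t) s"
      using T_eq[of "c t" "yy c j t s"] c[OF t] by (simp add: yy_def)
    show ?thesis unfolding T[symmetric] using ramp_T[of "c t" "yy c j t s"] c[OF t]
      by (simp only: right_diff_distrib sdx sdx')
  qed
  have tel: "(\<Sum>t<m. ?F (yy c j (Suc t) s) - ?G (yy c j t s)) = ?F (yy c j m s) - ?F (xx' s j) + (\<Sum>t<m. FF s (yy c j t s))" for m :: nat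
  proof (induction m)
    case (Suc m)
    then show ?case by (simp add: FF_def comp_def)
  qed (simp add: yy_def)
  have "s * dyy c j k s = s * dx' s j + (\<Sum>t<k. s * (dx' s (\<sigma> (c t) - 1) - dx s (c t - 1)))"
    unfolding dyy_def by (simp add: distrib_left sum_distrib_left)
  also have "(\<Sum>t<k. s * (dx' s (\<sigma> (c t) - 1) - dx s (c t - 1))) = (\<Sum>t<k. ?F (yy c j (Suc t) s) - ?G (yy c j t s))"
    by (rule sum.cong) (use tau in auto)
  finally show ?thesis unfolding tel using F G by (simp add: right_diff_distrib)
qed

section \<open>Measure of the parameters with isolated near-connections\<close>

definition "hits s j k \<mu> W \<longleftrightarrow> near (DD s) \<mu> ((TT s ^^ k) (xx' s j)) \<and> (\<forall>t<k. \<not> near (DD s) W ((TT s ^^ t) (xx' s j)))"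

lemma xx_sep:
  assumes s: "s \<in> K" and i: "i < i'" "i' \<le> d"
  shows "xx s i + w0 \<le> xx s i'"
proof -
  have "xx s i \<le> xx s (i' - 1)" using i K_pos[OF s] by (intro endpt_mono[of d]) auto
  moreover have "xx s i' = xx s (i' - 1) + s ^ i'" using i by (cases i') (auto simp: iet_endpt_def)
  moreover have "w0 \<le> s ^ i'" by (rule w0(2)[OF s]) (use i in auto)
  ultimately show ?thesis by simp
qed

lemma xx_bounds:
  assumes s: "s \<in> K" and i: "i \<in> {1..d - 1}"
  shows "w0 \<le> xx s i" "xx s i \<le> LL s - w0"
proof -
  have i': "0 < i" "i \<le> d" "i < d" using i d2 by auto
  have "xx s 0 = 0" by (simp add: iet_endpt_def)
  then show "w0 \<le> xx s i" "xx s i \<le> LL s - w0"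
    using xx_sep[OF s i'(1,2)] xx_sep[OF s i'(3) order_refl] by linarith+
qed

text \<open>At \<open>xx s i\<close> the boundary terms of \<open>deriv_formula\<close> would give
  \<open>FF \<ge> c0\<close>; replacing one argument by the nearby orbit point costs at most
  \<open>c0 / 2\<close>, by the Lipschitz bound. The orbit sum adds \<open>c0 * (k div 2)\<close>,
  and together these exceed \<open>c0 * (k + 1) / 4\<close>.\<close>

lemma speed_lower:
  assumes c0: "0 < c0" "\<And>s y. s \<in> K \<Longrightarrow> w0 / 2 \<le> y \<Longrightarrow> y \<le> LL s - w0 / 2 \<Longrightarrow> c0 \<le> FF s y"
    and s: "s \<in> K" and i: "i \<in> {1..d - 1}" and j: "j \<in> {1..d - 1}" and W: "0 < W" "real d * real d * W \<le> c0"
    and c: "\<And>t. t < k \<Longrightarrow> c t \<in> {1..d}"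
    and orb: "\<And>t. t \<le> k \<Longrightarrow> (TT s ^^ t) (xx' s j) = yy c j t s"
    and margin: "\<And>t. t < k \<Longrightarrow> xx s (c t - 1) + W / 2 \<le> yy c j t s \<and> yy c j t s \<le> xx s (c t) - W / 2"
    and close: "\<bar>yy c j k s - xx s i\<bar> \<le> W / 2"
  shows "c0 * (real k + 1) / 4 \<le> s * (dyy c j k s - dx s i)"
proof -
  note s0 = K_pos[OF s]
  let ?F = "ramp d (\<lambda>i. real (inv \<sigma> i)) ((\<lambda>i. s ^ i) \<circ> inv \<sigma>)" and ?G = "ramp d real (\<lambda>i. s ^ i)"
  have inv: "inv \<sigma> j \<le> d" if "j \<in> {1..d}" for j
    using permutes_in_image[OF permutes_inv[OF perm]] that by (metis atLeastAtMost_iff)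
  have "(\<Sum>i=1..d. real (inv \<sigma> i)) \<le> (\<Sum>i=1..d. real d)" by (rule sum_mono) (use inv in auto)
  then have "(\<Sum>i=1..d. real (inv \<sigma> i)) * \<bar>yy c j k s - xx s i\<bar> \<le> (real d * real d) * (W / 2)"
    using close by (intro mult_mono) auto
  moreover have "\<bar>?F (yy c j k s) - ?F (xx s i)\<bar> \<le> (\<Sum>i=1..d. real (inv \<sigma> i)) * \<bar>yy c j k s - xx s i\<bar>"
    by (rule ramp_lipschitz) simp
  ultimately have F: "?F (xx s i) - ?F (yy c j k s) \<le> c0 / 2" using W by linarith
  have "w0 / 2 \<le> xx s i" "xx s i \<le> LL s - w0 / 2" using xx_bounds[OF s i] w0(1) by linarith+
  then have G: "c0 \<le> ?F (xx s i) - ?G (xx s i)" using c0(2)[OF s] by (simp add: FF_def)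
  have sum: "c0 * real (k div 2) \<le> (\<Sum>t<k. FF s (yy c j t s))"
    unfolding ramp_gap_eq[OF s0, symmetric]
  proof (rule iet_data.ramp_gap_orbit_sum[OF data[OF s0], of w0])
    show "w0 \<le> s ^ i" if "i \<in> {1..d}" for i using w0(2)[OF s that] .
    show "c0 \<le> iet_data.ramp_gap d \<sigma> ((^) s) y" if "w0 / 2 \<le> y" "y \<le> iet_data.L d ((^) s) - w0 / 2" for y
      using c0(2)[OF s, of y] that by (simp add: ramp_gap_eq[OF s0] L_eq[OF s0])
    show "yy c j t s \<in> {0..<iet_data.L d ((^) s)}" if t: "t < k" for t
    proof -
      have "0 \<le> xx s (c t - 1)" using s0 by (auto simp: iet_endpt_def intro!: sum_nonneg)
      moreover have "xx s (c t) \<le> LL s" using s0 c[OF t] by (intro endpt_mono[of d]) auto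
      ultimately show ?thesis using margin[OF t] W by (simp add: L_eq[OF s0])
    qed
    show "yy c j (Suc t) s = TT s (yy c j t s)" if "Suc t < k" for t
      using orb[of t] orb[of "Suc t"] that by simp
  qed (use w0 c0 in auto)
  have "s * (dyy c j k s - dx s i) = ?F (yy c j k s) - ?G (xx s i) + (\<Sum>t<k. FF s (yy c j t s))"
    by (rule deriv_formula[OF s0 i j]) (use c margin W in \<open>force\<close>)
  moreover have "c0 * (real k + 1) / 4 \<le> c0 / 2 + c0 * real (k div 2)"
  proof -
    have "real k \<le> 2 * real (k div 2) + 1" by linarith
    then have "(real k + 1) / 4 \<le> 1 / 2 + real (k div 2)" using of_nat_0_le_iff[of "k div 2", where 'a = real] by argo
    then have "c0 * ((real k + 1) / 4) \<le> c0 * (1 / 2 + real (k div 2))" using c0(1) by (intro mult_left_mono) auto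
    then show ?thesis by (simp add: algebra_simps)
  qed
  ultimately show ?thesis using F G sum by linarith
qed

text \<open>In the window of stability a hit at one parameter is still \<open>W\<close>-close at the
  other. Isolation then forces \<open>k' = k\<close>, and the spacing \<open>w0\<close> of the
  endpoints forces the same target. So one function of the parameter is at most \<open>\<mu>\<close>
  in size at both places, while its slope between them is at least
  \<open>c0 * (k + 1) / (4 * \<beta>)\<close>.\<close>

lemma hits_localized:
  assumes c0: "0 < c0" "\<And>s y. s \<in> K \<Longrightarrow> w0 / 2 \<le> y \<Longrightarrow> y \<le> LL s - w0 / 2 \<Longrightarrow> c0 \<le> FF s y"
    and s: "s0 \<in> K" "s \<in> K" and j: "j \<in> {1..d - 1}"
    and W: "0 < W" "W \<le> w0 / 4" "real d * real d * W \<le> c0" and mu: "8 * \<mu> \<le> W"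
    and hit: "hits s0 j k \<mu> W" "hits s j k' \<mu> W"
    and near_s: "8 * Cd * (real k + 1) * \<bar>s - s0\<bar> \<le> W"
  shows "c0 * (real k + 1) * \<bar>s - s0\<bar> \<le> 8 * \<beta> * \<mu>"
proof -
  have far: "\<And>t. t < k \<Longrightarrow> \<not> near (DD s0) W ((TT s0 ^^ t) (xx' s0 j))"
    and far': "\<And>t. t < k' \<Longrightarrow> \<not> near (DD s) W ((TT s ^^ t) (xx' s j))"
    using hit by (auto simp: hits_def)
  have Ww: "W \<le> w0" using W w0(1) by simp
  obtain c where c: "\<And>t. t < k \<Longrightarrow> c t \<in> {1..d}"
    "\<And>s t. s \<in> K \<Longrightarrow> 8 * Cd * (real k + 1) * \<bar>s - s0\<bar> \<le> W \<Longrightarrow> t \<le> k \<Longrightarrow> (TT s ^^ t) (xx' s j) = yy c j t s"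
    "\<And>s t. s \<in> K \<Longrightarrow> 8 * Cd * (real k + 1) * \<bar>s - s0\<bar> \<le> W \<Longrightarrow> t < k \<Longrightarrow>
       xx s (c t - 1) + W / 2 \<le> yy c j t s \<and> yy c j t s \<le> xx s (c t) - W / 2"
    "\<And>s t i. s \<in> K \<Longrightarrow> 8 * Cd * (real k + 1) * \<bar>s - s0\<bar> \<le> W \<Longrightarrow> t \<le> k \<Longrightarrow> i \<le> d \<Longrightarrow>
       \<bar>(yy c j t s - xx s i) - (yy c j t s0 - xx s0 i)\<bar> \<le> W / 4"
    using stable_orbit[OF s(1) j W(1) Ww far] by blast
  have orb: "(TT s ^^ t) (xx' s j) = yy c j t s" "(TT s0 ^^ t) (xx' s0 j) = yy c j t s0" if "t \<le> k" for t
    using c(2)[OF s(2) near_s that] c(2)[OF s(1) _ that] W by auto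
  obtain i1 where i1: "i1 \<in> {1..d - 1}" "\<bar>(TT s ^^ k') (xx' s j) - xx s i1\<bar> \<le> \<mu>"
    using hit(2) by (auto simp: hits_def near_def)
  obtain i0 where i0: "i0 \<in> {1..d - 1}" "\<bar>(TT s0 ^^ k) (xx' s0 j) - xx s0 i0\<bar> \<le> \<mu>"
    using hit(1) by (auto simp: hits_def near_def)
  have id: "i0 \<le> d" "i1 \<le> d" using i0 i1 by auto
  have mu0: "0 \<le> \<mu>" using i0(2) by linarith
  have "\<not> k' < k"
  proof
    assume k: "k' < k"
    have "\<bar>yy c j k' s0 - xx s0 i1\<bar> \<le> W"
      using c(4)[OF s(2) near_s less_imp_le[OF k] id(2)] i1(2) orb(1)[OF less_imp_le[OF k]] mu W by linarith
    then have "near (DD s0) W ((TT s0 ^^ k') (xx' s0 j))" unfolding near_def orb(2)[OF less_imp_le[OF k]] using i1(1) by blast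
    then show False using far[OF k] by simp
  qed
  moreover have "\<not> k < k'"
  proof
    assume k: "k < k'"
    have "\<bar>yy c j k s - xx s i0\<bar> \<le> W"
      using c(4)[OF s(2) near_s order_refl id(1)] i0(2) orb(2)[OF order_refl] mu W by linarith
    then have "near (DD s) W ((TT s ^^ k) (xx' s j))" unfolding near_def orb(1)[OF order_refl] using i0(1) by blast
    then show False using far'[OF k] by simp
  qed
  ultimately have kk: "k' = k" by simp
  have e0: "\<bar>yy c j k s0 - xx s0 i0\<bar> \<le> \<mu>" using i0(2) orb(2)[OF order_refl] by simp
  have e1: "\<bar>yy c j k s - xx s i1\<bar> \<le> \<mu>" using i1(2) orb(1)[OF order_refl] kk by simp
  have "i0 = i1"
  proof (rule ccontr)
    assume "i0 \<noteq> i1"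
    then have "w0 \<le> \<bar>xx s0 i0 - xx s0 i1\<bar>"
      using xx_sep[OF s(1), of i0 i1] xx_sep[OF s(1), of i1 i0] id by linarith
    moreover have "\<bar>xx s0 i0 - xx s0 i1\<bar> \<le> 2 * \<mu> + W / 4"
      using c(4)[OF s(2) near_s order_refl id(2)] e0 e1 by linarith
    ultimately show False using W mu by linarith
  qed
  define f where "f u = yy c j k u - xx u i0" for u
  have f01: "\<bar>f s0\<bar> \<le> \<mu>" "\<bar>f s\<bar> \<le> \<mu>" using e0 e1 \<open>i0 = i1\<close> by (auto simp: f_def)
  have slope: "c0 * (real k + 1) / 4 \<le> u * (dyy c j k u - dx u i0)" if u: "u \<in> K" "\<bar>u - s0\<bar> \<le> \<bar>s - s0\<bar>" for u
  proof -
    have "8 * Cd * (real k + 1) * \<bar>u - s0\<bar> \<le> 8 * Cd * (real k + 1) * \<bar>s - s0\<bar>"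
      using u Cd1 by (intro mult_left_mono) auto
    then have nu: "8 * Cd * (real k + 1) * \<bar>u - s0\<bar> \<le> W" using near_s by linarith
    have "\<bar>yy c j k u - xx u i0\<bar> \<le> W / 2"
      using c(4)[OF u(1) nu order_refl id(1)] f01(1) mu W unfolding f_def by linarith
    then show ?thesis
      by (intro speed_lower[OF c0 u(1) i0(1) j W(1,3) c(1) c(2)[OF u(1) nu] c(3)[OF u(1) nu]])
  qed
  have df: "(f has_real_derivative dyy c j k u - dx u i0) (at u)" for u
    unfolding f_def[abs_def] by (intro derivative_intros yy_deriv xx_deriv)
  have main: "c0 * (real k + 1) / (4 * \<beta>) * (v - u) \<le> f v - f u"
    if uv: "u < v" "u \<in> K" "v \<in> K" "\<And>z. u \<le> z \<Longrightarrow> z \<le> v \<Longrightarrow> \<bar>z - s0\<bar> \<le> \<bar>s - s0\<bar>" for u v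
  proof -
    obtain z where z: "u < z" "z < v" "f v - f u = (v - u) * (dyy c j k z - dx z i0)"
      using MVT2[OF uv(1), of f "\<lambda>z. dyy c j k z - dx z i0"] df by blast
    have zK: "z \<in> K" using z uv by auto
    have sl: "c0 * (real k + 1) / 4 \<le> z * (dyy c j k z - dx z i0)" by (rule slope[OF zK uv(4)]) (use z in auto)
    have "0 < c0 * (real k + 1) / 4" using c0 by simp
    then have "0 < dyy c j k z - dx z i0" using sl K_pos[OF zK] by (meson less_le_trans zero_less_mult_pos)
    then have "z * (dyy c j k z - dx z i0) \<le> \<beta> * (dyy c j k z - dx z i0)" using zK by (intro mult_right_mono) auto
    then have "c0 * (real k + 1) / (4 * \<beta>) \<le> dyy c j k z - dx z i0" using sl ab by (simp add: field_simps)
    then have "(v - u) * (c0 * (real k + 1) / (4 * \<beta>)) \<le> f v - f u"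
      unfolding z(3) using uv(1) by (intro mult_left_mono) auto
    then show ?thesis by (simp only: mult.commute)
  qed
  have "c0 * (real k + 1) / (4 * \<beta>) * \<bar>s - s0\<bar> \<le> 2 * \<mu>"
  proof (cases s s0 rule: linorder_cases)
    case less
    then show ?thesis using main[of s s0] s f01 by auto
  next
    case greater
    then show ?thesis using main[of s0 s] s f01 by auto
  qed (use mu0 in simp)
  then show ?thesis using ab by (simp add: field_simps)
qed

abbreviation "isol s \<equiv> isolated (TT s) (DD s) (DD' s)"

lemma isolated_iff_hits: "isol s N \<mu> W \<longleftrightarrow> (\<exists>j\<in>{1..d - 1}. \<exists>k<N. hits s j k \<mu> W)"
  by (auto simp: isolated_def hits_def)

text \<open>The constants do not depend on \<open>N\<close>, although times up to \<open>N\<close>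
  are allowed: the window and the part of it that can contain hits both shrink like
  \<open>1 / (k + 1)\<close>. \<open>N\<close> enters only through the smallest radius
  \<open>r0\<close>, which serves to terminate the covering.\<close>

lemma isolated_cover:
  obtains C Wm where "0 < C" "0 < Wm"
    "\<And>N \<mu> W. 0 \<le> \<mu> \<Longrightarrow> 8 * \<mu> \<le> W \<Longrightarrow> 0 < W \<Longrightarrow> W \<le> Wm \<Longrightarrow>
       \<exists>U\<in>sets borel. {s \<in> K. isol s N \<mu> W} \<subseteq> U \<and> emeasure lborel U \<le> ennreal (C * \<mu> / W)"
proof -
  obtain c0 where c0: "0 < c0" "\<And>s y. s \<in> K \<Longrightarrow> w0 / 2 \<le> y \<Longrightarrow> y \<le> LL s - w0 / 2 \<Longrightarrow> c0 \<le> FF s y"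
    using FF_lower by blast
  define Wm where "Wm = min 1 (min (w0 / 4) (c0 / (real d * real d)))"
  define C1 where "C1 = 128 * \<beta> * Cd * (\<beta> - \<alpha> + 1) / c0"
  have d0: "0 < real d" using d2 by simp
  have Wm: "0 < Wm" using w0(1) c0(1) d0 by (simp add: Wm_def)
  have C1: "0 < C1" using ab Cd1 c0(1) by (simp add: C1_def)
  have single: "\<exists>U\<in>sets borel. {s \<in> K. \<exists>k<N. hits s j k \<mu> W} \<subseteq> U \<and> emeasure lborel U \<le> ennreal (C1 * \<mu> / W)"
    if mu: "0 \<le> \<mu>" "8 * \<mu> \<le> W" and W: "0 < W" "W \<le> Wm" and j: "j \<in> {1..d - 1}" for N \<mu> W j
  proof (cases "N = 0")
    case True
    then show ?thesis by (intro bexI[of _ "{}"]) auto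
  next
    case False
    \<comment> \<open>\<open>r k\<close> is the radius of stability at time \<open>k\<close>, and
      \<open>\<kappa> * r k\<close> is the radius
      \<open>8 * \<beta> * \<mu> / (c0 * (k + 1))\<close> to which \<open>hits_localized\<close>
      confines the hits; the ratio is free of \<open>k\<close>.\<close>
    define \<kappa> where "\<kappa> = 64 * \<beta> * \<mu> * Cd / (c0 * W)"
    define r where "r k = W / (8 * Cd * (real k + 1))" for k :: nat
    define r0 where "r0 = W / (8 * Cd * real N)"
    have W': "W \<le> w0 / 4" "real d * real d * W \<le> c0" "W \<le> 1"
      using W d0 by (auto simp: Wm_def field_simps)
    have r0: "0 < r0" using W Cd1 False by (simp add: r0_def)
    have kap: "0 \<le> \<kappa>" using ab mu W Cd1 c0 by (simp add: \<kappa>_def)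
    obtain n :: nat where n: "\<beta> - \<alpha> < real n * r0" using reals_Archimedean3[OF r0] by blast
    let ?S = "{s \<in> K. \<exists>k<N. hits s j k \<mu> W}"
    have "\<exists>U\<in>sets borel. ?S \<subseteq> U \<and> emeasure lborel U \<le> ennreal (2 * \<kappa> * (\<bar>\<beta> - \<alpha>\<bar> + 1))"
    proof (rule interval_cover[OF r0 kap, where n = n and \<alpha> = \<alpha> and \<beta> = \<beta>])
      fix s assume "s \<in> ?S"
      then obtain k where k: "s \<in> K" "k < N" "hits s j k \<mu> W" by auto
      have "r0 \<le> r k" unfolding r0_def r_def using k W Cd1 by (intro divide_left_mono mult_left_mono) auto
      moreover have "r k \<le> 1"
      proof -
        have "1 * 1 \<le> Cd * (real k + 1)" using Cd1 by (intro mult_mono) auto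
        then show ?thesis unfolding r_def using W'(3) Cd1 by (subst divide_le_eq_1_pos) auto
      qed
      moreover have "?S \<inter> {s - r k..s + r k} \<subseteq> {s - \<kappa> * r k..s + \<kappa> * r k}"
      proof
        fix u assume u: "u \<in> ?S \<inter> {s - r k..s + r k}"
        then obtain k' where k': "u \<in> K" "hits u j k' \<mu> W" by auto
        have "\<bar>u - s\<bar> \<le> r k" using u by auto
        then have "8 * Cd * (real k + 1) * \<bar>u - s\<bar> \<le> W" unfolding r_def using Cd1 by (subst (asm) pos_le_divide_eq) (auto simp: mult.commute)
        then have "c0 * (real k + 1) * \<bar>u - s\<bar> \<le> 8 * \<beta> * \<mu>"
          using hits_localized[OF c0 k(1) k'(1) j W(1) W'(1,2) mu(2) k(3) k'(2)] by blast
        then have "\<bar>u - s\<bar> \<le> 8 * \<beta> * \<mu> / (c0 * (real k + 1))" using c0(1) by (subst pos_le_divide_eq) (auto simp: mult.commute)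
        also have "\<dots> = \<kappa> * r k" unfolding \<kappa>_def r_def using W Cd1 c0(1) by (simp add: divide_simps)
        finally show "u \<in> {s - \<kappa> * r k..s + \<kappa> * r k}" by auto
      qed
      ultimately show "\<exists>r. r0 \<le> r \<and> r \<le> 1 \<and> ?S \<inter> {s - r..s + r} \<subseteq> {s - \<kappa> * r..s + \<kappa> * r}" by blast
    next
      show "\<beta> - \<alpha> \<le> real n * r0" using n by simp
    qed auto
    moreover have "2 * \<kappa> * (\<bar>\<beta> - \<alpha>\<bar> + 1) = C1 * \<mu> / W" using ab unfolding \<kappa>_def C1_def by simp
    ultimately show ?thesis by simp
  qed
  show thesis
  proof (rule that[of "real d * C1" Wm])
    fix N \<mu> W assume A: "(0::real) \<le> \<mu>" "8 * \<mu> \<le> W" "0 < W" "W \<le> Wm"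
    define U where "U j = (SOME U. U \<in> sets borel \<and> {s \<in> K. \<exists>k<N. hits s j k \<mu> W} \<subseteq> U \<and> emeasure lborel U \<le> ennreal (C1 * \<mu> / W))" for j
    have "U j \<in> sets borel \<and> {s \<in> K. \<exists>k<N. hits s j k \<mu> W} \<subseteq> U j \<and> emeasure lborel (U j) \<le> ennreal (C1 * \<mu> / W)"
      if j: "j \<in> {1..d - 1}" for j
      unfolding U_def by (rule someI_ex) (use single[OF A j, of N] in blast)
    then have U: "\<And>j. j \<in> {1..d - 1} \<Longrightarrow> U j \<in> sets borel"
      "\<And>j. j \<in> {1..d - 1} \<Longrightarrow> {s \<in> K. \<exists>k<N. hits s j k \<mu> W} \<subseteq> U j"
      "\<And>j. j \<in> {1..d - 1} \<Longrightarrow> emeasure lborel (U j) \<le> ennreal (C1 * \<mu> / W)"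
      by blast+
    let ?U = "\<Union>j\<in>{1..d - 1}. U j"
    have "emeasure lborel ?U \<le> (\<Sum>j=1..d - 1. emeasure lborel (U j))"
      by (rule emeasure_subadditive_finite) (use U(1) in auto)
    also have "\<dots> \<le> (\<Sum>j=1..d - 1. ennreal (C1 * \<mu> / W))" by (rule sum_mono) (rule U(3))
    also have "\<dots> = ennreal (\<Sum>j=1..d - 1. C1 * \<mu> / W)" using A C1 by (intro sum_ennreal) simp
    also have "\<dots> \<le> ennreal (real d * C1 * \<mu> / W)"
    proof (rule ennreal_leI)
      have "real (d - 1) * (C1 * \<mu> / W) \<le> real d * (C1 * \<mu> / W)" using A C1 by (intro mult_right_mono) auto
      then show "(\<Sum>j=1..d - 1. C1 * \<mu> / W) \<le> real d * C1 * \<mu> / W" by (simp add: mult.assoc)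
    qed
    finally have "emeasure lborel ?U \<le> ennreal (real d * C1 * \<mu> / W)" .
    moreover have "?U \<in> sets borel" using U(1) by auto
    moreover have "{s \<in> K. isol s N \<mu> W} \<subseteq> ?U" unfolding isolated_iff_hits using U(2) by blast
    ultimately show "\<exists>U\<in>sets borel. {s \<in> K. isol s N \<mu> W} \<subseteq> U \<and> emeasure lborel U \<le> ennreal (real d * C1 * \<mu> / W)"
      by blast
  qed (use C1 d0 Wm in auto)
qed

text \<open>Up to its first exact hit an orbit keeps a positive distance from the finitely many
  singularities, so a connection is an isolated hit with \<open>\<mu> = 0\<close> at some scale
  \<open>v n\<close>. By \<open>isolated_cover\<close> each of these countably many sets is
  null.\<close>

lemma connections_null:
  obtains Z where "Z \<in> null_sets lborel"
    "\<And>s i j k. s \<in> K \<Longrightarrow> i \<in> {1..d - 1} \<Longrightarrow> j \<in> {1..d - 1} \<Longrightarrow> (TT s ^^ k) (xx' s j) = xx s i \<Longrightarrow> s \<in> Z"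
proof -
  obtain C Wm where C: "0 < C" "0 < Wm"
    "\<And>N \<mu> W. 0 \<le> \<mu> \<Longrightarrow> 8 * \<mu> \<le> W \<Longrightarrow> 0 < W \<Longrightarrow> W \<le> Wm \<Longrightarrow>
       \<exists>U\<in>sets borel. {s \<in> K. isol s N \<mu> W} \<subseteq> U \<and> emeasure lborel U \<le> ennreal (C * \<mu> / W)"
    using isolated_cover by blast
  define v where "v n = min Wm (1 / real (Suc n))" for n
  have v: "0 < v n" "v n \<le> Wm" "v n \<le> 1 / real (Suc n)" for n using C(2) by (auto simp: v_def)
  define U where "U N n = (SOME U. U \<in> null_sets lborel \<and> {s \<in> K. isol s N 0 (v n)} \<subseteq> U)" for N n
  have "U N n \<in> null_sets lborel \<and> {s \<in> K. isol s N 0 (v n)} \<subseteq> U N n" for N n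
    unfolding U_def
  proof (rule someI_ex)
    obtain U where "U \<in> sets borel" "{s \<in> K. isol s N 0 (v n)} \<subseteq> U" "emeasure lborel U \<le> ennreal (C * 0 / v n)"
      using C(3)[of 0 "v n" N] v[of n] by auto
    then show "\<exists>U. U \<in> null_sets lborel \<and> {s \<in> K. isol s N 0 (v n)} \<subseteq> U" by (intro exI[of _ U]) (auto simp: null_sets_def)
  qed
  then have U: "\<And>N n. U N n \<in> null_sets lborel" "\<And>N n. {s \<in> K. isol s N 0 (v n)} \<subseteq> U N n" by blast+
  show thesis
  proof (rule that[of "\<Union>N. \<Union>n. U N n"])
    show "(\<Union>N. \<Union>n. U N n) \<in> null_sets lborel" using U(1) by (intro null_sets_UN) auto
    fix s i j k0 assume A: "s \<in> K" "i \<in> {1..d - 1}" "j \<in> {1..d - 1}" "(TT s ^^ k0) (xx' s j) = xx s i"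
    define k where "k = (LEAST k. (TT s ^^ k) (xx' s j) \<in> DD s)"
    have "(TT s ^^ k0) (xx' s j) \<in> DD s" using A by auto
    then have k: "(TT s ^^ k) (xx' s j) \<in> DD s" unfolding k_def by (rule LeastI)
    have nk: "(TT s ^^ t) (xx' s j) \<notin> DD s" if "t < k" for t using not_less_Least[OF that[unfolded k_def]] .
    define V where "V = insert 1 ((\<lambda>(t, x). \<bar>(TT s ^^ t) (xx' s j) - x\<bar>) ` ({..<k} \<times> DD s))"
    have fin: "finite V" "V \<noteq> {}" by (auto simp: V_def)
    have "0 < Min V" using fin nk by (subst Min_gr_iff) (auto simp: V_def)
    then obtain n where n: "1 / real (Suc n) < Min V" using reals_Archimedean[of "Min V"] by (auto simp: inverse_eq_divide)
    have "\<not> near (DD s) (v n) ((TT s ^^ t) (xx' s j))" if "t < k" for t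
    proof
      assume "near (DD s) (v n) ((TT s ^^ t) (xx' s j))"
      then obtain x where x: "x \<in> DD s" "\<bar>(TT s ^^ t) (xx' s j) - x\<bar> \<le> v n" by (auto simp: near_def)
      have "\<bar>(TT s ^^ t) (xx' s j) - x\<bar> \<in> V" unfolding V_def using x(1) that by (intro insertI2 image_eqI[of _ _ "(t, x)"]) auto
      then have "Min V \<le> \<bar>(TT s ^^ t) (xx' s j) - x\<bar>" using fin by (intro Min_le)
      then show False using x(2) n v(3)[of n] by linarith
    qed
    then have "hits s j k 0 (v n)" using k by (auto simp: hits_def near_def)
    then have "isol s (Suc k) 0 (v n)" unfolding isolated_iff_hits using A(3) by blast
    then show "s \<in> (\<Union>N. \<Union>n. U N n)" using U(2)[of "Suc k" n] A(1) by blast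
  qed
qed

lemma bad_cover:
  assumes eps: "0 < \<epsilon>"
  obtains U where "U \<in> sets borel" "emeasure lborel U \<le> ennreal \<epsilon>"
    "\<And>s. s \<in> K \<Longrightarrow> \<not> uniquely_ergodic_on (iet_domain d (\<lambda>i. s ^ i)) (TT s) \<Longrightarrow> s \<in> U"
proof -
  obtain Z where Z: "Z \<in> null_sets lborel"
    "\<And>s i j k. s \<in> K \<Longrightarrow> i \<in> {1..d - 1} \<Longrightarrow> j \<in> {1..d - 1} \<Longrightarrow> (TT s ^^ k) (xx' s j) = xx s i \<Longrightarrow> s \<in> Z"
    using connections_null by blast
  obtain C Wm where C: "0 < C" "0 < Wm"
    "\<And>N \<mu> W. 0 \<le> \<mu> \<Longrightarrow> 8 * \<mu> \<le> W \<Longrightarrow> 0 < W \<Longrightarrow> W \<le> Wm \<Longrightarrow>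
       \<exists>U\<in>sets borel. {s \<in> K. isol s N \<mu> W} \<subseteq> U \<and> emeasure lborel U \<le> ennreal (C * \<mu> / W)"
    using isolated_cover by blast
  define p where "p = 4 * (d - 1) + 12"
  define M where "M = p * ((d - 1) + (d - 1) + 1)"
  \<comment> \<open>\<open>M\<close> depends on \<open>d\<close> only, so \<open>A\<close> can be
    chosen to make \<open>M\<close> sets of measure at most \<open>C / A\<close> add up to at most
    \<open>\<epsilon>\<close>; 8 is the ratio of scales required by
    \<open>isolated_cover\<close>.\<close>
  define A where "A = max 8 (real M * C / \<epsilon>)"
  \<comment> \<open>The top scale is \<open>c / (N + 1)\<close>, and the length bound of
    \<open>short_connection_isolated\<close>, where \<open>card D' + 1 = d\<close>, becomes
    \<open>2 * c * d < LL s\<close>; this follows from \<open>4 * d * c \<le> w0\<close>.\<close>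
  define c where "c = min (w0 / (4 * real d)) Wm"
  define w where "w N i = c * A ^ i / (A ^ M * real (N + 1))" for N i :: nat
  have d0: "0 < real d" using d2 by simp
  have A: "8 \<le> A" "real M * (C / A) \<le> \<epsilon>"
  proof -
    show "8 \<le> A" by (simp add: A_def)
    then show "real M * (C / A) \<le> \<epsilon>" using eps max.cobounded2[of "real M * C / \<epsilon>" 8] unfolding A_def[symmetric] by (simp add: field_simps)
  qed
  have c: "0 < c" "c \<le> Wm" "4 * real d * c \<le> w0" using C(2) w0(1) d0 by (auto simp: c_def min_def field_simps)
  have w_pos: "0 < w N i" for N i using A c by (simp add: w_def)
  have w_Suc: "w N (Suc i) = A * w N i" for N i by (simp add: w_def)
  have w_M: "w N M = c / real (N + 1)" for N using A by (simp add: w_def)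
  have w_le: "w N i \<le> c" if "i \<le> M" for N i
  proof -
    have "w N i \<le> w N M" unfolding w_def using that A c by (intro divide_right_mono mult_left_mono power_increasing) auto
    also have "\<dots> \<le> c" unfolding w_M using c by (simp add: field_simps)
    finally show ?thesis .
  qed
  define U where "U N i = (SOME U. U \<in> sets borel \<and> {s \<in> K. isol s N (w N i) (w N (Suc i))} \<subseteq> U \<and> emeasure lborel U \<le> ennreal (C / A))" for N i
  have "U N i \<in> sets borel \<and> {s \<in> K. isol s N (w N i) (w N (Suc i))} \<subseteq> U N i \<and> emeasure lborel (U N i) \<le> ennreal (C / A)"
    if i: "i < M" for N i
    unfolding U_def
  proof (rule someI_ex)
    have "C * w N i / w N (Suc i) = C / A" using w_pos[of N i] by (simp add: w_Suc)
    moreover have "8 * w N i \<le> w N (Suc i)" unfolding w_Suc using A w_pos[of N i] by simp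
    ultimately show "\<exists>U. U \<in> sets borel \<and> {s \<in> K. isol s N (w N i) (w N (Suc i))} \<subseteq> U \<and> emeasure lborel U \<le> ennreal (C / A)"
      using C(3)[of "w N i" "w N (Suc i)" N] w_pos[of N i] w_pos[of N "Suc i"] w_le[of "Suc i" N] i c(2) by auto
  qed
  then have U: "\<And>N i. i < M \<Longrightarrow> U N i \<in> sets borel"
    "\<And>N i. i < M \<Longrightarrow> {s \<in> K. isol s N (w N i) (w N (Suc i))} \<subseteq> U N i"
    "\<And>N i. i < M \<Longrightarrow> emeasure lborel (U N i) \<le> ennreal (C / A)"
    by blast+
  define UU where "UU N = (\<Union>i<M. U N i)" for N
  have UU: "UU N \<in> sets borel" for N unfolding UU_def using U(1) by auto
  have UU_le: "emeasure lborel (UU N) \<le> ennreal \<epsilon>" for N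
  proof -
    have "emeasure lborel (UU N) \<le> (\<Sum>i<M. emeasure lborel (U N i))"
      unfolding UU_def by (rule emeasure_subadditive_finite) (use U(1) in auto)
    also have "\<dots> \<le> (\<Sum>i<M. ennreal (C / A))" by (rule sum_mono) (use U(3) in auto)
    also have "\<dots> = ennreal (\<Sum>i<M. C / A)" using A C by (intro sum_ennreal) simp
    also have "\<dots> \<le> ennreal \<epsilon>" using A by (intro ennreal_leI) simp
    finally show ?thesis .
  qed
  \<comment> \<open>\<open>V n\<close> grows with \<open>n\<close> and lies in \<open>UU n\<close>;
    so the parameters lying in \<open>UU N\<close> for all large \<open>N\<close> have measure at
    most \<open>\<epsilon>\<close>.\<close>
  define V where "V n = (\<Inter>N\<in>{n..}. UU N)" for n
  have V: "V n \<in> sets lborel" for n unfolding V_def using UU by (auto intro!: sets.countable_INT')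
  have "emeasure lborel (\<Union>n. V n) = (SUP n. emeasure lborel (V n))"
    by (rule SUP_emeasure_incseq[symmetric]) (use V in \<open>auto simp: V_def incseq_def le_fun_def\<close>)
  also have "\<dots> \<le> ennreal \<epsilon>"
  proof (rule SUP_least)
    fix n
    have "emeasure lborel (V n) \<le> emeasure lborel (UU n)" using UU by (intro emeasure_mono) (auto simp: V_def)
    then show "emeasure lborel (V n) \<le> ennreal \<epsilon>" using UU_le[of n] by simp
  qed
  finally have VV: "emeasure lborel (\<Union>n. V n) \<le> ennreal \<epsilon>" .
  show thesis
  proof (rule that[of "(\<Union>n. V n) \<union> Z"])
    show "(\<Union>n. V n) \<union> Z \<in> sets borel" using V Z(1) by (auto simp: null_sets_def)
    show "emeasure lborel ((\<Union>n. V n) \<union> Z) \<le> ennreal \<epsilon>"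
      using VV V by (subst emeasure_Un_null_set[OF _ Z(1)]) auto
    fix s assume s: "s \<in> K" and nue: "\<not> uniquely_ergodic_on (iet_domain d (\<lambda>i. s ^ i)) (TT s)"
    note s0 = K_pos[OF s]
    show "s \<in> (\<Union>n. V n) \<union> Z"
    proof (rule ccontr)
      assume out: "s \<notin> (\<Union>n. V n) \<union> Z"
      have "exch 0 (LL s) w0 (TT s) (iet d (inv \<sigma>) ((\<lambda>i. s ^ i) \<circ> inv \<sigma>)) (DD s) (DD' s)"
        by (rule iet_data.exch_iet[OF data[OF s0] w0(1) w0(2)[OF s], unfolded L_eq[OF s0]]) (use Z(2)[OF s] out in blast)+
      then interpret E: exch 0 "LL s" w0 "TT s" "iet d (inv \<sigma>) ((\<lambda>i. s ^ i) \<circ> inv \<sigma>)" "DD s" "DD' s" .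
      have ex: "exch 0 (LL s) w0 (TT s) (iet d (inv \<sigma>) ((\<lambda>i. s ^ i) \<circ> inv \<sigma>)) (DD s) (DD' s)" by (rule E.exch_axioms)
      have trap: "no_trap 0 (LL s) (TT s) (DD s)"
        by (rule iet_data.no_trap_iet[OF data[OF s0], unfolded L_eq[OF s0], OF ex])
      have cd: "card (DD s) = d - 1"
        by (subst card_image) (auto simp: inj_on_def intro!: iet_data.endpt_inj[OF data[OF s0]])
      have cd': "card (DD' s) = d - 1"
        by (subst card_image) (auto simp: inj_on_def intro!: iet_data.endpt'_inj[OF data[OF s0]])
      \<comment> \<open>\<open>e / H\<close> stays below the lowest scale
        \<open>c / (A ^ M * (H + 1))\<close> as soon as \<open>H + 1 < 2 * H\<close>; hence the 2
        here and the bound \<open>H \<ge> 2\<close> below.\<close>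
      define e where "e = c / (2 * A ^ M)"
      have e: "0 < e" using c A by (simp add: e_def)
      have "\<exists>H\<ge>N0. iet_data.well_separated d \<sigma> (\<lambda>i. s ^ i) e H" for N0
      proof (rule ccontr)
        assume no: "\<not> ?thesis"
        have "s \<in> UU H" if H: "H \<ge> max N0 2" for H
        proof -
          have "\<not> iet_data.well_separated d \<sigma> (\<lambda>i. s ^ i) e H" using no H by auto
          then obtain x' k where k: "x' \<in> DD' s" "k < H" "near (DD s) (e / H) ((TT s ^^ k) x')"
            unfolding iet_data.well_separated_def[OF data[OF s0]] by blast
          have lt: "e / H < w H 0"
          proof -
            have "real (H + 1) < 2 * real H" using H by auto
            then have "A ^ M * real (H + 1) < A ^ M * (2 * real H)" using A by (intro mult_strict_left_mono) auto
            then have "c / (A ^ M * (2 * real H)) < c / (A ^ M * real (H + 1))"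
              using c A H by (intro divide_strict_left_mono mult_pos_pos) auto
            then show ?thesis by (simp add: e_def w_def mult.assoc mult.left_commute)
          qed
          have LLw: "w0 \<le> LL s" using xx_sep[OF s, of 0 d] d2 by (simp add: iet_endpt_def)
          have "\<exists>i<M. isol s H (w H i) (w H (Suc i))"
          proof (rule E.short_connection_isolated[of "w H" p M H x' k "e / H"])
            show "2 * w H i \<le> w H (Suc i)" for i unfolding w_Suc using A w_pos[of H i] by simp
            show "0 < w H 0" by (rule w_pos)
            show "p = 4 * card (DD s) + 12" "M = p * (card (DD s) + card (DD' s) + 1)"
              unfolding cd cd' by (simp_all add: p_def M_def)
            show "w H M < w0"
            proof -
              have "1 * c < 4 * real d * c" using c d2 by (intro mult_strict_right_mono) auto
              then show ?thesis using w_le[of M H] c(3) by simp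
            qed
            have "real (H + 1) * (2 * w H M * (card (DD' s) + 1)) = 2 * c * real d"
              unfolding w_M cd' using d2 by (simp add: field_simps of_nat_diff)
            also have "\<dots> < 4 * real d * c" using c d0 by simp
            finally show "real (H + 1) * (2 * w H M * (card (DD' s) + 1)) < LL s - 0" using c(3) LLw by linarith
          qed (use k lt trap in auto)
          then show ?thesis unfolding UU_def using U(2)[of _ H] s by blast
        qed
        then have "s \<in> V (max N0 2)" by (simp add: V_def)
        then show False using out by blast
      qed
      then have "uniquely_ergodic_on (iet_domain d (\<lambda>i. s ^ i)) (TT s)"
        by (rule iet_data.uniquely_ergodic_iet[OF data[OF s0], unfolded L_eq[OF s0], OF ex w0(1) e])
      then show False using nue by contradiction
    qed
  qed
qed

lemma negligible_bad: "negligible {s \<in> K. \<not> uniquely_ergodic_on (iet_domain d (\<lambda>i. s ^ i)) (TT s)}"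
  unfolding negligible_outer_le
proof (intro allI impI)
  fix e :: real assume e: "0 < e"
  obtain U where U: "U \<in> sets borel" "emeasure lborel U \<le> ennreal e"
    "\<And>s. s \<in> K \<Longrightarrow> \<not> uniquely_ergodic_on (iet_domain d (\<lambda>i. s ^ i)) (TT s) \<Longrightarrow> s \<in> U"
    using bad_cover[OF e] by blast
  have "emeasure lebesgue U \<le> ennreal e" using U(1,2) by simp
  moreover have "U \<in> sets lebesgue" using U(1) by simp
  ultimately have "U \<in> lmeasurable" "measure lebesgue U \<le> e"
    using e by (auto simp: measure_def fmeasurable_def intro!: enn2real_leI intro: le_less_trans)
  then show "\<exists>T. {s \<in> K. \<not> uniquely_ergodic_on (iet_domain d (\<lambda>i. s ^ i)) (TT s)} \<subseteq> T \<and> T \<in> lmeasurable \<and> measure lebesgue T \<le> e"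
    using U(3) by blast
qed

end

theorem corollary0p6:
  fixes d :: nat and \<sigma> :: "nat \<Rightarrow> nat"
  assumes "d \<ge> 2"
    and "irreducible_perm d \<sigma>"
  shows "AE s in (lebesgue :: real measure). s > 0 \<longrightarrow>
           uniquely_ergodic_on (iet_domain d (\<lambda>i. s ^ i)) (iet d \<sigma> (\<lambda>i. s ^ i))"
proof -
  \<comment> \<open>Compact parameter windows that exhaust the positive reals; the constants of the
    family are uniform on each of them.\<close>
  let ?B = "\<lambda>n :: nat. {s \<in> {1 / real (Suc n)..real (Suc n)}. \<not> uniquely_ergodic_on (iet_domain d (\<lambda>i. s ^ i)) (iet d \<sigma> (\<lambda>i. s ^ i))}"
  have fam: "iet_family d \<sigma> (1 / real (Suc n)) (real (Suc n))" for n
  proof unfold_locales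
    have "1 / real (Suc n) \<le> 1" by simp
    then show "1 / real (Suc n) \<le> real (Suc n)" by linarith
  qed (use assms in auto)
  have "negligible (\<Union>n. ?B n)"
    by (rule negligible_countable_Union) (use iet_family.negligible_bad[OF fam] in auto)
  then have "AE s in lebesgue. s \<notin> (\<Union>n. ?B n)"
    unfolding negligible_iff_null_sets by (rule AE_not_in)
  then show ?thesis
  proof eventually_elim
    case (elim s)
    show ?case
    proof
      assume s: "0 < s"
      obtain n1 :: nat where n1: "s < real n1" using reals_Archimedean2 by blast
      obtain n2 :: nat where n2: "1 / s < real n2" using reals_Archimedean2 by blast
      define n where "n = max n1 n2"
      have "s \<le> real (Suc n)" "1 / s \<le> real (Suc n)" using n1 n2 by (auto simp: n_def)
      then have "s \<in> {1 / real (Suc n)..real (Suc n)}" using s by (auto simp: field_simps)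
      then show "uniquely_ergodic_on (iet_domain d (\<lambda>i. s ^ i)) (iet d \<sigma> (\<lambda>i. s ^ i))" using elim by blast
    qed
  qed
qed

end
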